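(* Let $\Gamma$ be a countably infinite group, let $B\curvearrowright(X,\mu)$ be a free p.m.p. action of a nontrivial countable group $B$ on a standard probability space, and let $\mathcal{B}$ be its orbit equivalence relation. Assume that $\Gamma$ has no nontrivial finite normal subgroups, and that the Bernoulli shift action of $\Gamma$ on $(X^\Gamma,\mu^\Gamma)$ is $\mathcal{G}_{\mathrm{ctble}}$-cocycle superrigid. Then $$\mathrm{Aut}(\mathcal{B}\wr\Gamma)=\mathrm{Aut}(\Gamma)^*\cdot\Big(\mathrm{Aut}_\Gamma\big(\textstyle\bigoplus_\Gamma\mathcal{B}\big)\cdot[\mathcal{B}\wr\Gamma]\Big),$$ and $\mathrm{Aut}_\Gamma(\bigoplus_\Gamma\mathcal{B})\cdot[\mathcal{B}\wr\Gamma]$ is a normal subgroup of $\mathrm{Aut}(\mathcal{B}\wr\Gamma)$. In addition, $\mathrm{Aut}_\Gamma(\bigoplus_\Gamma\mathcal{B})\cap[\mathcal{B}\wr\Gamma]=Z(\Gamma)$, where $Z(\Gamma)$ is the center of $\Gamma$, naturally viewed as a subgroup of $[\mathcal{B}\wr\Gamma]$ (via $\gamma\mapsto(x\mapsto\gamma.x)$).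
   Context: P.m.p. means probability measure preserving; free means essentially free. $B\wr\Gamma$ is the restricted regular wreath product, i.e. the semidirect product of $\bigoplus_\Gamma B$ and $\Gamma$ with $\gamma b\gamma^{-1}=\gamma.b$, $(\gamma.b)_\delta=b_{\gamma^{-1}\delta}$. It acts on $(X^\Gamma,\mu^\Gamma)$ by the wreath product action determined by $(b.x)_\delta=b_\delta.x_\delta$ and $(\gamma.x)_\delta=x_{\gamma^{-1}\delta}$ for $b\in\bigoplus_\Gamma B$, $\gamma,\delta\in\Gamma$; the restriction to $\Gamma$ is the Bernoulli shift. $\mathcal{B}\wr\Gamma$ is identified with the orbit equivalence relation of $B\wr\Gamma\curvearrowright(X^\Gamma,\mu^\Gamma)$, and $\bigoplus_\Gamma\mathcal{B}$ with the equivalence relation on $X^\Gamma$ of all pairs $(x,y)$ with $(x_\gamma,y_\gamma)\in\mathcal{B}$ for all $\gamma\in\Gamma$ and $x_\gamma=y_\gamma$ for all but finitely many $\gamma$. For a p.m.p. equivalence relation $\mathcal{R}$ on $(X^\Gamma,\mu^\Gamma)$, $\mathrm{Aut}(\mathcal{R})$ is the group of all $T\in\mathrm{Aut}(X^\Gamma,\mu^\Gamma)$ (measure preserving automorphisms modulo null sets) that are automorphisms of $\mathcal{R}$ (after discarding a null set, $(x,y)\in\mathcal{R}\iff(Tx,Ty)\in\mathcal{R}$), and $[\mathcal{R}]$ is the full group, i.e. the group of those $T$ with $(Tx,x)\in\mathcal{R}$ for a.e. $x$. $\mathrm{Aut}_\Gamma(\bigoplus_\Gamma\mathcal{B})$ is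 the group of all $\Gamma$-equivariant elements of $\mathrm{Aut}(\bigoplus_\Gamma\mathcal{B})$; it is a subgroup of $\mathrm{Aut}(\mathcal{B}\wr\Gamma)$. For $\varphi\in\mathrm{Aut}(\Gamma)$ define $\varphi^*:X^\Gamma\to X^\Gamma$ by $\varphi^*(x)_\gamma=x_{\varphi^{-1}(\gamma)}$; then $\mathrm{Aut}(\Gamma)^*=\{\varphi^*:\varphi\in\mathrm{Aut}(\Gamma)\}\le\mathrm{Aut}(\mathcal{B}\wr\Gamma)$. For a Polish group $L$, a measurable $L$-valued cocycle of a p.m.p. action $\Gamma\curvearrowright (W,\omega)$ is a measurable map $c:\Gamma\times W\to L$ with $c(\gamma_1\gamma_0,w)=c(\gamma_1,\gamma_0.w)c(\gamma_0,w)$ for all $\gamma_0,\gamma_1$ and a.e. $w$. The action is $L$-cocycle superrigid if for every such $c$ there are a group homomorphism $\rho:\Gamma\to L$ and a measurable $f:W\to L$ with $c(\gamma,w)=f(\gamma.w)\rho(\gamma)f(w)^{-1}$ for all $\gamma$ and a.e. $w$; it is $\mathcal{G}_{\mathrm{ctble}}$-cocycle superrigid if it is $L$-cocycle superrigid for every countable discrete group $L$. *)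

theory Defs
  imports "HOL-Algebra.Algebra" "HOL-Probability.Probability"
begin

section \<open>Standard probability spaces and p.m.p. actions\<close>

text \<open>The Polish topology lives on \<^term>\<open>space M\<close>, not on the whole type.\<close>

definition standard_prob_space :: "'x measure \<Rightarrow> bool" where
  "standard_prob_space M \<longleftrightarrow> prob_space M \<and>
     (\<exists>T. completely_metrizable_space T \<and> second_countable T \<and> topspace T = space M \<and>
          sets M = sigma_sets (space M) {U. openin T U})"

definition pmp_action ::
  "('g, 'm) monoid_scheme \<Rightarrow> 'x measure \<Rightarrow> ('g \<Rightarrow> 'x \<Rightarrow> 'x) \<Rightarrow> bool" where
  "pmp_action G M \<alpha> \<longleftrightarrow> group_action G (space M) \<alpha> \<and>
     (\<forall>g\<in>carrier G. \<alpha> g \<in> measurable M M \<and> distr M M (\<alpha> g) = M)"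

definition ess_free ::
  "('g, 'm) monoid_scheme \<Rightarrow> 'x measure \<Rightarrow> ('g \<Rightarrow> 'x \<Rightarrow> 'x) \<Rightarrow> bool" where
  "ess_free G M \<alpha> \<longleftrightarrow> (\<forall>g\<in>carrier G. g \<noteq> \<one>\<^bsub>G\<^esub> \<longrightarrow> (AE x in M. \<alpha> g x \<noteq> x))"

definition orbit_eqrel ::
  "('g, 'm) monoid_scheme \<Rightarrow> 'x measure \<Rightarrow> ('g \<Rightarrow> 'x \<Rightarrow> 'x) \<Rightarrow> ('x \<times> 'x) set" where
  "orbit_eqrel G M \<alpha> = {(x, y). x \<in> space M \<and> y \<in> orbit G \<alpha> x}"


section \<open>Automorphisms modulo null sets\<close>

text \<open>
  An element of \<open>Aut(W)\<close> is a class, under almost everywhere equality, of measure preserving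
  maps that have a measure preserving inverse almost everywhere.
\<close>

definition mp_autos :: "'w measure \<Rightarrow> ('w \<Rightarrow> 'w) set" where
  "mp_autos W = {T \<in> measurable W W. distr W W T = W \<and>
     (\<exists>S\<in>measurable W W. distr W W S = W \<and>
        (AE x in W. S (T x) = x) \<and> (AE x in W. T (S x) = x))}"

definition ae_rel :: "'w measure \<Rightarrow> (('w \<Rightarrow> 'w) \<times> ('w \<Rightarrow> 'w)) set" where
  "ae_rel W = {(S, T). S \<in> mp_autos W \<and> T \<in> mp_autos W \<and> (AE x in W. S x = T x)}"

definition ae_class :: "'w measure \<Rightarrow> ('w \<Rightarrow> 'w) \<Rightarrow> ('w \<Rightarrow> 'w) set" where
  "ae_class W T = ae_rel W `` {T}"

definition Aut_mp :: "'w measure \<Rightarrow> ('w \<Rightarrow> 'w) set monoid" where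
  "Aut_mp W = \<lparr>carrier = mp_autos W // ae_rel W,
               monoid.mult = (\<lambda>A B. \<Union>S\<in>A. \<Union>T\<in>B. ae_class W (S \<circ> T)),
               monoid.one = ae_class W id\<rparr>"

definition Aut_rel :: "'w measure \<Rightarrow> ('w \<times> 'w) set \<Rightarrow> ('w \<Rightarrow> 'w) set set" where
  "Aut_rel W R = {ae_class W T | T. T \<in> mp_autos W \<and>
     (\<exists>N\<in>null_sets W. \<forall>x\<in>space W - N. \<forall>y\<in>space W - N. (x, y) \<in> R \<longleftrightarrow> (T x, T y) \<in> R)}"

definition full_group :: "'w measure \<Rightarrow> ('w \<times> 'w) set \<Rightarrow> ('w \<Rightarrow> 'w) set set" where
  "full_group W R = {ae_class W T | T. T \<in> mp_autos W \<and> (AE x in W. (T x, x) \<in> R)}"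

definition Aut_rel_equivariant ::
  "('g, 'm) monoid_scheme \<Rightarrow> 'w measure \<Rightarrow> ('g \<Rightarrow> 'w \<Rightarrow> 'w) \<Rightarrow> ('w \<times> 'w) set
    \<Rightarrow> ('w \<Rightarrow> 'w) set set" where
  "Aut_rel_equivariant G W \<alpha> R = {ae_class W T | T. T \<in> mp_autos W \<and> ae_class W T \<in> Aut_rel W R \<and>
     (\<forall>g\<in>carrier G. AE x in W. T (\<alpha> g x) = \<alpha> g (T x))}"


section \<open>Cocycle superrigidity\<close>

definition cocycle ::
  "('g, 'm) monoid_scheme \<Rightarrow> 'w measure \<Rightarrow> ('g \<Rightarrow> 'w \<Rightarrow> 'w) \<Rightarrow> ('l, 'n) monoid_scheme
    \<Rightarrow> ('g \<times> 'w \<Rightarrow> 'l) \<Rightarrow> bool" where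
  "cocycle G W \<alpha> L c \<longleftrightarrow>
     c \<in> measurable (count_space (carrier G) \<Otimes>\<^sub>M W) (count_space (carrier L)) \<and>
     (\<forall>g0\<in>carrier G. \<forall>g1\<in>carrier G.
        AE w in W. c (g1 \<otimes>\<^bsub>G\<^esub> g0, w) = c (g1, \<alpha> g0 w) \<otimes>\<^bsub>L\<^esub> c (g0, w))"

definition cocycle_superrigid ::
  "('g, 'm) monoid_scheme \<Rightarrow> 'w measure \<Rightarrow> ('g \<Rightarrow> 'w \<Rightarrow> 'w) \<Rightarrow> ('l, 'n) monoid_scheme \<Rightarrow> bool" where
  "cocycle_superrigid G W \<alpha> L \<longleftrightarrow> (\<forall>c. cocycle G W \<alpha> L c \<longrightarrow>
     (\<exists>\<rho>\<in>hom G L. \<exists>f\<in>measurable W (count_space (carrier L)).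
        \<forall>g\<in>carrier G. AE w in W.
          c (g, w) = f (\<alpha> g w) \<otimes>\<^bsub>L\<^esub> \<rho> g \<otimes>\<^bsub>L\<^esub> inv\<^bsub>L\<^esub> f w))"

text \<open>
  A single proposition cannot quantify over the element types of all countable groups, so the
  target groups range over those whose elements are natural numbers. Up to isomorphism these are
  all countable groups; lemma \<open>Gctble_cocycle_superrigidD\<close> transfers the property to any of them.
\<close>

definition Gctble_cocycle_superrigid ::
  "('g, 'm) monoid_scheme \<Rightarrow> 'w measure \<Rightarrow> ('g \<Rightarrow> 'w \<Rightarrow> 'w) \<Rightarrow> bool" where
  "Gctble_cocycle_superrigid G W \<alpha> \<longleftrightarrow>
     (\<forall>L :: nat monoid. group L \<longrightarrow> cocycle_superrigid G W \<alpha> L)"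


lemma Gctble_cocycle_superrigidD:
  fixes L :: "('l, 'k) monoid_scheme"
  assumes sr: "Gctble_cocycle_superrigid G W \<alpha>"
    and act: "group_action G (space W) \<alpha>" "\<And>g. g \<in> carrier G \<Longrightarrow> \<alpha> g \<in> measurable W W"
    and L: "group L" "countable (carrier L)"
  shows "cocycle_superrigid G W \<alpha> L"
  unfolding cocycle_superrigid_def
proof (intro allI impI)
  fix c assume c: "cocycle G W \<alpha> L c"
  interpret L: Group.group L by fact
  interpret A: group_action G "space W" \<alpha> by fact
  interpret G: Group.group G using A.group_hom by (simp add: group_hom_def)
  define e where "e = to_nat_on (carrier L)"
  define d where "d = from_nat_into (carrier L)"
  have de[simp]: "d (e x) = x" if "x \<in> carrier L" for x
    using L(2) that by (simp add: d_def e_def)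
  define L' :: "nat monoid" where "L' = \<lparr>carrier = e ` carrier L,
    monoid.mult = (\<lambda>x y. e (d x \<otimes>\<^bsub>L\<^esub> d y)), monoid.one = e \<one>\<^bsub>L\<^esub>\<rparr>"
  have carr': "carrier L' = e ` carrier L" and mult': "x \<otimes>\<^bsub>L'\<^esub> y = e (d x \<otimes>\<^bsub>L\<^esub> d y)"
    and one': "\<one>\<^bsub>L'\<^esub> = e \<one>\<^bsub>L\<^esub>" for x y
    by (simp_all add: L'_def)
  have dL: "d x \<in> carrier L" if "x \<in> carrier L'" for x
    using that by (auto simp: carr')
  have gL': "Group.group L'"
  proof (rule groupI)
    fix x assume "x \<in> carrier L'"
    then obtain a where a: "a \<in> carrier L" "x = e a" by (auto simp: carr')
    then show "\<exists>y\<in>carrier L'. y \<otimes>\<^bsub>L'\<^esub> x = \<one>\<^bsub>L'\<^esub>"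
      by (intro bexI[of _ "e (inv\<^bsub>L\<^esub> a)"]) (auto simp: carr' mult' one')
  qed (auto simp: carr' mult' one' L.m_assoc)
  interpret L': Group.group L' by fact
  have inv': "d (inv\<^bsub>L'\<^esub> x) = inv\<^bsub>L\<^esub> (d x)" if "x \<in> carrier L'" for x
  proof -
    from that obtain a where a: "a \<in> carrier L" "x = e a" by (auto simp: carr')
    have "inv\<^bsub>L'\<^esub> x = e (inv\<^bsub>L\<^esub> a)"
      by (rule L'.inv_equality) (use a in \<open>auto simp: carr' mult' one'\<close>)
    then show ?thesis using a by simp
  qed
  have dmult: "d (x \<otimes>\<^bsub>L'\<^esub> y) = d x \<otimes>\<^bsub>L\<^esub> d y" if "x \<in> carrier L'" "y \<in> carrier L'" for x y
    using dL that by (simp add: mult')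
  have cm: "c \<in> measurable (count_space (carrier G) \<Otimes>\<^sub>M W) (count_space (carrier L))"
    using c by (simp add: cocycle_def)
  have cin: "c (g, w) \<in> carrier L" if "g \<in> carrier G" "w \<in> space W" for g w
    using measurable_space[OF cm, of "(g, w)"] that by (simp add: space_pair_measure)
  have \<alpha>in: "\<alpha> g w \<in> space W" if "g \<in> carrier G" "w \<in> space W" for g w
    using measurable_space[OF act(2)] that by blast
  have em: "e \<in> measurable (count_space (carrier L)) (count_space (carrier L'))"
    by (auto simp: carr')
  have "cocycle G W \<alpha> L' (e \<circ> c)"
    unfolding cocycle_def
  proof (intro conjI ballI)
    show "e \<circ> c \<in> measurable (count_space (carrier G) \<Otimes>\<^sub>M W) (count_space (carrier L'))"
      using measurable_comp[OF cm em] .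
    fix g0 g1 assume g: "g0 \<in> carrier G" "g1 \<in> carrier G"
    have "AE w in W. c (g1 \<otimes>\<^bsub>G\<^esub> g0, w) = c (g1, \<alpha> g0 w) \<otimes>\<^bsub>L\<^esub> c (g0, w)"
      using c g by (auto simp: cocycle_def)
    then show "AE w in W. (e \<circ> c) (g1 \<otimes>\<^bsub>G\<^esub> g0, w) = (e \<circ> c) (g1, \<alpha> g0 w) \<otimes>\<^bsub>L'\<^esub> (e \<circ> c) (g0, w)"
      by (rule AE_mp) (intro AE_I2 impI, simp add: mult' cin \<alpha>in g)
  qed
  with sr gL' obtain \<rho> f where \<rho>: "\<rho> \<in> hom G L'"
    and f: "f \<in> measurable W (count_space (carrier L'))"
    and eq: "\<And>g. g \<in> carrier G \<Longrightarrow> AE w in W.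
      (e \<circ> c) (g, w) = f (\<alpha> g w) \<otimes>\<^bsub>L'\<^esub> \<rho> g \<otimes>\<^bsub>L'\<^esub> inv\<^bsub>L'\<^esub> f w"
    unfolding Gctble_cocycle_superrigid_def cocycle_superrigid_def by meson
  have fin: "f w \<in> carrier L'" if "w \<in> space W" for w
    using measurable_space[OF f that] by simp
  have \<rho>in: "\<rho> g \<in> carrier L'" if "g \<in> carrier G" for g
    using \<rho> that by (auto simp: hom_def)
  show "\<exists>\<rho>\<in>hom G L. \<exists>f\<in>measurable W (count_space (carrier L)).
      \<forall>g\<in>carrier G. AE w in W. c (g, w) = f (\<alpha> g w) \<otimes>\<^bsub>L\<^esub> \<rho> g \<otimes>\<^bsub>L\<^esub> inv\<^bsub>L\<^esub> f w"
  proof (intro bexI ballI)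
    show "d \<circ> \<rho> \<in> hom G L"
      using \<rho> by (auto simp: hom_def dL dmult Pi_iff)
    show "d \<circ> f \<in> measurable W (count_space (carrier L))"
      by (rule measurable_comp[OF f]) (auto simp: dL)
    fix g assume g: "g \<in> carrier G"
    show "AE w in W. c (g, w) = (d \<circ> f) (\<alpha> g w) \<otimes>\<^bsub>L\<^esub> (d \<circ> \<rho>) g \<otimes>\<^bsub>L\<^esub> inv\<^bsub>L\<^esub> (d \<circ> f) w"
      using eq[OF g]
    proof (rule AE_mp, intro AE_I2 impI)
      fix w assume w: "w \<in> space W"
        and h: "(e \<circ> c) (g, w) = f (\<alpha> g w) \<otimes>\<^bsub>L'\<^esub> \<rho> g \<otimes>\<^bsub>L'\<^esub> inv\<^bsub>L'\<^esub> f w"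
      have "c (g, w) = d ((e \<circ> c) (g, w))" by (simp add: cin g w)
      also have "\<dots> = (d \<circ> f) (\<alpha> g w) \<otimes>\<^bsub>L\<^esub> (d \<circ> \<rho>) g \<otimes>\<^bsub>L\<^esub> inv\<^bsub>L\<^esub> (d \<circ> f) w"
        unfolding h using g w by (simp add: dmult inv' fin \<alpha>in \<rho>in)
      finally show "c (g, w) = (d \<circ> f) (\<alpha> g w) \<otimes>\<^bsub>L\<^esub> (d \<circ> \<rho>) g \<otimes>\<^bsub>L\<^esub> inv\<^bsub>L\<^esub> (d \<circ> f) w" .
    qed
  qed
qed


section \<open>Wreath products\<close>

definition shift_family :: "('g, 'm) monoid_scheme \<Rightarrow> 'g \<Rightarrow> ('g \<Rightarrow> 'b) \<Rightarrow> 'g \<Rightarrow> 'b" where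
  "shift_family G g b = (\<lambda>d\<in>carrier G. b (inv\<^bsub>G\<^esub> g \<otimes>\<^bsub>G\<^esub> d))"

text \<open>The pair \<open>(b, g)\<close> stands for the element \<open>b g\<close> of the semidirect product.\<close>

definition wreath ::
  "('b, 'n) monoid_scheme \<Rightarrow> ('g, 'm) monoid_scheme \<Rightarrow> (('g \<Rightarrow> 'b) \<times> 'g) monoid" where
  "wreath B G = (let S = sum_group (carrier G) (\<lambda>_. B) in
     \<lparr>carrier = carrier S \<times> carrier G,
      monoid.mult = (\<lambda>(b, g) (b', g'). (b \<otimes>\<^bsub>S\<^esub> shift_family G g b', g \<otimes>\<^bsub>G\<^esub> g')),
      monoid.one = (\<one>\<^bsub>S\<^esub>, \<one>\<^bsub>G\<^esub>)\<rparr>)"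

definition bernoulli_space :: "('g, 'm) monoid_scheme \<Rightarrow> 'x measure \<Rightarrow> ('g \<Rightarrow> 'x) measure" where
  "bernoulli_space G M = PiM (carrier G) (\<lambda>_. M)"

definition bernoulli_shift ::
  "('g, 'm) monoid_scheme \<Rightarrow> 'x measure \<Rightarrow> 'g \<Rightarrow> ('g \<Rightarrow> 'x) \<Rightarrow> 'g \<Rightarrow> 'x" where
  "bernoulli_shift G M g = (\<lambda>x\<in>space (bernoulli_space G M). shift_family G g x)"

definition wreath_action ::
  "('g, 'm) monoid_scheme \<Rightarrow> 'x measure \<Rightarrow> ('b \<Rightarrow> 'x \<Rightarrow> 'x)
    \<Rightarrow> ('g \<Rightarrow> 'b) \<times> 'g \<Rightarrow> ('g \<Rightarrow> 'x) \<Rightarrow> 'g \<Rightarrow> 'x" where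
  "wreath_action G M \<beta> = (\<lambda>(b, g). \<lambda>x\<in>space (bernoulli_space G M).
     (\<lambda>d\<in>carrier G. \<beta> (b d) (bernoulli_shift G M g x d)))"

definition wreath_eqrel ::
  "('b, 'n) monoid_scheme \<Rightarrow> ('g, 'm) monoid_scheme \<Rightarrow> 'x measure \<Rightarrow> ('b \<Rightarrow> 'x \<Rightarrow> 'x)
    \<Rightarrow> (('g \<Rightarrow> 'x) \<times> ('g \<Rightarrow> 'x)) set" where
  "wreath_eqrel B G M \<beta> = orbit_eqrel (wreath B G) (bernoulli_space G M) (wreath_action G M \<beta>)"

definition sum_eqrel ::
  "('g, 'm) monoid_scheme \<Rightarrow> 'x measure \<Rightarrow> ('x \<times> 'x) set \<Rightarrow> (('g \<Rightarrow> 'x) \<times> ('g \<Rightarrow> 'x)) set" where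
  "sum_eqrel G M R = {(x, y). x \<in> space (bernoulli_space G M) \<and> y \<in> space (bernoulli_space G M) \<and>
     (\<forall>d\<in>carrier G. (x d, y d) \<in> R) \<and> finite {d\<in>carrier G. x d \<noteq> y d}}"

definition aut_star :: "('g, 'm) monoid_scheme \<Rightarrow> ('g \<Rightarrow> 'g) \<Rightarrow> ('g \<Rightarrow> 'x) \<Rightarrow> 'g \<Rightarrow> 'x" where
  "aut_star G \<phi> x = (\<lambda>d\<in>carrier G. x (inv_into (carrier G) \<phi> d))"

definition Aut_star ::
  "('g, 'm) monoid_scheme \<Rightarrow> 'x measure \<Rightarrow> (('g \<Rightarrow> 'x) \<Rightarrow> 'g \<Rightarrow> 'x) set set" where
  "Aut_star G M = (\<lambda>\<phi>. ae_class (bernoulli_space G M) (aut_star G \<phi>)) ` auto G"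

definition group_center :: "('g, 'm) monoid_scheme \<Rightarrow> 'g set" where
  "group_center G = {z \<in> carrier G. \<forall>g\<in>carrier G. z \<otimes>\<^bsub>G\<^esub> g = g \<otimes>\<^bsub>G\<^esub> z}"

end

theory Submission
  imports Defs
begin

text \<open>
  Let \<open>T\<close> be an automorphism of the orbit relation of \<open>H = B \<wr> \<Gamma>\<close>. By essential freeness
  \<open>T (\<gamma>.x) = c(\<gamma>, x).T x\<close> defines a cocycle with values in \<open>H\<close>; superrigidity turns \<open>T\<close>, up to
  a measurable choice of points in the same orbits, into a map \<open>Sm\<close> with
  \<open>Sm (\<gamma>.x) = \<rho>(\<gamma>).Sm x\<close> for a homomorphism \<open>\<rho> : \<Gamma> \<rightarrow> H\<close>. Let \<open>\<phi>\<close> be its component in \<open>\<Gamma>\<close>.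
  An infinite kernel of \<open>\<phi>\<close> would act ergodically, but each of its elements is mapped by \<open>\<rho>\<close> to an
  element moving finitely many coordinates only; as \<open>\<Gamma>\<close> has no finite normal subgroups, \<open>\<phi>\<close> is
  injective. Then \<open>\<rho>(\<Gamma>)\<close> acts mixingly, so \<open>Sm\<close>, being nonsingular, is measure preserving, and
  counting the pieces on which \<open>Sm\<close> is a translate of \<open>T\<close> shows that it is invertible. Coordinates
  of \<open>Sm x\<close> hardly depend on distant coordinates of \<open>x\<close>, hence \<open>Sm\<close> preserves the relation of the
  direct sum, and it follows that \<open>\<phi>\<close> is surjective. Superrigidity with a target of order two makes
  almost invariant functions on \<open>\<Gamma>\<close> almost constant, so the cocycle in the direct sum defined by
  \<open>\<rho>\<close> is a coboundary and \<open>\<rho>\<close> can be replaced by \<open>\<phi>\<close>. Undoing the permutation \<open>\<phi>\<^sup>*\<close> of the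
  coordinates leaves an equivariant automorphism of the relation of the direct sum.
\<close>

section \<open>Automorphisms of a measure space modulo null sets\<close>

text \<open>The tension in the proof is that \<open>Sm\<close> intertwines the actions but glues
  countably many translates of \<open>T\<close> together, so that at first it is merely nonsingular
  and might fail to be injective. Nonsingularity is enough to treat the kernel, since it forbids
  infinitely many coordinates of \<open>Sm x\<close> to stay in one set of measure less than 1;
  everything else about \<open>Sm\<close> has to wait until \<phi> is known to be injective. Mixing
  sees only the \<Gamma>-part of an element, as the other part acts inside the coordinates. Limits
  are therefore phrased with a finite set F outside of which a bound holds uniformly in all data
  that get chosen after F. That \<open>Sm\<close> respects the direct sum is not formal: a change of
  one coordinate might be answered by a shift, and this is excluded by playing a lower bound from
  independence against an upper bound from locality. The cocycle at the end is always the coboundary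
  of some function on \<Gamma>, which acts simply transitively on the coordinates; the difficulty is
  to make this function finitely supported, and there almost invariant sets enter.\<close>

definition mp_maps :: "'w measure \<Rightarrow> ('w \<Rightarrow> 'w) set" where
  "mp_maps W = {T \<in> measurable W W. distr W W T = W}"

text \<open>The inverse is an argument and not a witness, so that inverses can be named, swapped and
  composed.\<close>

definition ae_inverse :: "'w measure \<Rightarrow> ('w \<Rightarrow> 'w) \<Rightarrow> ('w \<Rightarrow> 'w) \<Rightarrow> bool" where
  "ae_inverse W T S \<longleftrightarrow> T \<in> mp_maps W \<and> S \<in> mp_maps W \<and>
     (AE x in W. S (T x) = x) \<and> (AE x in W. T (S x) = x)"

lemma mp_mapsD: "T \<in> mp_maps W \<Longrightarrow> T \<in> measurable W W" "T \<in> mp_maps W \<Longrightarrow> distr W W T = W"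
  by (auto simp: mp_maps_def)

lemma mp_maps_space: "T \<in> mp_maps W \<Longrightarrow> x \<in> space W \<Longrightarrow> T x \<in> space W"
  by (rule measurable_space[OF mp_mapsD(1)])

text \<open>Null sets have null preimages. Together with the countability of the acting group this
  gives almost sure statements along whole orbits.\<close>

lemma AE_mp_maps: "T \<in> mp_maps W \<Longrightarrow> AE x in W. P x \<Longrightarrow> AE x in W. P (T x)"
  by (rule AE_distrD[of T W W], simp add: mp_mapsD, subst mp_mapsD(2)) auto

lemma measure_mp_maps:
  "T \<in> mp_maps W \<Longrightarrow> U \<in> sets W \<Longrightarrow> measure W (T -` U \<inter> space W) = measure W U"
  using measure_distr[of T W W U] by (simp add: mp_mapsD)

lemma mp_maps_id: "id \<in> mp_maps W"
  by (simp add: mp_maps_def id_def distr_id2)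

lemma mp_maps_comp: "S \<in> mp_maps W \<Longrightarrow> T \<in> mp_maps W \<Longrightarrow> S \<circ> T \<in> mp_maps W"
  unfolding mp_maps_def using distr_distr[of S W W T W] by (auto simp: measurable_comp)

lemma mp_autos_iff: "T \<in> mp_autos W \<longleftrightarrow> (\<exists>S. ae_inverse W T S)"
  by (auto simp: mp_autos_def ae_inverse_def mp_maps_def)

lemma ae_inverse_sym: "ae_inverse W T S \<Longrightarrow> ae_inverse W S T"
  by (auto simp: ae_inverse_def)

lemma ae_inverse_autos:
  "ae_inverse W T S \<Longrightarrow> T \<in> mp_autos W" "ae_inverse W T S \<Longrightarrow> S \<in> mp_autos W"
  by (auto simp: mp_autos_iff intro: ae_inverse_sym)

lemma ae_inverse_id: "ae_inverse W id id"
  by (simp add: ae_inverse_def mp_maps_id)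

lemma ae_inverse_comp:
  assumes "ae_inverse W T T'" "ae_inverse W S S'"
  shows "ae_inverse W (T \<circ> S) (S' \<circ> T')"
proof -
  have T: "T \<in> mp_maps W" "T' \<in> mp_maps W" "S \<in> mp_maps W" "S' \<in> mp_maps W"
    using assms by (auto simp: ae_inverse_def)
  have inv: "AE x in W. T' (T x) = x" "AE x in W. T (T' x) = x"
    "AE x in W. S' (S x) = x" "AE x in W. S (S' x) = x"
    using assms by (auto simp: ae_inverse_def)
  have "AE x in W. S' (T' (T (S x))) = x"
    using inv(3) AE_mp_maps[OF T(3) inv(1)] by eventually_elim simp
  moreover have "AE x in W. T (S (S' (T' x))) = x"
    using inv(2) AE_mp_maps[OF T(2) inv(4)] by eventually_elim simp
  ultimately show ?thesis
    using T by (auto simp: ae_inverse_def mp_maps_comp)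
qed

lemma mp_autos_maps: "T \<in> mp_autos W \<Longrightarrow> T \<in> mp_maps W"
  by (auto simp: mp_autos_iff ae_inverse_def)

lemma mp_autos_comp: "S \<in> mp_autos W \<Longrightarrow> T \<in> mp_autos W \<Longrightarrow> S \<circ> T \<in> mp_autos W"
  by (meson ae_inverse_comp mp_autos_iff)

lemma mp_autos_id: "id \<in> mp_autos W"
  using ae_inverse_id mp_autos_iff by blast

lemma equiv_ae_rel: "equiv (mp_autos W) (ae_rel W)"
proof (rule equivI)
  show "ae_rel W \<subseteq> mp_autos W \<times> mp_autos W" by (auto simp: ae_rel_def)
  show "refl_on (mp_autos W) (ae_rel W)" by (auto simp: ae_rel_def refl_on_def)
  show "sym (ae_rel W)" by (auto simp: ae_rel_def sym_def)
  show "trans (ae_rel W)"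
  proof (rule transI)
    fix S T U assume "(S, T) \<in> ae_rel W" "(T, U) \<in> ae_rel W"
    then have "S \<in> mp_autos W" "U \<in> mp_autos W" "AE x in W. S x = T x" "AE x in W. T x = U x"
      by (auto simp: ae_rel_def)
    moreover from this(3,4) have "AE x in W. S x = U x" by eventually_elim simp
    ultimately show "(S, U) \<in> ae_rel W" by (auto simp: ae_rel_def)
  qed
qed

lemma ae_class_eq_iff:
  assumes "S \<in> mp_autos W" "T \<in> mp_autos W"
  shows "ae_class W S = ae_class W T \<longleftrightarrow> (AE x in W. S x = T x)"
  unfolding ae_class_def using eq_equiv_class_iff[OF equiv_ae_rel assms] assms
  by (auto simp: ae_rel_def)

lemma carrier_Aut_mp: "carrier (Aut_mp W) = ae_class W ` mp_autos W"
  by (auto simp: Aut_mp_def quotient_def ae_class_def)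

lemma one_Aut_mp: "\<one>\<^bsub>Aut_mp W\<^esub> = ae_class W id"
  by (simp add: Aut_mp_def)

lemma mem_ae_class: "S \<in> ae_class W T \<longleftrightarrow> T \<in> mp_autos W \<and> S \<in> mp_autos W \<and> (AE x in W. T x = S x)"
  by (auto simp: ae_class_def ae_rel_def)

text \<open>The product of two classes is a union over all representatives. It collapses to one
  class, because a change of \<open>S\<close> on a null set affects \<open>S \<circ> T\<close> on
  the preimage of that set under \<open>T\<close> only, which is null again.\<close>

lemma mult_Aut_mp:
  assumes "S \<in> mp_autos W" "T \<in> mp_autos W"
  shows "ae_class W S \<otimes>\<^bsub>Aut_mp W\<^esub> ae_class W T = ae_class W (S \<circ> T)"
proof -
  have eq: "ae_class W (S' \<circ> T') = ae_class W (S \<circ> T)"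
    if "S' \<in> ae_class W S" "T' \<in> ae_class W T" for S' T'
  proof -
    have *: "S' \<in> mp_autos W" "T' \<in> mp_autos W" "AE x in W. S x = S' x" "AE x in W. T x = T' x"
      using that by (auto simp: mem_ae_class)
    have "AE x in W. (S' \<circ> T') x = (S \<circ> T) x"
      using AE_mp_maps[OF mp_autos_maps[OF *(2)] *(3)] *(4) by eventually_elim simp
    then show ?thesis
      using * assms by (subst ae_class_eq_iff) (auto intro: mp_autos_comp)
  qed
  have "S \<in> ae_class W S" "T \<in> ae_class W T" using assms by (auto simp: mem_ae_class)
  then have "(\<Union>S\<in>ae_class W S. \<Union>T\<in>ae_class W T. ae_class W (S \<circ> T)) = ae_class W (S \<circ> T)"
    using eq by blast
  then show ?thesis by (simp add: Aut_mp_def)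
qed

lemma group_Aut_mp: "group (Aut_mp W)"
proof (rule groupI)
  fix x assume "x \<in> carrier (Aut_mp W)"
  then obtain T where T: "T \<in> mp_autos W" "x = ae_class W T" by (auto simp: carrier_Aut_mp)
  then obtain S where S: "ae_inverse W T S" by (auto simp: mp_autos_iff)
  then have "ae_class W S \<otimes>\<^bsub>Aut_mp W\<^esub> x = \<one>\<^bsub>Aut_mp W\<^esub>"
    using T ae_inverse_autos[OF S]
    by (auto simp: mult_Aut_mp one_Aut_mp ae_class_eq_iff mp_autos_comp mp_autos_id ae_inverse_def)
  then show "\<exists>y\<in>carrier (Aut_mp W). y \<otimes>\<^bsub>Aut_mp W\<^esub> x = \<one>\<^bsub>Aut_mp W\<^esub>"
    using ae_inverse_autos[OF S] by (auto simp: carrier_Aut_mp)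
qed (auto simp: carrier_Aut_mp mult_Aut_mp one_Aut_mp mp_autos_comp mp_autos_id comp_assoc)

lemma inv_Aut_mp:
  assumes "ae_inverse W T S"
  shows "inv\<^bsub>Aut_mp W\<^esub> (ae_class W T) = ae_class W S"
proof -
  interpret group "Aut_mp W" by (rule group_Aut_mp)
  show ?thesis
    using assms ae_inverse_autos[OF assms]
    by (intro inv_equality)
      (auto simp: mult_Aut_mp one_Aut_mp ae_class_eq_iff mp_autos_comp mp_autos_id ae_inverse_def carrier_Aut_mp)
qed

section \<open>Groups of automorphisms of an equivalence relation\<close>

definition ae_preserves :: "'w measure \<Rightarrow> ('w \<times> 'w) set \<Rightarrow> ('w \<Rightarrow> 'w) \<Rightarrow> bool" where
  "ae_preserves W R T \<longleftrightarrow> (\<exists>P. (AE x in W. P x) \<and>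
     (\<forall>x y. P x \<longrightarrow> P y \<longrightarrow> (x, y) \<in> R \<longleftrightarrow> (T x, T y) \<in> R))"

lemma ae_preservesI:
  assumes "AE x in W. P x"
    and "\<And>x y. P x \<Longrightarrow> P y \<Longrightarrow> x \<in> space W \<Longrightarrow> y \<in> space W \<Longrightarrow> (x, y) \<in> R \<longleftrightarrow> (T x, T y) \<in> R"
  shows "ae_preserves W R T"
  unfolding ae_preserves_def
  by (intro exI[of _ "\<lambda>x. x \<in> space W \<and> P x"]) (use assms in auto)

lemma ae_preserves_comp:
  assumes "ae_preserves W R S" "ae_preserves W R T" "T \<in> mp_maps W"
  shows "ae_preserves W R (S \<circ> T)"
proof -
  obtain P Q where PQ: "AE x in W. P x" "\<And>x y. P x \<Longrightarrow> P y \<Longrightarrow> (x, y) \<in> R \<longleftrightarrow> (S x, S y) \<in> R"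
    "AE x in W. Q x" "\<And>x y. Q x \<Longrightarrow> Q y \<Longrightarrow> (x, y) \<in> R \<longleftrightarrow> (T x, T y) \<in> R"
    using assms unfolding ae_preserves_def by blast
  show ?thesis
    by (rule ae_preservesI[where P = "\<lambda>x. P (T x) \<and> Q x"])
      (use AE_mp_maps[OF assms(3) PQ(1)] PQ in auto)
qed

lemma ae_preserves_cong:
  assumes "ae_preserves W R S" "AE x in W. S x = T x"
  shows "ae_preserves W R T"
proof -
  obtain P where P: "AE x in W. P x" "\<And>x y. P x \<Longrightarrow> P y \<Longrightarrow> (x, y) \<in> R \<longleftrightarrow> (S x, S y) \<in> R"
    using assms unfolding ae_preserves_def by blast
  show ?thesis
    by (rule ae_preservesI[where P = "\<lambda>x. P x \<and> S x = T x"]) (use P assms(2) in auto)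
qed

lemma ae_preserves_inverse:
  assumes "ae_preserves W R T" "ae_inverse W T S"
  shows "ae_preserves W R S"
proof -
  obtain P where P: "AE x in W. P x" "\<And>x y. P x \<Longrightarrow> P y \<Longrightarrow> (x, y) \<in> R \<longleftrightarrow> (T x, T y) \<in> R"
    using assms unfolding ae_preserves_def by blast
  have S: "S \<in> mp_maps W" "AE x in W. T (S x) = x" using assms(2) by (auto simp: ae_inverse_def)
  show ?thesis
    by (rule ae_preservesI[where P = "\<lambda>x. P (S x) \<and> T (S x) = x"])
      (use P(2) AE_mp_maps[OF S(1) P(1)] S(2) in auto)
qed

lemma ae_preserves_id: "ae_preserves W R id"
  by (rule ae_preservesI[where P = "\<lambda>_. True"]) auto

text \<open>A predicate that holds almost everywhere can be pulled back and combined with others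
  without choosing null sets. The null set demanded by \<open>Aut_rel\<close> is recovered as one
  that contains the exceptional points.\<close>

lemma Aut_rel_iff:
  assumes "T \<in> mp_autos W"
  shows "ae_class W T \<in> Aut_rel W R \<longleftrightarrow> ae_preserves W R T"
proof -
  have *: "(\<exists>N\<in>null_sets W. \<forall>x\<in>space W - N. \<forall>y\<in>space W - N. (x, y) \<in> R \<longleftrightarrow> (S x, S y) \<in> R)
    \<longleftrightarrow> ae_preserves W R S" for S
  proof
    assume "\<exists>N\<in>null_sets W. \<forall>x\<in>space W - N. \<forall>y\<in>space W - N. (x, y) \<in> R \<longleftrightarrow> (S x, S y) \<in> R"
    then obtain N where N: "N \<in> null_sets W"
      "\<forall>x\<in>space W - N. \<forall>y\<in>space W - N. (x, y) \<in> R \<longleftrightarrow> (S x, S y) \<in> R" by blast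
    show "ae_preserves W R S"
      by (rule ae_preservesI[where P = "\<lambda>x. x \<notin> N"]) (use N in \<open>auto intro: AE_not_in\<close>)
  next
    assume "ae_preserves W R S"
    then obtain P where P: "AE x in W. P x" "\<And>x y. P x \<Longrightarrow> P y \<Longrightarrow> (x, y) \<in> R \<longleftrightarrow> (S x, S y) \<in> R"
      unfolding ae_preserves_def by blast
    then obtain N where "N \<in> null_sets W" "{x \<in> space W. \<not> P x} \<subseteq> N"
      by (auto simp: eventually_ae_filter)
    then show "\<exists>N\<in>null_sets W. \<forall>x\<in>space W - N. \<forall>y\<in>space W - N. (x, y) \<in> R \<longleftrightarrow> (S x, S y) \<in> R"
      using P(2) by (intro bexI[of _ N] ballI) auto
  qed
  show ?thesis
    unfolding Aut_rel_def * using assms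
    by (auto simp: ae_class_eq_iff eq_commute intro: ae_preserves_cong)
qed

lemma Aut_rel_eq: "Aut_rel W R = ae_class W ` {T \<in> mp_autos W. ae_preserves W R T}"
proof (intro Set.set_eqI)
  fix A
  show "A \<in> Aut_rel W R \<longleftrightarrow> A \<in> ae_class W ` {T \<in> mp_autos W. ae_preserves W R T}"
  proof
    assume A: "A \<in> Aut_rel W R"
    then obtain T where "T \<in> mp_autos W" "A = ae_class W T" by (auto simp: Aut_rel_def)
    then show "A \<in> ae_class W ` {T \<in> mp_autos W. ae_preserves W R T}" using A Aut_rel_iff by blast
  qed (auto simp: Aut_rel_iff)
qed

lemma full_group_iff:
  assumes "T \<in> mp_autos W"
  shows "ae_class W T \<in> full_group W R \<longleftrightarrow> (AE x in W. (T x, x) \<in> R)"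
proof
  assume "ae_class W T \<in> full_group W R"
  then obtain S where S: "S \<in> mp_autos W" "AE x in W. (S x, x) \<in> R" "ae_class W T = ae_class W S"
    by (auto simp: full_group_def)
  then have "AE x in W. T x = S x" using assms by (simp add: ae_class_eq_iff)
  with S(2) show "AE x in W. (T x, x) \<in> R" by eventually_elim simp
qed (use assms in \<open>auto simp: full_group_def\<close>)

lemma full_group_eq: "full_group W R = ae_class W ` {T \<in> mp_autos W. AE x in W. (T x, x) \<in> R}"
  by (auto simp: full_group_def)

lemma subgroup_Aut_rel: "subgroup (Aut_rel W R) (Aut_mp W)"
proof -
  interpret group "Aut_mp W" by (rule group_Aut_mp)
  show ?thesis
  proof (rule subgroupI)
    show "Aut_rel W R \<noteq> {}"
      using ae_preserves_id mp_autos_id by (auto simp: Aut_rel_eq)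
    fix a assume "a \<in> Aut_rel W R"
    then obtain T S where T: "T \<in> mp_autos W" "ae_preserves W R T" "a = ae_class W T" "ae_inverse W T S"
      by (auto simp: Aut_rel_eq mp_autos_iff)
    then show "inv\<^bsub>Aut_mp W\<^esub> a \<in> Aut_rel W R"
      using ae_preserves_inverse ae_inverse_autos by (fastforce simp: inv_Aut_mp Aut_rel_eq)
  next
    fix a b assume "a \<in> Aut_rel W R" "b \<in> Aut_rel W R"
    then show "a \<otimes>\<^bsub>Aut_mp W\<^esub> b \<in> Aut_rel W R"
      by (auto simp: Aut_rel_eq mult_Aut_mp intro!: imageI mp_autos_comp ae_preserves_comp mp_autos_maps)
  qed (auto simp: Aut_rel_eq carrier_Aut_mp)
qed

context
  fixes W :: "'w measure" and R :: "('w \<times> 'w) set"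
  assumes R: "equiv (space W) R"
begin

lemma full_group_ae_preserves:
  assumes "T \<in> mp_maps W" "AE x in W. (T x, x) \<in> R"
  shows "ae_preserves W R T"
proof (rule ae_preservesI[OF assms(2)])
  have s: "sym R" and t: "trans R" using R by (auto simp: equiv_def)
  fix x y assume "(T x, x) \<in> R" "(T y, y) \<in> R"
  then show "(x, y) \<in> R \<longleftrightarrow> (T x, T y) \<in> R"
    by (meson s t symE transE)
qed

lemma full_group_subset: "full_group W R \<subseteq> Aut_rel W R"
  by (auto simp: full_group_eq Aut_rel_eq full_group_ae_preserves mp_autos_maps)

lemma full_group_inverse:
  assumes "ae_inverse W T S" "AE x in W. (T x, x) \<in> R"
  shows "AE x in W. (S x, x) \<in> R"
proof -
  have S: "S \<in> mp_maps W" "AE x in W. T (S x) = x" using assms(1) by (auto simp: ae_inverse_def)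
  have s: "sym R" using R by (auto simp: equiv_def)
  show ?thesis
    using AE_mp_maps[OF S(1) assms(2)] S(2) by eventually_elim (use s in \<open>auto elim: symE\<close>)
qed

lemma full_group_comp:
  assumes "AE x in W. (S x, x) \<in> R" "AE x in W. (T x, x) \<in> R" "T \<in> mp_maps W"
  shows "AE x in W. ((S \<circ> T) x, x) \<in> R"
proof -
  have t: "trans R" using R by (auto simp: equiv_def)
  show ?thesis
    using AE_mp_maps[OF assms(3,1)] assms(2) by eventually_elim (use t in \<open>auto elim: transE\<close>)
qed

text \<open>The relation has to be preserved at the pair \<open>K (S x)\<close>, \<open>S x\<close>;
  both points are images of x under measure preserving maps, so the conull condition on
  \<open>T\<close> holds at both.\<close>

lemma full_group_conj:
  assumes "ae_inverse W T S" "ae_preserves W R T" "K \<in> mp_maps W" "AE x in W. (K x, x) \<in> R"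
  shows "AE x in W. ((T \<circ> K \<circ> S) x, x) \<in> R"
proof -
  obtain P where P: "AE x in W. P x" "\<And>x y. P x \<Longrightarrow> P y \<Longrightarrow> (x, y) \<in> R \<longleftrightarrow> (T x, T y) \<in> R"
    using assms unfolding ae_preserves_def by blast
  have S: "S \<in> mp_maps W" "AE x in W. T (S x) = x" using assms(1) by (auto simp: ae_inverse_def)
  show ?thesis
    using S(2) AE_mp_maps[OF S(1) P(1)] AE_mp_maps[OF S(1) AE_mp_maps[OF assms(3) P(1)]]
      AE_mp_maps[OF S(1) assms(4)]
  proof eventually_elim
    case (elim x)
    then show ?case using P(2)[OF elim(3,2)] by simp
  qed
qed

lemma normal_full_group: "full_group W R \<lhd> (Aut_mp W\<lparr>carrier := Aut_rel W R\<rparr>)"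
proof -
  interpret A: group "Aut_mp W" by (rule group_Aut_mp)
  note sub = subgroup_Aut_rel[of W R]
  interpret group "Aut_mp W\<lparr>carrier := Aut_rel W R\<rparr>"
    by (rule A.subgroup_imp_group[OF sub])
  have inv: "inv\<^bsub>Aut_mp W\<lparr>carrier := Aut_rel W R\<rparr>\<^esub> a = inv\<^bsub>Aut_mp W\<^esub> a" if "a \<in> Aut_rel W R" for a
    using A.m_inv_consistent[OF sub that] by simp
  show ?thesis
    unfolding normal_inv_iff
  proof (intro conjI ballI subgroupI)
    show "full_group W R \<subseteq> carrier (Aut_mp W\<lparr>carrier := Aut_rel W R\<rparr>)" using full_group_subset by simp
    have "AE x in W. (id x, x) \<in> R"
      by (rule AE_I2) (use R in \<open>auto simp: equiv_def refl_on_def\<close>)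
    then have "ae_class W id \<in> full_group W R" by (rule full_group_iff[OF mp_autos_id, THEN iffD2])
    then show "full_group W R \<noteq> {}" by blast
  next
    fix a assume a: "a \<in> full_group W R"
    then obtain T S where T: "T \<in> mp_autos W" "AE x in W. (T x, x) \<in> R" "a = ae_class W T" "ae_inverse W T S"
      by (auto simp: full_group_eq mp_autos_iff)
    have aR: "a \<in> Aut_rel W R" using a full_group_subset by auto
    show "inv\<^bsub>Aut_mp W\<lparr>carrier := Aut_rel W R\<rparr>\<^esub> a \<in> full_group W R"
      using T full_group_inverse[OF T(4,2)] ae_inverse_autos[OF T(4)]
      unfolding inv[OF aR] by (auto simp: inv_Aut_mp full_group_eq)
  next
    fix a b assume "a \<in> full_group W R" "b \<in> full_group W R"
    then obtain S T where ST: "S \<in> mp_autos W" "AE x in W. (S x, x) \<in> R" "a = ae_class W S"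
      "T \<in> mp_autos W" "AE x in W. (T x, x) \<in> R" "b = ae_class W T"
      by (auto simp: full_group_eq)
    then have "ae_class W (S \<circ> T) \<in> full_group W R"
      using full_group_comp[OF ST(2,5) mp_autos_maps[OF ST(4)]]
      by (intro full_group_iff[OF mp_autos_comp, THEN iffD2])
    then show "a \<otimes>\<^bsub>Aut_mp W\<lparr>carrier := Aut_rel W R\<rparr>\<^esub> b \<in> full_group W R"
      using ST by (simp add: mult_Aut_mp)
  next
    fix a k assume a: "a \<in> carrier (Aut_mp W\<lparr>carrier := Aut_rel W R\<rparr>)" and k: "k \<in> full_group W R"
    obtain T S where T: "T \<in> mp_autos W" "ae_preserves W R T" "a = ae_class W T" "ae_inverse W T S"
      using a by (auto simp: Aut_rel_eq mp_autos_iff)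
    obtain K where K: "K \<in> mp_autos W" "AE x in W. (K x, x) \<in> R" "k = ae_class W K"
      using k by (auto simp: full_group_eq)
    have aR: "a \<in> Aut_rel W R" using a by simp
    have Sa: "S \<in> mp_autos W" using ae_inverse_autos[OF T(4)] by simp
    show "a \<otimes>\<^bsub>Aut_mp W\<lparr>carrier := Aut_rel W R\<rparr>\<^esub> k \<otimes>\<^bsub>Aut_mp W\<lparr>carrier := Aut_rel W R\<rparr>\<^esub>
        inv\<^bsub>Aut_mp W\<lparr>carrier := Aut_rel W R\<rparr>\<^esub> a \<in> full_group W R"
      using T K Sa full_group_conj[OF T(4,2) mp_autos_maps[OF K(1)] K(2)]
      unfolding inv[OF aR] by (auto simp: inv_Aut_mp mult_Aut_mp mp_autos_comp full_group_eq)
  qed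
qed

end

lemma Aut_rel_equivariant_iff:
  assumes "T \<in> mp_autos W" "\<And>g. g \<in> carrier G \<Longrightarrow> \<alpha> g \<in> mp_maps W"
  shows "ae_class W T \<in> Aut_rel_equivariant G W \<alpha> R \<longleftrightarrow>
    ae_preserves W R T \<and> (\<forall>g\<in>carrier G. AE x in W. T (\<alpha> g x) = \<alpha> g (T x))"
proof
  assume "ae_class W T \<in> Aut_rel_equivariant G W \<alpha> R"
  then obtain S where S: "S \<in> mp_autos W" "ae_class W S \<in> Aut_rel W R"
    "\<And>g. g\<in>carrier G \<Longrightarrow> AE x in W. S (\<alpha> g x) = \<alpha> g (S x)" "ae_class W T = ae_class W S"
    by (auto simp: Aut_rel_equivariant_def)
  then have eq: "AE x in W. T x = S x" using assms by (simp add: ae_class_eq_iff)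
  have "AE x in W. T (\<alpha> g x) = \<alpha> g (T x)" if "g \<in> carrier G" for g
    using AE_mp_maps[OF assms(2)[OF that] eq] eq S(3)[OF that] by eventually_elim simp
  then show "ae_preserves W R T \<and> (\<forall>g\<in>carrier G. AE x in W. T (\<alpha> g x) = \<alpha> g (T x))"
    using S assms(1) Aut_rel_iff by metis
next
  assume "ae_preserves W R T \<and> (\<forall>g\<in>carrier G. AE x in W. T (\<alpha> g x) = \<alpha> g (T x))"
  then show "ae_class W T \<in> Aut_rel_equivariant G W \<alpha> R"
    using assms(1) by (auto simp: Aut_rel_equivariant_def Aut_rel_iff)
qed

lemma Aut_rel_equivariant_eq:
  "Aut_rel_equivariant G W \<alpha> R =
    ae_class W ` {T \<in> mp_autos W. ae_preserves W R T \<and> (\<forall>g\<in>carrier G. AE x in W. T (\<alpha> g x) = \<alpha> g (T x))}"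
  by (auto simp: Aut_rel_equivariant_def Aut_rel_iff)

lemma subgroup_Aut_rel_equivariant:
  assumes "\<And>g. g \<in> carrier G \<Longrightarrow> \<alpha> g \<in> mp_maps W"
  shows "subgroup (Aut_rel_equivariant G W \<alpha> R) (Aut_mp W)"
proof -
  interpret group "Aut_mp W" by (rule group_Aut_mp)
  show ?thesis
  proof (rule subgroupI)
    show "Aut_rel_equivariant G W \<alpha> R \<noteq> {}"
      using ae_preserves_id mp_autos_id by (fastforce simp: Aut_rel_equivariant_eq)
    fix a assume "a \<in> Aut_rel_equivariant G W \<alpha> R"
    then obtain T S where T: "T \<in> mp_autos W" "ae_preserves W R T" "a = ae_class W T" "ae_inverse W T S"
      "\<And>g. g\<in>carrier G \<Longrightarrow> AE x in W. T (\<alpha> g x) = \<alpha> g (T x)"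
      by (auto simp: Aut_rel_equivariant_eq mp_autos_iff)
    have inv: "S \<in> mp_maps W" "AE x in W. S (T x) = x" "AE x in W. T (S x) = x"
      using T(4) by (auto simp: ae_inverse_def)
    \<comment> \<open>Almost surely \<open>\<alpha> g x\<close> equals
      \<open>T (\<alpha> g (S x))\<close>, to which \<open>S\<close> is applied.\<close>
    have "AE x in W. S (\<alpha> g x) = \<alpha> g (S x)" if g: "g \<in> carrier G" for g
      using AE_mp_maps[OF inv(1) T(5)[OF g]] AE_mp_maps[OF inv(1) AE_mp_maps[OF assms[OF g] inv(2)]] inv(3)
      by eventually_elim metis
    then show "inv\<^bsub>Aut_mp W\<^esub> a \<in> Aut_rel_equivariant G W \<alpha> R"
      using ae_preserves_inverse[OF T(2,4)] ae_inverse_autos[OF T(4)] T(3)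
      by (auto simp: inv_Aut_mp[OF T(4)] Aut_rel_equivariant_eq)
  next
    fix a b assume "a \<in> Aut_rel_equivariant G W \<alpha> R" "b \<in> Aut_rel_equivariant G W \<alpha> R"
    then obtain S T where S: "S \<in> mp_autos W" "ae_preserves W R S" "a = ae_class W S"
      "\<And>g. g\<in>carrier G \<Longrightarrow> AE x in W. S (\<alpha> g x) = \<alpha> g (S x)"
      and T: "T \<in> mp_autos W" "ae_preserves W R T" "b = ae_class W T"
      "\<And>g. g\<in>carrier G \<Longrightarrow> AE x in W. T (\<alpha> g x) = \<alpha> g (T x)"
      by (auto simp: Aut_rel_equivariant_eq)
    have "AE x in W. (S \<circ> T) (\<alpha> g x) = \<alpha> g ((S \<circ> T) x)" if g: "g \<in> carrier G" for g
      using AE_mp_maps[OF mp_autos_maps[OF T(1)] S(4)[OF g]] T(4)[OF g] by eventually_elim simp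
    then show "a \<otimes>\<^bsub>Aut_mp W\<^esub> b \<in> Aut_rel_equivariant G W \<alpha> R"
      using S(1-3) T(1-3) by (auto simp: Aut_rel_equivariant_eq mult_Aut_mp
        intro!: imageI mp_autos_comp ae_preserves_comp mp_autos_maps)
  qed (auto simp: Aut_rel_equivariant_eq carrier_Aut_mp)
qed

section \<open>Product probability spaces\<close>

definition depends_on :: "'i set \<Rightarrow> ('i \<Rightarrow> 'a) set \<Rightarrow> ('i \<Rightarrow> 'a) set \<Rightarrow> bool" where
  "depends_on J \<Omega> U \<longleftrightarrow> (\<forall>x\<in>\<Omega>. \<forall>y\<in>\<Omega>. (\<forall>i\<in>J. x i = y i) \<longrightarrow> (x \<in> U \<longleftrightarrow> y \<in> U))"

lemma depends_onD:
  "depends_on J \<Omega> U \<Longrightarrow> x \<in> \<Omega> \<Longrightarrow> y \<in> \<Omega> \<Longrightarrow> (\<And>i. i \<in> J \<Longrightarrow> x i = y i) \<Longrightarrow> x \<in> U \<longleftrightarrow> y \<in> U"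
  unfolding depends_on_def by blast

lemma depends_on_mono: "depends_on J \<Omega> U \<Longrightarrow> J \<subseteq> K \<Longrightarrow> depends_on K \<Omega> U"
  unfolding depends_on_def by (meson subsetD)

lemma (in finite_measure) abs_measure_diff_le:
  assumes "A \<in> sets M" "B \<in> sets M"
  shows "\<bar>measure M A - measure M B\<bar> \<le> measure M (sym_diff A B)"
proof -
  have le: "measure M A \<le> measure M B + measure M (sym_diff A B)"
    if "A \<in> sets M" "B \<in> sets M" for A B
  proof -
    have "measure M A \<le> measure M (B \<union> sym_diff A B)"
      by (rule finite_measure_mono) (use that in auto)
    also have "\<dots> \<le> measure M B + measure M (sym_diff A B)"
      by (rule measure_Un_le) (use that in auto)
    finally show ?thesis .
  qed
  have "sym_diff B A = sym_diff A B" by auto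
  then show ?thesis using le[OF assms] le[OF assms(2,1)] by simp
qed

context
  fixes M :: "'a measure" and I :: "'i set"
  assumes M: "prob_space M"
begin

abbreviation (input) "PW \<equiv> PiM I (\<lambda>_. M)"

interpretation M: prob_space M by (rule M)
interpretation PP: product_prob_space "\<lambda>_. M" I by unfold_locales

lemma indep_vars_coordinates:
  assumes "I \<noteq> {}"
  shows "prob_space.indep_vars PW (\<lambda>_. M) (\<lambda>i x. x i) I"
proof (subst PP.indep_vars_iff_distr_eq_PiM')
  have "distr PW PW (\<lambda>x. \<lambda>i\<in>I. x i) = distr PW PW (\<lambda>x. x)"
    by (rule distr_cong) (auto simp: space_PiM PiE_restrict)
  also have "\<dots> = PW" by (simp add: distr_id2)
  also have "\<dots> = PiM I (\<lambda>i. distr PW M (\<lambda>x. x i))"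
    by (rule PiM_cong) (auto simp: PP.PiM_component)
  finally show "distr PW PW (\<lambda>x. \<lambda>i\<in>I. x i) = PiM I (\<lambda>i. distr PW M (\<lambda>x. x i))" .
qed (use assms in auto)

lemma indep_depends_on:
  assumes U: "U \<in> sets PW" "depends_on J (space PW) U"
    and V: "V \<in> sets PW" "depends_on K (space PW) V"
    and JK: "J \<subseteq> I" "K \<subseteq> I" "J \<inter> K = {}"
  shows "measure PW (U \<inter> V) = measure PW U * measure PW V"
proof (cases "I = {}")
  \<comment> \<open>Independence of the coordinates is stated over nonempty index sets; over the
    empty one the space is a single point.\<close>
  case True
  have "space PW = {\<lambda>_. undefined}" by (simp add: space_PiM True)
  then have "U = {} \<or> U = space PW" using sets.sets_into_space[OF U(1)] by auto
  moreover have "measure PW (space PW) = 1"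
    by (rule prob_space.prob_space[OF prob_space_PiM]) (rule M)
  ultimately show ?thesis
    using sets.sets_into_space[OF V(1)] by (auto simp: Int_absorb1)
next
  case False
  have "space PW \<noteq> {}" by (rule prob_space.not_empty[OF prob_space_PiM]) (rule M)
  then obtain x0 where x0: "x0 \<in> space PW" by blast
  \<comment> \<open>\<open>m J\<close> completes a family over J by the coordinates of the fixed
    point \<open>x0\<close>. A set that depends on J only is then the preimage, under restriction to
    J, of its own preimage under \<open>m J\<close>, which makes it an event of the coordinates in
    J.\<close>
  define m where "m = (\<lambda>J y. \<lambda>i\<in>I. if i \<in> J then y i else x0 i :: 'a)"
  have m: "m J \<in> measurable (PiM J (\<lambda>_. M)) PW" if "J \<subseteq> I" for J
    unfolding m_def
  proof (rule measurable_restrict)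
    fix i assume "i \<in> I"
    then show "(\<lambda>y. if i \<in> J then y i else x0 i) \<in> measurable (PiM J (\<lambda>_. M)) M"
      using x0 by (cases "i \<in> J") (auto simp: space_PiM PiE_iff)
  qed
  define s where "s = (\<lambda>J U. m J -` U \<inter> space (PiM J (\<lambda>_. M)))"
  have s: "s J U \<in> sets (PiM J (\<lambda>_. M))"
    "(\<lambda>x. \<lambda>i\<in>J. x i) -` s J U \<inter> space PW = U"
    if "U \<in> sets PW" "depends_on J (space PW) U" "J \<subseteq> I" for J U
  proof -
    show "s J U \<in> sets (PiM J (\<lambda>_. M))"
      unfolding s_def by (rule measurable_sets[OF m]) (use that in auto)
    have "m J (restrict x J) \<in> U \<longleftrightarrow> x \<in> U" if x: "x \<in> space PW" for x
    proof (rule depends_onD[OF \<open>depends_on J (space PW) U\<close> _ x])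
      show "m J (restrict x J) \<in> space PW"
        by (rule measurable_space[OF m[OF \<open>J \<subseteq> I\<close>]]) (use x \<open>J \<subseteq> I\<close> in \<open>auto simp: space_PiM\<close>)
    qed (use \<open>J \<subseteq> I\<close> in \<open>auto simp: m_def\<close>)
    moreover have "restrict x J \<in> space (PiM J (\<lambda>_. M))" if "x \<in> space PW" for x
      using that \<open>J \<subseteq> I\<close> by (auto simp: space_PiM)
    ultimately show "(\<lambda>x. \<lambda>i\<in>J. x i) -` s J U \<inter> space PW = U"
      using sets.sets_into_space[OF \<open>U \<in> sets PW\<close>] unfolding s_def by blast
  qed
  have "PP.indep_var (PiM J (\<lambda>_. M)) (\<lambda>x. restrict (\<lambda>i. x i) J) (PiM K (\<lambda>_. M)) (\<lambda>x. restrict (\<lambda>i. x i) K)"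
    by (rule PP.indep_var_restrict[OF indep_vars_coordinates[OF False]]) (use JK in auto)
  note * = PP.indep_varD[OF this s(1)[OF U JK(1)] s(1)[OF V JK(2)]]
  have "(\<lambda>x. (restrict x J, restrict x K)) -` (s J U \<times> s K V) \<inter> space PW =
      ((\<lambda>x. \<lambda>i\<in>J. x i) -` s J U \<inter> space PW) \<inter> ((\<lambda>x. \<lambda>i\<in>K. x i) -` s K V \<inter> space PW)"
    by auto
  also have "\<dots> = U \<inter> V" using s(2)[OF U JK(1)] s(2)[OF V JK(2)] by simp
  finally show ?thesis using * s(2)[OF U JK(1)] s(2)[OF V JK(2)] by simp
qed

text \<open>The sets with such approximations contain the cylinders and are closed under complements
  and countable unions; a union is first cut down to finitely many members by continuity of the
  measure.\<close>

lemma approx_depends_on: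
  assumes "U \<in> sets PW" "\<epsilon> > 0"
  shows "\<exists>F V. finite F \<and> F \<subseteq> I \<and> V \<in> sets PW \<and> depends_on F (space PW) V \<and>
    measure PW (sym_diff U V) < \<epsilon>"
proof -
  have "U \<in> sigma_sets (space PW) (prod_algebra I (\<lambda>_. M))"
    using assms(1) by (simp add: sets_PiM space_PiM)
  then show ?thesis using assms(2)
  proof (induction arbitrary: \<epsilon>)
    case (Basic A)
    then obtain J E where A: "A = prod_emb I (\<lambda>_. M) J (\<Pi>\<^sub>E j\<in>J. E j)" "finite J" "J \<subseteq> I"
      "\<And>j. j \<in> J \<Longrightarrow> E j \<in> sets M"
      by (force elim!: prod_algebraE)
    have "A \<in> sets PW" using Basic(1) by (simp add: sets_PiM)
    moreover have "depends_on J (space PW) A"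
      by (auto simp: depends_on_def A(1) prod_emb_def space_PiM PiE_iff) 
    ultimately show ?case using A Basic(2) by (intro exI[of _ J] exI[of _ A]) auto
  next
    case Empty
    have "depends_on {} (space PW) {}" by (simp add: depends_on_def)
    then show ?case using Empty by (intro exI[of _ "{}"] conjI) auto
  next
    case (Compl A)
    obtain F V where V: "finite F" "F \<subseteq> I" "V \<in> sets PW" "depends_on F (space PW) V"
      "measure PW (sym_diff A V) < \<epsilon>"
      using Compl(2)[OF Compl(3)] by (elim exE conjE) rule
    have A: "A \<in> sets PW" using Compl by (simp add: sets_PiM space_PiM)
    have eq: "sym_diff (space PW - A) (space PW - V) = sym_diff A V"
      using sets.sets_into_space[OF A] sets.sets_into_space[OF V(3)] by blast
    have "depends_on F (space PW) (space PW - V)"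
      using V(4) unfolding depends_on_def by blast
    moreover have "measure PW (sym_diff (space PW - A) (space PW - V)) < \<epsilon>"
      unfolding eq by (rule V(5))
    ultimately show ?case using V(1-3) by blast
  next
    case (Union A)
    have A: "A i \<in> sets PW" for i using Union(1) by (simp add: sets_PiM space_PiM)
    define B where "B = (\<lambda>k. \<Union>n<k. A n)"
    have B: "range B \<subseteq> sets PW" using A by (auto simp: B_def)
    have incB: "incseq B" by (force simp: B_def incseq_def)
    have UB: "(\<Union>k. B k) = (\<Union>n. A n)" by (auto simp: B_def)
    have "(\<lambda>k. measure PW (B k)) \<longlonglongrightarrow> measure PW (\<Union>n. A n)"
      using PP.finite_Lim_measure_incseq[OF B incB] UB by simp
    then have "eventually (\<lambda>k. dist (measure PW (B k)) (measure PW (\<Union>n. A n)) < \<epsilon> / 2) sequentially"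
      using Union(3) by (intro tendstoD) auto
    then obtain k where k: "dist (measure PW (B k)) (measure PW (\<Union>n. A n)) < \<epsilon> / 2"
      by (auto simp: eventually_sequentially)
    \<comment> \<open>At most k errors of this size are added up, and half of \<epsilon> is
      available for them; the summand 1 covers k = 0.\<close>
    define \<delta> where "\<delta> = \<epsilon> / (2 * (real k + 1))"
    have \<delta>: "\<delta> > 0" using Union(3) by (simp add: \<delta>_def)
    have "\<forall>n. \<exists>F V. finite F \<and> F \<subseteq> I \<and> V \<in> sets PW \<and> depends_on F (space PW) V \<and>
      measure PW (sym_diff (A n) V) < \<delta>"
      using Union(2)[OF \<delta>] by (rule allI)
    then obtain F V where FV: "\<And>n. finite (F n)" "\<And>n. F n \<subseteq> I" "\<And>n. V n \<in> sets PW"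
      "\<And>n. depends_on (F n) (space PW) (V n)" "\<And>n. measure PW (sym_diff (A n) (V n)) < \<delta>"
      by metis
    let ?F = "\<Union>n<k. F n" and ?V = "\<Union>n<k. V n"
    have "depends_on ?F (space PW) ?V"
      unfolding depends_on_def
    proof (intro ballI impI)
      fix x y assume "x \<in> space PW" "y \<in> space PW" "\<forall>i\<in>?F. x i = y i"
      then have "x \<in> V n \<longleftrightarrow> y \<in> V n" if "n < k" for n
        using that by (intro depends_onD[OF FV(4)]) auto
      then show "x \<in> ?V \<longleftrightarrow> y \<in> ?V" by auto
    qed
    moreover have "measure PW (sym_diff (\<Union>n. A n) ?V) < \<epsilon>"
    proof -
      have meas: "(\<Union>n. A n) \<in> sets PW" "B k \<in> sets PW" "?V \<in> sets PW"
        using A B FV(3) by auto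
      have "measure PW (sym_diff (\<Union>n. A n) ?V)
        \<le> measure PW (((\<Union>n. A n) - B k) \<union> (\<Union>n<k. sym_diff (A n) (V n)))"
        by (rule PP.finite_measure_mono) (use A FV(3) meas in \<open>auto simp: B_def\<close>)
      also have "\<dots> \<le> measure PW ((\<Union>n. A n) - B k) + measure PW (\<Union>n<k. sym_diff (A n) (V n))"
        by (rule measure_Un_le) (use A FV(3) meas in auto)
      also have "measure PW (\<Union>n<k. sym_diff (A n) (V n)) \<le> (\<Sum>n<k. measure PW (sym_diff (A n) (V n)))"
        by (rule PP.finite_measure_subadditive_finite) (use A FV(3) in auto)
      also have "\<dots> \<le> (\<Sum>n<k. \<delta>)"
        by (rule sum_mono) (use FV(5) less_imp_le in auto)
      also have "\<dots> \<le> \<epsilon> / 2"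
        using Union(3) by (simp add: \<delta>_def field_simps)
      also have "measure PW ((\<Union>n. A n) - B k) = measure PW (\<Union>n. A n) - measure PW (B k)"
        by (rule PP.finite_measure_Diff) (use meas in \<open>auto simp: B_def\<close>)
      also have "\<dots> < \<epsilon> / 2" using k unfolding dist_real_def by linarith
      finally show ?thesis by simp
    qed
    ultimately show ?case
      using FV(1-3) by (intro exI[of _ ?F] exI[of _ ?V] conjI) auto
  qed
qed

text \<open>The set F comes from \<open>U\<close> alone: \<open>U\<close> is replaced by a set
  depending on F, which is independent of every A that does not see F. The replacement costs half of
  \<epsilon> on each side.\<close>

lemma asymptotic_independence:
  assumes U: "U \<in> sets PW" and "\<epsilon> > 0"
  shows "\<exists>F. finite F \<and> F \<subseteq> I \<and> (\<forall>A\<in>sets PW. depends_on (I - F) (space PW) A \<longrightarrow>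
    \<bar>measure PW (U \<inter> A) - measure PW U * measure PW A\<bar> \<le> \<epsilon>)"
proof -
  obtain F V where V: "finite F" "F \<subseteq> I" "V \<in> sets PW" "depends_on F (space PW) V"
    "measure PW (sym_diff U V) < \<epsilon> / 2"
    using approx_depends_on[OF U, of "\<epsilon> / 2"] assms(2) by auto
  have "\<bar>measure PW (U \<inter> A) - measure PW U * measure PW A\<bar> \<le> \<epsilon>"
    if A: "A \<in> sets PW" "depends_on (I - F) (space PW) A" for A
  proof -
    have "measure PW (V \<inter> A) = measure PW V * measure PW A"
      by (rule indep_depends_on[OF V(3,4) A]) (use V in auto)
    moreover have "\<bar>measure PW (U \<inter> A) - measure PW (V \<inter> A)\<bar> \<le> \<epsilon> / 2"
    proof -
      have "\<bar>measure PW (U \<inter> A) - measure PW (V \<inter> A)\<bar> \<le> measure PW (sym_diff (U \<inter> A) (V \<inter> A))"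
        by (rule PP.abs_measure_diff_le) (use U V A in auto)
      also have "\<dots> \<le> measure PW (sym_diff U V)"
        by (rule PP.finite_measure_mono) (use U V A in auto)
      finally show ?thesis using V(5) by simp
    qed
    moreover have "\<bar>measure PW V * measure PW A - measure PW U * measure PW A\<bar> \<le> \<epsilon> / 2"
    proof -
      have "\<bar>measure PW U - measure PW V\<bar> \<le> \<epsilon> / 2"
        using PP.abs_measure_diff_le[OF U V(3)] V(5) by linarith
      then have "\<bar>measure PW V - measure PW U\<bar> * measure PW A \<le> \<epsilon> / 2 * 1"
        using assms(2) by (intro mult_mono) (auto simp: abs_minus_commute)
      then show ?thesis by (simp add: abs_mult flip: left_diff_distrib)
    qed
    ultimately show ?thesis by linarith
  qed
  then show ?thesis using V by blast
qed

text \<open>A permutation of the coordinates followed by separate maps on them. Every element of the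
  wreath product acts like this, with a translation as the permutation.\<close>

lemma mp_maps_coordinates:
  assumes h: "\<And>i. i \<in> I \<Longrightarrow> h i \<in> mp_maps M" and t: "bij_betw t I I"
  shows "(\<lambda>x. \<lambda>i\<in>I. h i (x (t i))) \<in> mp_maps PW"
proof -
  have t': "inj_on t I" "t \<in> I \<rightarrow> I" using t by (auto simp: bij_betw_def)
  have "(\<lambda>x. \<lambda>i\<in>I. x (t i)) \<in> mp_maps PW"
    unfolding mp_maps_def using distr_PiM_reindex[of I "\<lambda>_. M" t I] t' M
    by (auto intro!: measurable_restrict measurable_component_singleton)
  moreover have "(\<lambda>x. \<lambda>i\<in>I. h i (x i)) \<in> mp_maps PW"
  proof -
    have meas: "(\<lambda>x. \<lambda>i\<in>I. h i (x i)) \<in> measurable PW PW"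
      by (rule measurable_restrict, rule measurable_compose[OF measurable_component_singleton])
        (auto intro: mp_mapsD(1)[OF h])
    have "distr PW PW (\<lambda>x. \<lambda>i\<in>I. h i (x i)) = PW"
    proof (rule PP.PiM_eq)
      fix J F assume J: "finite J" "J \<subseteq> I" and F: "\<And>j. j \<in> J \<Longrightarrow> F j \<in> sets M"
      have hs: "h j -` F j \<inter> space M \<in> sets M" if "j \<in> J" for j
        using measurable_sets[OF mp_mapsD(1)[OF h] F] that J by auto
      have sp: "h j x \<in> space M" if "j \<in> I" "x \<in> space M" for j x
        using mp_maps_space[OF h] that by auto
      have "(\<lambda>x. \<lambda>i\<in>I. h i (x i)) -` prod_emb I (\<lambda>_. M) J (Pi\<^sub>E J F) \<inter> space PW
          = prod_emb I (\<lambda>_. M) J (\<Pi>\<^sub>E j\<in>J. h j -` F j \<inter> space M)"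
        using J sp by (auto simp: prod_emb_def space_PiM PiE_iff extensional_def subset_eq)
      then have "emeasure (distr PW PW (\<lambda>x. \<lambda>i\<in>I. h i (x i))) (prod_emb I (\<lambda>_. M) J (Pi\<^sub>E J F))
        = emeasure PW (prod_emb I (\<lambda>_. M) J (\<Pi>\<^sub>E j\<in>J. h j -` F j \<inter> space M))"
        using J F by (subst emeasure_distr[OF meas]) auto
      also have "\<dots> = (\<Prod>j\<in>J. emeasure M (h j -` F j \<inter> space M))"
        by (rule PP.emeasure_PiM_emb) (use J hs in auto)
      also have "\<dots> = (\<Prod>j\<in>J. emeasure M (F j))"
      proof (rule prod.cong)
        fix j assume "j \<in> J"
        then show "emeasure M (h j -` F j \<inter> space M) = emeasure M (F j)"
          using emeasure_distr[OF mp_mapsD(1)[OF h] F, of j j] mp_mapsD(2)[OF h, of j] J by auto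
      qed simp
      finally show "emeasure (distr PW PW (\<lambda>x. \<lambda>i\<in>I. h i (x i))) (prod_emb I (\<lambda>_. M) J (Pi\<^sub>E J F))
        = (\<Prod>j\<in>J. emeasure M (F j))" .
    qed simp
    then show ?thesis using meas by (simp add: mp_maps_def)
  qed
  ultimately have "(\<lambda>x. \<lambda>i\<in>I. h i (x i)) \<circ> (\<lambda>x. \<lambda>i\<in>I. x (t i)) \<in> mp_maps PW"
    by (rule mp_maps_comp[rotated])
  also have "(\<lambda>x. \<lambda>i\<in>I. h i (x i)) \<circ> (\<lambda>x. \<lambda>i\<in>I. x (t i)) = (\<lambda>x. \<lambda>i\<in>I. h i (x (t i)))"
    by (auto simp: fun_eq_iff restrict_def)
  finally show ?thesis .
qed

end

section \<open>The wreath product and its action\<close>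

text \<open>\<open>BijGroup\<close> consists of extensional bijections, hence the condition
  \<open>ext\<close>; bijectivity follows from the action of the inverse element.\<close>

lemma group_actionI:
  fixes G (structure)
  assumes "group G"
    and closed: "\<And>g x. g \<in> carrier G \<Longrightarrow> x \<in> E \<Longrightarrow> \<phi> g x \<in> E"
    and ext: "\<And>g. g \<in> carrier G \<Longrightarrow> \<phi> g \<in> extensional E"
    and one: "\<And>x. x \<in> E \<Longrightarrow> \<phi> \<one> x = x"
    and mult: "\<And>g h x. g \<in> carrier G \<Longrightarrow> h \<in> carrier G \<Longrightarrow> x \<in> E \<Longrightarrow> \<phi> (g \<otimes> h) x = \<phi> g (\<phi> h x)"
  shows "group_action G E \<phi>"
proof -
  interpret group G by fact
  have Bij: "\<phi> g \<in> Bij E" if g: "g \<in> carrier G" for g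
  proof -
    have "bij_betw (\<phi> g) E E"
      by (rule bij_betw_byWitness[where f' = "\<phi> (inv g)"])
        (use g closed in \<open>auto simp: one simp flip: mult\<close>)
    then show ?thesis using ext g by (simp add: Bij_def)
  qed
  have "\<phi> (g \<otimes> h) = compose E (\<phi> g) (\<phi> h)" if "g \<in> carrier G" "h \<in> carrier G" for g h
    by (rule extensionalityI[where A = E]) (use that ext mult in \<open>auto simp: compose_eq\<close>)
  then have "\<phi> \<in> hom G (BijGroup E)"
    by (auto simp: hom_def BijGroup_def Bij)
  then show ?thesis
    by (intro group_action.intro group_hom.intro group_hom_axioms.intro group_BijGroup \<open>group G\<close>)
qed

lemma mp_maps_cong:
  assumes "T \<in> mp_maps W" "\<And>x. x \<in> space W \<Longrightarrow> S x = T x"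
  shows "S \<in> mp_maps W"
proof -
  have "S \<in> measurable W W"
    using measurable_cong[of W S T W] assms mp_mapsD(1) by blast
  moreover have "distr W W S = distr W W T"
    by (rule distr_cong) (use assms in auto)
  ultimately show ?thesis using mp_mapsD(2)[OF assms(1)] by (simp add: mp_maps_def)
qed

locale wreath_pmp =
  fixes G :: "('g, 'm) monoid_scheme" (structure) and B :: "('b, 'n) monoid_scheme"
    and M :: "'x measure" and \<beta> :: "'b \<Rightarrow> 'x \<Rightarrow> 'x"
  assumes group_G: "group G" and countable_G: "countable (carrier G)" and infinite_G: "infinite (carrier G)"
    and group_B: "group B" and countable_B: "countable (carrier B)" and B_nontrivial: "carrier B \<noteq> {\<one>\<^bsub>B\<^esub>}"
    and standard_M: "standard_prob_space M" and pmp: "pmp_action B M \<beta>" and free_\<beta>: "ess_free B M \<beta>"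
begin

sublocale G: group G by (rule group_G)
sublocale B: group B by (rule group_B)
sublocale M: prob_space M using standard_M by (simp add: standard_prob_space_def)
sublocale \<beta>: group_action B "space M" \<beta> using pmp by (simp add: pmp_action_def)

abbreviation "W \<equiv> bernoulli_space G M"
abbreviation "H \<equiv> wreath B G"
abbreviation "act \<equiv> wreath_action G M \<beta>"
abbreviation "R \<equiv> wreath_eqrel B G M \<beta>"
abbreviation "e \<equiv> \<one>"

sublocale W: prob_space W
  unfolding bernoulli_space_def by (rule prob_space_PiM) (rule M.prob_space_axioms)

lemma space_W: "space W = carrier G \<rightarrow>\<^sub>E space M"
  by (simp add: bernoulli_space_def space_PiM)

lemma coordinate_measurable[measurable]: "d \<in> carrier G \<Longrightarrow> (\<lambda>x. x d) \<in> measurable W M"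
  unfolding bernoulli_space_def by simp

lemma W_mem: "x \<in> space W \<Longrightarrow> d \<in> carrier G \<Longrightarrow> x d \<in> space M"
  by (auto simp: space_W)

lemma W_ext: "x \<in> space W \<Longrightarrow> y \<in> space W \<Longrightarrow> (\<And>d. d \<in> carrier G \<Longrightarrow> x d = y d) \<Longrightarrow> x = y"
  unfolding space_W by (rule PiE_ext)

definition supp :: "('g \<Rightarrow> 'b) \<Rightarrow> 'g set" where
  "supp a = {d \<in> carrier G. a d \<noteq> \<one>\<^bsub>B\<^esub>}"

lemma carrier_H: "(a, g) \<in> carrier H \<longleftrightarrow> a \<in> carrier G \<rightarrow>\<^sub>E carrier B \<and> finite (supp a) \<and> g \<in> carrier G"
  by (auto simp: wreath_def Let_def carrier_sum_group group_B supp_def)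

lemma mult_H: "g \<in> carrier G \<Longrightarrow> (a, g) \<otimes>\<^bsub>H\<^esub> (a', g') =
    (\<lambda>d\<in>carrier G. a d \<otimes>\<^bsub>B\<^esub> a' (inv g \<otimes> d), g \<otimes> g')"
  by (auto simp: wreath_def Let_def shift_family_def)

lemma one_H: "\<one>\<^bsub>H\<^esub> = (\<lambda>d\<in>carrier G. \<one>\<^bsub>B\<^esub>, e)"
  by (simp add: wreath_def Let_def)

lemma H_cases:
  assumes "h \<in> carrier H"
  obtains a g where "h = (a, g)" "\<And>d. d \<in> carrier G \<Longrightarrow> a d \<in> carrier B" "a \<in> extensional (carrier G)"
    "finite (supp a)" "g \<in> carrier G"
  using assms by (cases h) (auto simp: carrier_H PiE_iff)

lemma snd_H[simp]: "h \<in> carrier H \<Longrightarrow> snd h \<in> carrier G"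
  by (auto elim!: H_cases)

lemma fst_H[simp]: "h \<in> carrier H \<Longrightarrow> d \<in> carrier G \<Longrightarrow> fst h d \<in> carrier B"
  by (auto elim!: H_cases)

lemma finite_supp: "h \<in> carrier H \<Longrightarrow> finite (supp (fst h))"
  by (auto elim!: H_cases)

lemma H_eqI:
  assumes "h \<in> carrier H" "k \<in> carrier H" "\<And>d. d \<in> carrier G \<Longrightarrow> fst h d = fst k d" "snd h = snd k"
  shows "h = k"
proof (rule prod_eqI)
  show "fst h = fst k"
    by (rule extensionalityI[where A = "carrier G"]) (use assms in \<open>auto elim!: H_cases\<close>)
qed fact

lemma fst_mult_H: "h \<in> carrier H \<Longrightarrow> d \<in> carrier G \<Longrightarrow>
    fst (h \<otimes>\<^bsub>H\<^esub> k) d = fst h d \<otimes>\<^bsub>B\<^esub> fst k (inv (snd h) \<otimes> d)"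
  by (cases h, cases k) (auto simp: mult_H carrier_H)

lemma snd_mult_H[simp]: "h \<in> carrier H \<Longrightarrow> snd (h \<otimes>\<^bsub>H\<^esub> k) = snd h \<otimes> snd k"
  by (cases h, cases k) (auto simp: mult_H carrier_H)

lemma fst_one_H[simp]: "d \<in> carrier G \<Longrightarrow> fst \<one>\<^bsub>H\<^esub> d = \<one>\<^bsub>B\<^esub>"
  by (simp add: one_H)

lemma snd_one_H[simp]: "snd \<one>\<^bsub>H\<^esub> = e"
  by (simp add: one_H)

lemma translate_cancel[simp]:
  "g \<in> carrier G \<Longrightarrow> d \<in> carrier G \<Longrightarrow> inv g \<otimes> (g \<otimes> d) = d"
  "g \<in> carrier G \<Longrightarrow> d \<in> carrier G \<Longrightarrow> g \<otimes> (inv g \<otimes> d) = d"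
  by (simp_all flip: G.m_assoc)

lemma finite_translate:
  assumes "finite F" "g \<in> carrier G"
  shows "finite {d \<in> carrier G. g \<otimes> d \<in> F}"
proof (rule finite_imageD)
  show "finite ((\<lambda>d. g \<otimes> d) ` {d \<in> carrier G. g \<otimes> d \<in> F})"
    by (rule finite_subset[OF _ assms(1)]) auto
  show "inj_on (\<lambda>d. g \<otimes> d) {d \<in> carrier G. g \<otimes> d \<in> F}"
    using assms(2) by (auto simp: inj_on_def)
qed

lemma finite_translate_right:
  assumes "finite F" "g \<in> carrier G"
  shows "finite {d \<in> carrier G. d \<otimes> g \<in> F}"
proof (rule finite_imageD)
  show "finite ((\<lambda>d. d \<otimes> g) ` {d \<in> carrier G. d \<otimes> g \<in> F})"
    by (rule finite_subset[OF _ assms(1)]) auto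
  show "inj_on (\<lambda>d. d \<otimes> g) {d \<in> carrier G. d \<otimes> g \<in> F}"
    using assms(2) by (auto simp: inj_on_def)
qed

lemma group_H: "group H"
proof (rule groupI)
  fix h k assume h: "h \<in> carrier H" and k: "k \<in> carrier H"
  obtain a g a' g' where hk: "h = (a, g)" "k = (a', g')" by (cases h, cases k)
  have g: "g \<in> carrier G" "g' \<in> carrier G" using h k hk by (auto simp: carrier_H)
  have "finite (supp a \<union> {d \<in> carrier G. inv g \<otimes> d \<in> supp a'})"
    using h k g by (auto simp: carrier_H hk finite_translate)
  then have "finite (supp (\<lambda>d\<in>carrier G. a d \<otimes>\<^bsub>B\<^esub> a' (inv g \<otimes> d)))"
    by (rule finite_subset[rotated]) (use g in \<open>auto simp: supp_def\<close>)
  then show "h \<otimes>\<^bsub>H\<^esub> k \<in> carrier H"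
    using h k g by (auto simp: hk mult_H carrier_H PiE_iff)
next
  show "\<one>\<^bsub>H\<^esub> \<in> carrier H" by (auto simp: one_H carrier_H supp_def)
next
  fix x y z assume xyz: "x \<in> carrier H" "y \<in> carrier H" "z \<in> carrier H"
  then show "x \<otimes>\<^bsub>H\<^esub> y \<otimes>\<^bsub>H\<^esub> z = x \<otimes>\<^bsub>H\<^esub> (y \<otimes>\<^bsub>H\<^esub> z)"
    by (cases x; cases y; cases z)
      (auto simp: mult_H carrier_H PiE_iff fun_eq_iff B.m_assoc G.m_assoc G.inv_mult_group)
next
  fix x assume x: "x \<in> carrier H"
  then obtain a g where ag: "x = (a, g)" "\<And>d. d \<in> carrier G \<Longrightarrow> a d \<in> carrier B"
    "a \<in> extensional (carrier G)" "finite (supp a)" "g \<in> carrier G"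
    by (rule H_cases) (rule that; assumption)
  show "\<one>\<^bsub>H\<^esub> \<otimes>\<^bsub>H\<^esub> x = x"
    unfolding ag one_H mult_H[OF G.one_closed]
    using ag by (auto simp: fun_eq_iff extensional_def)
  let ?y = "(\<lambda>d\<in>carrier G. inv\<^bsub>B\<^esub> (a (g \<otimes> d)), inv g)"
  have "supp (\<lambda>d\<in>carrier G. inv\<^bsub>B\<^esub> (a (g \<otimes> d))) \<subseteq> {d \<in> carrier G. g \<otimes> d \<in> supp a}"
    using ag by (auto simp: supp_def)
  then have "finite (supp (\<lambda>d\<in>carrier G. inv\<^bsub>B\<^esub> (a (g \<otimes> d))))"
    using finite_translate ag finite_subset by blast
  then have "?y \<in> carrier H" using ag by (auto simp: carrier_H)
  moreover have "?y \<otimes>\<^bsub>H\<^esub> x = \<one>\<^bsub>H\<^esub>"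
    using ag by (auto simp: mult_H one_H fun_eq_iff)
  ultimately show "\<exists>y\<in>carrier H. y \<otimes>\<^bsub>H\<^esub> x = \<one>\<^bsub>H\<^esub>" by blast
qed

sublocale H: group H by (rule group_H)

lemma snd_hom: "group_hom H G snd"
  by unfold_locales (auto simp: hom_def)

lemma snd_inv_H[simp]: "h \<in> carrier H \<Longrightarrow> snd (inv\<^bsub>H\<^esub> h) = inv (snd h)"
  by (rule group_hom.hom_inv[OF snd_hom])

lemma countable_H: "countable (carrier H)"
proof -
  let ?S = "{a \<in> carrier G \<rightarrow>\<^sub>E carrier B. finite (supp a)}"
  have "countable ?S"
  proof (rule countable_image_inj_on)
    \<comment> \<open>A finitely supported family is encoded by its finite graph over the support,
      since its values elsewhere are known.\<close>
    let ?f = "\<lambda>a. (\<lambda>d. (d, a d)) ` supp a"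
    show "countable (?f ` ?S)"
      by (rule countable_subset[OF _ countable_Collect_finite_subset[of "carrier G \<times> carrier B"]])
        (auto simp: countable_G countable_B supp_def)
    show "inj_on ?f ?S"
    proof (rule inj_onI)
      fix a a' assume a: "a \<in> ?S" "a' \<in> ?S" and eq: "?f a = ?f a'"
      have *: "d \<in> supp a \<and> y = a d \<longleftrightarrow> d \<in> supp a' \<and> y = a' d" for d y
      proof -
        have "(d, y) \<in> ?f a \<longleftrightarrow> (d, y) \<in> ?f a'" using eq by simp
        then show ?thesis by auto
      qed
      have "a d = a' d" if "d \<in> carrier G" for d
        using *[of d "a d"] *[of d "a' d"] that by (auto simp: supp_def)
      then show "a = a'"
        using a by (intro extensionalityI[where A = "carrier G"]) (auto simp: PiE_iff)
    qed
  qed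
  then have "countable (?S \<times> carrier G)" using countable_G by simp
  moreover have "carrier H = ?S \<times> carrier G" by (auto simp: carrier_H)
  ultimately show ?thesis by simp
qed

lemma act_apply: "h \<in> carrier H \<Longrightarrow> x \<in> space W \<Longrightarrow> d \<in> carrier G \<Longrightarrow>
    act h x d = \<beta> (fst h d) (x (inv (snd h) \<otimes> d))"
  by (cases h) (auto simp: wreath_action_def bernoulli_shift_def shift_family_def carrier_H)

lemma \<beta>_closed: "b \<in> carrier B \<Longrightarrow> x \<in> space M \<Longrightarrow> \<beta> b x \<in> space M"
  using \<beta>.element_image by blast

lemma \<beta>_mp: "b \<in> carrier B \<Longrightarrow> \<beta> b \<in> mp_maps M"
  using pmp by (auto simp: pmp_action_def mp_maps_def)

lemma \<beta>_one: "x \<in> space M \<Longrightarrow> \<beta> \<one>\<^bsub>B\<^esub> x = x"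
  by (metis \<beta>.id_eq_one restrict_apply')

lemma act_closed[simp]: "h \<in> carrier H \<Longrightarrow> x \<in> space W \<Longrightarrow> act h x \<in> space W"
  by (cases h) (auto simp: wreath_action_def bernoulli_shift_def shift_family_def carrier_H space_W
      intro!: \<beta>_closed)

lemma act_one[simp]: "x \<in> space W \<Longrightarrow> act \<one>\<^bsub>H\<^esub> x = x"
  by (rule W_ext) (auto simp: act_apply \<beta>_one W_mem)

lemma act_mult: "h \<in> carrier H \<Longrightarrow> k \<in> carrier H \<Longrightarrow> x \<in> space W \<Longrightarrow> act (h \<otimes>\<^bsub>H\<^esub> k) x = act h (act k x)"
  by (rule W_ext) (auto simp: act_apply fst_mult_H \<beta>.composition_rule W_mem G.inv_mult_group G.m_assoc)

sublocale act: group_action H "space W" act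
proof (rule group_actionI[OF group_H])
  fix h assume "h \<in> carrier H"
  show "act h \<in> extensional (space W)" by (cases h) (simp add: wreath_action_def)
qed (auto simp: act_mult)

lemma act_inv[simp]:
  "h \<in> carrier H \<Longrightarrow> x \<in> space W \<Longrightarrow> act (inv\<^bsub>H\<^esub> h) (act h x) = x"
  "h \<in> carrier H \<Longrightarrow> x \<in> space W \<Longrightarrow> act h (act (inv\<^bsub>H\<^esub> h) x) = x"
  by (simp_all flip: act_mult)

lemma bij_translate: "g \<in> carrier G \<Longrightarrow> bij_betw (\<lambda>d. g \<otimes> d) (carrier G) (carrier G)"
  by (rule bij_betw_byWitness[where f' = "\<lambda>d. inv g \<otimes> d"]) (auto simp flip: G.m_assoc)

lemma act_mp: 
  assumes h: "h \<in> carrier H"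
  shows "act h \<in> mp_maps W"
proof -
  have "(\<lambda>x. \<lambda>d\<in>carrier G. \<beta> (fst h d) (x (inv (snd h) \<otimes> d))) \<in> mp_maps W"
    unfolding bernoulli_space_def
    by (rule mp_maps_coordinates[OF M.prob_space_axioms]) (use h in \<open>auto intro!: \<beta>_mp bij_translate\<close>)
  then show ?thesis
  proof (rule mp_maps_cong)
    fix x assume x: "x \<in> space W"
    show "act h x = (\<lambda>d\<in>carrier G. \<beta> (fst h d) (x (inv (snd h) \<otimes> d)))"
      using act_closed[OF h x] h x
      by (intro extensionalityI[where A = "carrier G"]) (auto simp: act_apply space_W PiE_iff)
  qed
qed

lemma act_measurable[measurable]: "h \<in> carrier H \<Longrightarrow> act h \<in> measurable W W"
  using act_mp mp_mapsD(1) by blast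

lemma act_ae_inverse: "h \<in> carrier H \<Longrightarrow> ae_inverse W (act h) (act (inv\<^bsub>H\<^esub> h))"
  by (auto simp: ae_inverse_def act_mp intro!: AE_I2)

section \<open>Shifts and changes of one coordinate as elements of the wreath product\<close>

definition sh :: "'g \<Rightarrow> ('g \<Rightarrow> 'b) \<times> 'g" where
  "sh g = (\<lambda>d\<in>carrier G. \<one>\<^bsub>B\<^esub>, g)"

definition bs :: "'b \<Rightarrow> 'g \<Rightarrow> ('g \<Rightarrow> 'b) \<times> 'g" where
  "bs b c = (\<lambda>d\<in>carrier G. if d = c then b else \<one>\<^bsub>B\<^esub>, e)"

lemma sh_closed[simp]: "g \<in> carrier G \<Longrightarrow> sh g \<in> carrier H"
  by (auto simp: sh_def carrier_H supp_def)

lemma snd_sh[simp]: "snd (sh g) = g" by (simp add: sh_def)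

lemma fst_sh[simp]: "d \<in> carrier G \<Longrightarrow> fst (sh g) d = \<one>\<^bsub>B\<^esub>" by (simp add: sh_def)

lemma bs_closed[simp]: "b \<in> carrier B \<Longrightarrow> bs b c \<in> carrier H"
proof -
  assume "b \<in> carrier B"
  moreover have "supp (\<lambda>d\<in>carrier G. if d = c then b else \<one>\<^bsub>B\<^esub>) \<subseteq> {c}" by (auto simp: supp_def)
  then have "finite (supp (\<lambda>d\<in>carrier G. if d = c then b else \<one>\<^bsub>B\<^esub>))" by (rule finite_subset) simp
  ultimately show ?thesis by (auto simp: bs_def carrier_H)
qed

lemma snd_bs[simp]: "snd (bs b c) = e" by (simp add: bs_def)

lemma fst_bs[simp]: "d \<in> carrier G \<Longrightarrow> fst (bs b c) d = (if d = c then b else \<one>\<^bsub>B\<^esub>)"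
  by (simp add: bs_def)

lemma sh_mult: "g \<in> carrier G \<Longrightarrow> g' \<in> carrier G \<Longrightarrow> sh (g \<otimes> g') = sh g \<otimes>\<^bsub>H\<^esub> sh g'"
  by (rule H_eqI) (auto simp: fst_mult_H)

lemma sh_one: "sh e = \<one>\<^bsub>H\<^esub>"
  by (simp add: sh_def one_H)

lemma sh_hom: "group_hom G H sh"
  by unfold_locales (auto simp: hom_def sh_mult)

lemma sh_inv: "g \<in> carrier G \<Longrightarrow> sh (inv g) = inv\<^bsub>H\<^esub> (sh g)"
  by (rule group_hom.hom_inv[OF sh_hom])

text \<open>A change at e before the shift by g is a change at g after it when c is e. This is how
  distant coordinates are reached, and how statements about e are carried to all other
  coordinates.\<close>

lemma sh_bs: "g \<in> carrier G \<Longrightarrow> c \<in> carrier G \<Longrightarrow> b \<in> carrier B \<Longrightarrow>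
    sh g \<otimes>\<^bsub>H\<^esub> bs b c = bs b (g \<otimes> c) \<otimes>\<^bsub>H\<^esub> sh g"
  by (rule H_eqI) (auto simp: fst_mult_H)

lemma shift_eq_act:
  assumes g: "g \<in> carrier G"
  shows "bernoulli_shift G M g = act (sh g)"
proof (rule extensionalityI[where A = "space W"])
  show "bernoulli_shift G M g \<in> extensional (space W)" by (simp add: bernoulli_shift_def)
  show "act (sh g) \<in> extensional (space W)" by (simp add: wreath_action_def sh_def)
  fix x assume x: "x \<in> space W"
  show "bernoulli_shift G M g x = act (sh g) x"
    using act_closed[OF sh_closed[OF g] x] x g
    by (intro extensionalityI[where A = "carrier G"])
      (auto simp: bernoulli_shift_def shift_family_def space_W PiE_iff act_apply[OF sh_closed[OF g]] \<beta>_one)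
qed

lemma R_iff: "(x, y) \<in> R \<longleftrightarrow> x \<in> space W \<and> (\<exists>h\<in>carrier H. y = act h x)"
  by (auto simp: wreath_eqrel_def orbit_eqrel_def orbit_def)

lemma equiv_R: "equiv (space W) R"
proof (rule equivI)
  show "R \<subseteq> space W \<times> space W" by (auto simp: R_iff)
  show "refl_on (space W) R"
    unfolding refl_on_def using act_one by (force simp: R_iff)
  show "sym R"
  proof (rule symI)
    fix x y assume "(x, y) \<in> R"
    then obtain h where "h \<in> carrier H" "x \<in> space W" "y = act h x" by (auto simp: R_iff)
    then show "(y, x) \<in> R" by (auto simp: R_iff intro!: bexI[of _ "inv\<^bsub>H\<^esub> h"])
  qed
  show "trans R"
  proof (rule transI)
    fix x y z assume "(x, y) \<in> R" "(y, z) \<in> R"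
    then obtain h k where "h \<in> carrier H" "x \<in> space W" "y = act h x" "k \<in> carrier H" "z = act k y"
      by (auto simp: R_iff)
    then show "(x, z) \<in> R" by (auto simp: R_iff act_mult intro!: bexI[of _ "k \<otimes>\<^bsub>H\<^esub> h"])
  qed
qed


section \<open>Separation of points and sets moved by the action\<close>

lemma separating_family:
  "\<exists>E :: nat \<Rightarrow> 'x set. (\<forall>n. E n \<in> sets M) \<and>
     (\<forall>x\<in>space M. \<forall>y\<in>space M. (\<forall>n. x \<in> E n \<longleftrightarrow> y \<in> E n) \<longrightarrow> x = y)"
proof -
  obtain T where T: "completely_metrizable_space T" "second_countable T" "topspace T = space M"
    "sets M = sigma_sets (space M) {U. openin T U}"
    using standard_M by (auto simp: standard_prob_space_def)
  obtain \<B> where \<B>: "countable \<B>" "\<And>V. V \<in> \<B> \<Longrightarrow> openin T V"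
    "\<And>U x. openin T U \<Longrightarrow> x \<in> U \<Longrightarrow> \<exists>V\<in>\<B>. x \<in> V \<and> V \<subseteq> U"
    using T(2) unfolding second_countable_def by metis
  have haus: "Hausdorff_space T"
    using T(1) by (simp add: completely_metrizable_imp_metrizable_space metrizable_imp_Hausdorff_space)
  define E where "E = from_nat_into (insert {} \<B>)"
  have rE: "range E = insert {} \<B>" unfolding E_def by (rule range_from_nat_into) (use \<B>(1) in auto)
  have "E n \<in> sets M" for n
  proof -
    have "E n \<in> insert {} \<B>" using rE by auto
    then have "openin T (E n)" using \<B>(2) by auto
    then show ?thesis unfolding T(4) by (auto intro: sigma_sets.Basic)
  qed
  moreover have "x = y" if xy: "x \<in> space M" "y \<in> space M" "\<forall>n. x \<in> E n \<longleftrightarrow> y \<in> E n" for x y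
  proof (rule ccontr)
    assume "x \<noteq> y"
    then obtain U V where "openin T U" "openin T V" "x \<in> U" "y \<in> V" "disjnt U V"
      using haus xy(1,2) T(3) unfolding Hausdorff_space_def by metis
    moreover from this obtain U' where "U' \<in> \<B>" "x \<in> U'" "U' \<subseteq> U" using \<B>(3) by blast
    moreover from this obtain n where "U' = E n" using rE by auto
    ultimately show False using xy(3) by (auto simp: disjnt_iff)
  qed
  ultimately show ?thesis by blast
qed

text \<open>A countable separating family on each of the countably many coordinates turns equality
  into countably many measurable conditions. The free part and the return elements are measurable
  for this reason.\<close>

lemma measurable_eq_set:
  assumes f: "f \<in> measurable N W" and g: "g \<in> measurable N W"
  shows "{z \<in> space N. f z = g z} \<in> sets N"
proof -
  obtain E :: "nat \<Rightarrow> 'x set" where E: "\<And>n. E n \<in> sets M"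
    "\<And>x y. x\<in>space M \<Longrightarrow> y\<in>space M \<Longrightarrow> (\<And>n. x \<in> E n \<longleftrightarrow> y \<in> E n) \<Longrightarrow> x = y"
    using separating_family by metis
  have fW: "f z \<in> space W" and gW: "g z \<in> space W" if "z \<in> space N" for z
    by (rule measurable_space[OF f that], rule measurable_space[OF g that])
  have "f z = g z \<longleftrightarrow> (\<forall>d\<in>carrier G. \<forall>n. f z d \<in> E n \<longleftrightarrow> g z d \<in> E n)" if z: "z \<in> space N" for z
  proof
    assume "\<forall>d\<in>carrier G. \<forall>n. f z d \<in> E n \<longleftrightarrow> g z d \<in> E n"
    then show "f z = g z"
      using fW[OF z] gW[OF z] by (intro W_ext) (auto intro!: E(2) W_mem)
  qed simp
  then have "{z \<in> space N. f z = g z} =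
      {z \<in> space N. \<forall>d\<in>carrier G. \<forall>n. f z d \<in> E n \<longleftrightarrow> g z d \<in> E n}" by auto
  also have "\<dots> \<in> sets N"
  proof (intro sets.sets_Collect_countable_All' countable_G sets.sets_Collect_countable_All)
    fix d n assume d: "d \<in> carrier G"
    note [measurable] = f g E(1)[of n] coordinate_measurable[OF d]
    show "{z \<in> space N. f z d \<in> E n \<longleftrightarrow> g z d \<in> E n} \<in> sets N" by measurable
  qed
  finally show ?thesis .
qed

lemma AE_coordinate: "d \<in> carrier G \<Longrightarrow> AE x in M. P x \<Longrightarrow> AE x in W. P (x d)"
  unfolding bernoulli_space_def
  by (rule AE_PiM_component) (auto intro: M.prob_space_axioms)

lemma measure_coordinate:
  assumes d: "d \<in> carrier G" and A: "A \<in> sets M"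
  shows "measure W {z \<in> space W. z d \<in> A} = measure M A"
proof -
  have "distr W M (\<lambda>x. x d) = M"
    unfolding bernoulli_space_def by (rule distr_PiM_component) (auto intro: M.prob_space_axioms d)
  then have "measure M A = measure W ((\<lambda>x. x d) -` A \<inter> space W)"
    using measure_distr[OF coordinate_measurable[OF d] A] by simp
  also have "(\<lambda>x. x d) -` A \<inter> space W = {z \<in> space W. z d \<in> A}" by auto
  finally show ?thesis by simp
qed

text \<open>If b moved none of the separating sets, it would fix almost every point, against
  freeness. A set moved on positive measure is neither null nor conull, since b preserves the
  measure.\<close>

lemma moving_set:
  obtains b E where "b \<in> carrier B" "E \<in> sets M" "0 < measure M {x \<in> space M. (\<beta> b x \<in> E) \<noteq> (x \<in> E)}"
    "0 < measure M E" "measure M E < 1"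
proof -
  obtain b where b: "b \<in> carrier B" "b \<noteq> \<one>\<^bsub>B\<^esub>"
    using B_nontrivial B.one_closed by blast
  obtain E :: "nat \<Rightarrow> 'x set" where E: "\<And>n. E n \<in> sets M"
    "\<And>x y. x\<in>space M \<Longrightarrow> y\<in>space M \<Longrightarrow> (\<And>n. x \<in> E n \<longleftrightarrow> y \<in> E n) \<Longrightarrow> x = y"
    using separating_family by metis
  note [measurable] = E(1) mp_mapsD(1)[OF \<beta>_mp[OF b(1)]]
  let ?D = "\<lambda>n. {x \<in> space M. (\<beta> b x \<in> E n) \<noteq> (x \<in> E n)}"
  have D: "?D n \<in> sets M" for n by measurable
  have "\<exists>n. measure M (?D n) > 0"
  proof (rule ccontr)
    assume "\<not> (\<exists>n. measure M (?D n) > 0)"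
    then have "\<not> 0 < measure M (?D n)" for n by blast
    then have "measure M (?D n) = 0" for n using measure_nonneg[of M "?D n"] by (metis less_le)
    then have "AE x in M. x \<notin> ?D n" for n
      using D M.prob_eq_0 by blast
    then have "AE x in M. \<forall>n. x \<notin> ?D n" by (simp add: AE_all_countable)
    moreover have "AE x in M. \<beta> b x \<noteq> x" using free_\<beta> b by (simp add: ess_free_def)
    ultimately have "AE x in M. False"
    proof (rule AE_mp[OF _ AE_mp], intro AE_I2 impI)
      fix x assume "x \<in> space M" "\<beta> b x \<noteq> x" "\<forall>n. x \<notin> ?D n"
      then show False using E(2)[of "\<beta> b x" x] \<beta>_closed[OF b(1)] by auto
    qed
    then show False using M.AE_False by simp
  qed
  then obtain n where n: "measure M (?D n) > 0" by blast
  have pre: "measure M (\<beta> b -` E n \<inter> space M) = measure M (E n)"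
    using measure_mp_maps[OF \<beta>_mp[OF b(1)]] E(1) by blast
  have mE: "\<beta> b -` E n \<inter> space M \<in> sets M" by measurable
  have "measure M (E n) \<noteq> 0"
  proof
    assume 0: "measure M (E n) = 0"
    have "measure M (?D n) \<le> measure M (E n \<union> (\<beta> b -` E n \<inter> space M))"
      by (rule M.finite_measure_mono) (use E mE in auto)
    also have "\<dots> \<le> measure M (E n) + measure M (\<beta> b -` E n \<inter> space M)"
      by (rule measure_Un_le) (use E mE in auto)
    finally show False using n 0 pre by simp
  qed
  moreover have "measure M (E n) \<noteq> 1"
  proof
    assume 1: "measure M (E n) = 1"
    have "measure M (?D n) \<le> measure M ((space M - E n) \<union> (space M - (\<beta> b -` E n \<inter> space M)))"
      by (rule M.finite_measure_mono) (use E mE in auto)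
    also have "\<dots> \<le> measure M (space M - E n) + measure M (space M - (\<beta> b -` E n \<inter> space M))"
      by (rule measure_Un_le) (use E mE in auto)
    also have "\<dots> = 0" using 1 pre mE E(1) by (simp add: M.prob_compl)
    finally show False using n by simp
  qed
  moreover have "measure M (E n) \<le> 1" by simp
  ultimately show ?thesis using b n E by (intro that[of b "E n"]) (auto simp: less_le)
qed

section \<open>Mixing, ergodicity and insensitivity to distant coordinates\<close>

lemma depends_on_act:
  assumes "depends_on K (space W) V" "K \<subseteq> carrier G" and h: "h \<in> carrier H"
  shows "depends_on ((\<lambda>k. inv (snd h) \<otimes> k) ` K) (space W) (act h -` V \<inter> space W)"
  unfolding depends_on_def
proof (intro ballI impI)
  fix x y assume xy: "x \<in> space W" "y \<in> space W" "\<forall>i\<in>(\<lambda>k. inv (snd h) \<otimes> k) ` K. x i = y i"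
  then have "act h x \<in> V \<longleftrightarrow> act h y \<in> V"
    using assms(2) h by (intro depends_onD[OF assms(1)]) (auto simp: act_apply)
  then show "x \<in> act h -` V \<inter> space W \<longleftrightarrow> y \<in> act h -` V \<inter> space W" using xy by auto
qed

lemma approx_W:
  assumes "U \<in> sets W" "\<epsilon> > 0"
  obtains F V where "finite F" "F \<subseteq> carrier G" "V \<in> sets W" "depends_on F (space W) V"
    "measure W (sym_diff U V) < \<epsilon>"
  using approx_depends_on[OF M.prob_space_axioms, of U "carrier G" \<epsilon>] assms that
  unfolding bernoulli_space_def by blast

lemma asymp_indep_W:
  assumes "U \<in> sets W" "\<epsilon> > 0"
  obtains F where "finite F" "F \<subseteq> carrier G"
    "\<And>A. A \<in> sets W \<Longrightarrow> depends_on (carrier G - F) (space W) A \<Longrightarrow>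
      \<bar>measure W (U \<inter> A) - measure W U * measure W A\<bar> \<le> \<epsilon>"
  using asymptotic_independence[OF M.prob_space_axioms, of U "carrier G" \<epsilon>] assms that
  unfolding bernoulli_space_def by blast

lemma coordinate_positive:
  assumes U: "U \<in> sets W" "measure W U > 0" and p: "p > 0"
  obtains F where "finite F" "\<And>i A. i \<in> carrier G - F \<Longrightarrow> A \<in> sets M \<Longrightarrow> measure M A = p \<Longrightarrow>
    measure W (U \<inter> {z \<in> space W. z i \<in> A}) > 0"
proof -
  obtain F where F: "finite F" "F \<subseteq> carrier G"
    "\<And>A. A \<in> sets W \<Longrightarrow> depends_on (carrier G - F) (space W) A \<Longrightarrow>
      \<bar>measure W (U \<inter> A) - measure W U * measure W A\<bar> \<le> measure W U * p / 2"
    using asymp_indep_W[OF U(1), of "measure W U * p / 2"] U p by auto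
  have "measure W (U \<inter> {z \<in> space W. z i \<in> A}) > 0"
    if i: "i \<in> carrier G - F" and A: "A \<in> sets M" "measure M A = p" for i A
  proof -
    have [measurable]: "(\<lambda>x. x i) \<in> measurable W M" "A \<in> sets M" using i A by auto
    have "{z \<in> space W. z i \<in> A} \<in> sets W" by measurable
    moreover have "depends_on (carrier G - F) (space W) {z \<in> space W. z i \<in> A}"
      unfolding depends_on_def using i by auto
    ultimately have "\<bar>measure W (U \<inter> {z \<in> space W. z i \<in> A}) - measure W U * p\<bar> \<le> measure W U * p / 2"
      using F(3)[of "{z \<in> space W. z i \<in> A}"] measure_coordinate[of i A] i A by simp
    moreover have "measure W U * p > 0" using U p by simp
    ultimately show ?thesis by linarith
  qed
  then show ?thesis by (rule that[OF F(1)])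
qed

text \<open>By independence the event at i and j has measure p (1 - p), and at least half of the
  expected share of it survives in \<open>U\<close>. F is fixed before the coordinates and before A,
  of which only the measure enters; so A may depend on a group element chosen with regard to
  F.\<close>

lemma coordinate_pair_bound:
  assumes U: "U \<in> sets W" "measure W U > 0" and p: "0 < p" "p < 1"
  obtains F where "finite F" "\<And>i j A. i \<in> carrier G - F \<Longrightarrow> j \<in> carrier G - F \<Longrightarrow> i \<noteq> j \<Longrightarrow>
    A \<in> sets M \<Longrightarrow> measure M A = p \<Longrightarrow>
    measure W U * (p * (1 - p)) / 2 \<le> measure W (U \<inter> {z \<in> space W. z i \<in> A \<and> z j \<notin> A})"
proof -
  define q where "q = p * (1 - p)"
  have q: "q > 0" using p by (simp add: q_def)
  obtain F where F: "finite F" "F \<subseteq> carrier G"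
    "\<And>A. A \<in> sets W \<Longrightarrow> depends_on (carrier G - F) (space W) A \<Longrightarrow>
      \<bar>measure W (U \<inter> A) - measure W U * measure W A\<bar> \<le> measure W U * q / 2"
    using asymp_indep_W[OF U(1), of "measure W U * q / 2"] U q by auto
  have "measure W U * (p * (1 - p)) / 2 \<le> measure W (U \<inter> {z \<in> space W. z i \<in> A \<and> z j \<notin> A})"
    if ij: "i \<in> carrier G - F" "j \<in> carrier G - F" "i \<noteq> j" and A: "A \<in> sets M" "measure M A = p" for i j A
  proof -
    have [measurable]: "(\<lambda>x. x i) \<in> measurable W M" "(\<lambda>x. x j) \<in> measurable W M" "A \<in> sets M" using ij A by auto
    have s: "{z \<in> space W. z i \<in> A} \<in> sets W" "{z \<in> space W. z j \<in> space M - A} \<in> sets W" by measurable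
    have "{z \<in> space W. z i \<in> A \<and> z j \<notin> A} = {z \<in> space W. z i \<in> A} \<inter> {z \<in> space W. z j \<in> space M - A}"
      using W_mem ij by auto
    moreover have "measure W ({z \<in> space W. z i \<in> A} \<inter> {z \<in> space W. z j \<in> space M - A}) =
      measure W {z \<in> space W. z i \<in> A} * measure W {z \<in> space W. z j \<in> space M - A}"
      using s unfolding bernoulli_space_def
      by (intro indep_depends_on[OF M.prob_space_axioms, where J = "{i}" and K = "{j}"])
        (use ij in \<open>auto simp: depends_on_def\<close>)
    ultimately have "measure W {z \<in> space W. z i \<in> A \<and> z j \<notin> A} = q"
      using ij A measure_coordinate[of i A] measure_coordinate[of j "space M - A"]
      by (simp add: q_def M.prob_compl)
    moreover have "{z \<in> space W. z i \<in> A \<and> z j \<notin> A} \<in> sets W" by measurable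
    moreover have "depends_on (carrier G - F) (space W) {z \<in> space W. z i \<in> A \<and> z j \<notin> A}"
      unfolding depends_on_def using ij by auto
    ultimately have "\<bar>measure W (U \<inter> {z \<in> space W. z i \<in> A \<and> z j \<notin> A}) - measure W U * q\<bar> \<le> measure W U * q / 2"
      using F(3)[of "{z \<in> space W. z i \<in> A \<and> z j \<notin> A}"] by simp
    then show ?thesis unfolding q_def[symmetric] by linarith
  qed
  then show ?thesis by (rule that[OF F(1)])
qed

lemma vimage_act_sets: "h \<in> carrier H \<Longrightarrow> V \<in> sets W \<Longrightarrow> act h -` V \<inter> space W \<in> sets W"
  using measurable_sets[OF act_measurable] by blast

text \<open>Only the \<Gamma>-part of h decides where coordinates are carried; the other part acts
  inside the coordinates and does not affect which of them a set depends on. Hence the bound holds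
  for all h with a \<Gamma>-part outside F.\<close>

lemma mixing:
  assumes U: "U \<in> sets W" and V: "V \<in> sets W" and \<epsilon>: "\<epsilon> > 0"
  obtains F where "finite F" "\<And>h. h \<in> carrier H \<Longrightarrow> snd h \<notin> F \<Longrightarrow>
    \<bar>measure W (U \<inter> (act h -` V \<inter> space W)) - measure W U * measure W V\<bar> \<le> \<epsilon>"
proof -
  obtain K V' where V': "finite K" "K \<subseteq> carrier G" "V' \<in> sets W" "depends_on K (space W) V'"
    "measure W (sym_diff V V') < \<epsilon> / 3"
    using approx_W[OF V, of "\<epsilon> / 3"] \<epsilon> by auto
  obtain F where F: "finite F" "F \<subseteq> carrier G"
    "\<And>A. A \<in> sets W \<Longrightarrow> depends_on (carrier G - F) (space W) A \<Longrightarrow>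
      \<bar>measure W (U \<inter> A) - measure W U * measure W A\<bar> \<le> \<epsilon> / 3"
    using asymp_indep_W[OF U, of "\<epsilon> / 3"] \<epsilon> by auto
  \<comment> \<open>The elements g for which \<open>inv g \<otimes> k\<close> lies in F for some k
    in K, so that the set pulled back by g may see a coordinate in F.\<close>
  let ?F = "(\<lambda>(k, f). k \<otimes> inv f) ` (K \<times> F)"
  have "\<bar>measure W (U \<inter> (act h -` V \<inter> space W)) - measure W U * measure W V\<bar> \<le> \<epsilon>"
    if h: "h \<in> carrier H" "snd h \<notin> ?F" for h
  proof -
    let ?V = "act h -` V \<inter> space W" and ?V' = "act h -` V' \<inter> space W"
    have meas: "?V \<in> sets W" "?V' \<in> sets W" using h V V' vimage_act_sets by auto
    have "depends_on (carrier G - F) (space W) ?V'"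
    proof (rule depends_on_mono[OF depends_on_act[OF V'(4,2) h(1)]])
      show "(\<lambda>k. inv (snd h) \<otimes> k) ` K \<subseteq> carrier G - F"
      proof clarify
        fix k assume k: "k \<in> K"
        then have kG: "k \<in> carrier G" using V' by auto
        have "inv (snd h) \<otimes> k \<notin> F"
        proof
          assume f: "inv (snd h) \<otimes> k \<in> F"
          have "k \<otimes> inv (inv (snd h) \<otimes> k) = snd h"
            using h kG by (simp add: G.inv_mult_group)
          then show False using h(2) k f by force
        qed
        then show "inv (snd h) \<otimes> k \<in> carrier G - F" using h kG by auto
      qed
    qed
    then have 1: "\<bar>measure W (U \<inter> ?V') - measure W U * measure W ?V'\<bar> \<le> \<epsilon> / 3"
      using F(3) meas by blast
    have eq: "measure W ?V = measure W V" "measure W ?V' = measure W V'"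
      using measure_mp_maps[OF act_mp[OF h(1)]] V V' by auto
    have sd: "measure W (sym_diff ?V ?V') = measure W (sym_diff V V')"
    proof -
      have "sym_diff ?V ?V' = act h -` (sym_diff V V') \<inter> space W" by auto
      then show ?thesis using measure_mp_maps[OF act_mp[OF h(1)], of "sym_diff V V'"] V V' by simp
    qed
    have "\<bar>measure W (U \<inter> ?V) - measure W (U \<inter> ?V')\<bar> \<le> measure W (sym_diff (U \<inter> ?V) (U \<inter> ?V'))"
      by (rule W.abs_measure_diff_le) (use U meas in auto)
    also have "\<dots> \<le> measure W (sym_diff ?V ?V')"
      by (rule W.finite_measure_mono) (use U meas in auto)
    finally have 2: "\<bar>measure W (U \<inter> ?V) - measure W (U \<inter> ?V')\<bar> \<le> \<epsilon> / 3" using sd V' by linarith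
    have "\<bar>measure W V' - measure W V\<bar> \<le> \<epsilon> / 3"
      using W.abs_measure_diff_le[OF V V'(3)] V'(5) by linarith
    then have "measure W U * \<bar>measure W V' - measure W V\<bar> \<le> 1 * (\<epsilon> / 3)"
      using \<epsilon> by (intro mult_mono) auto
    then have 3: "\<bar>measure W U * measure W V' - measure W U * measure W V\<bar> \<le> \<epsilon> / 3"
      by (simp add: abs_mult flip: right_diff_distrib)
    show ?thesis using 1[unfolded eq] 2 3 by linarith
  qed
  moreover have "finite ?F" using V' F by auto
  ultimately show ?thesis by (rule that[rotated])
qed

text \<open>Mixing of an invariant set against itself leaves p = p * p for its measure.
  \<open>Q\<close> is any set with infinitely many \<Gamma>-parts, such as the shifts that
  centralise an element or that leave one coordinate of \<open>Sm\<close> alone.\<close>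

lemma ergodic:
  assumes U: "U \<in> sets W" and Q: "Q \<subseteq> carrier H" "infinite (snd ` Q)"
    and inv: "\<And>h. h \<in> Q \<Longrightarrow> AE x in W. act h x \<in> U \<longleftrightarrow> x \<in> U"
  shows "measure W U = 0 \<or> measure W U = 1"
proof -
  have "\<bar>measure W U - measure W U * measure W U\<bar> \<le> \<epsilon>" if "\<epsilon> > 0" for \<epsilon>
  proof -
    obtain F where F: "finite F" "\<And>h. h \<in> carrier H \<Longrightarrow> snd h \<notin> F \<Longrightarrow>
        \<bar>measure W (U \<inter> (act h -` U \<inter> space W)) - measure W U * measure W U\<bar> \<le> \<epsilon>"
      by (rule mixing[OF U U \<open>\<epsilon> > 0\<close>]) (rule that; assumption)
    obtain h where h: "h \<in> Q" "snd h \<notin> F" using Q(2) F(1) by (meson finite_subset image_subsetI)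
    then have hH: "h \<in> carrier H" using Q by auto
    have "measure W (U \<inter> (act h -` U \<inter> space W)) = measure W U"
    proof (rule measure_eq_AE)
      show "AE x in W. x \<in> U \<inter> (act h -` U \<inter> space W) \<longleftrightarrow> x \<in> U"
        using inv[OF h(1)] AE_space by eventually_elim auto
    qed (use U vimage_act_sets hH in auto)
    then show ?thesis using F(2)[OF hH h(2)] by simp
  qed
  then have "\<bar>measure W U - measure W U * measure W U\<bar> \<le> 0"
    by (rule field_le_epsilon) simp
  then have "measure W U * (1 - measure W U) = 0" by (simp add: algebra_simps)
  then show ?thesis by auto
qed

text \<open>Up to half of \<epsilon> the set depends on F alone and does not notice a change at d.
  The error occurs at the point and at the changed point, with the same measure, and it does not
  depend on b.\<close>

lemma asymp_fixed:
  assumes V: "V \<in> sets W" and \<epsilon>: "\<epsilon> > 0"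
  obtains F where "finite F" "\<And>d b. d \<in> carrier G - F \<Longrightarrow> b \<in> carrier B \<Longrightarrow>
    measure W {x \<in> space W. act (bs b d) x \<in> V \<longleftrightarrow> x \<notin> V} \<le> \<epsilon>"
proof -
  obtain F V' where V': "finite F" "F \<subseteq> carrier G" "V' \<in> sets W" "depends_on F (space W) V'"
    "measure W (sym_diff V V') < \<epsilon> / 2"
    using approx_W[OF V, of "\<epsilon> / 2"] \<epsilon> by auto
  have "measure W {x \<in> space W. act (bs b d) x \<in> V \<longleftrightarrow> x \<notin> V} \<le> \<epsilon>"
    if d: "d \<in> carrier G - F" and b: "b \<in> carrier B" for d b
  proof -
    let ?D = "sym_diff V V'" and ?h = "bs b d"
    have D: "?D \<in> sets W" using V V' by auto
    have "act ?h x \<in> V' \<longleftrightarrow> x \<in> V'" if x: "x \<in> space W" for x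
    proof (rule depends_onD[OF V'(4)])
      fix i assume "i \<in> F"
      then have "i \<in> carrier G" "i \<noteq> d" using V' d by auto
      then show "act ?h x i = x i" using x b by (simp add: act_apply \<beta>_one W_mem)
    qed (use x b in auto)
    then have "{x \<in> space W. act ?h x \<in> V \<longleftrightarrow> x \<notin> V} \<subseteq> ?D \<union> (act ?h -` ?D \<inter> space W)" by blast
    then have "measure W {x \<in> space W. act ?h x \<in> V \<longleftrightarrow> x \<notin> V} \<le> measure W (?D \<union> (act ?h -` ?D \<inter> space W))"
      by (rule W.finite_measure_mono) (use D vimage_act_sets[OF bs_closed[OF b] D] in \<open>auto simp del: Un_iff\<close>)
    also have "\<dots> \<le> measure W ?D + measure W (act ?h -` ?D \<inter> space W)"
      by (rule measure_Un_le) (use D vimage_act_sets[OF bs_closed[OF b] D] in auto)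
    also have "measure W (act ?h -` ?D \<inter> space W) = measure W ?D"
      by (rule measure_mp_maps[OF act_mp D]) (use b in simp)
    finally show ?thesis using V'(5) by linarith
  qed
  then show ?thesis by (rule that[OF V'(1)])
qed

section \<open>Essential freeness and return elements\<close>

lemma infinite_ex:
  assumes "finite F"
  shows "\<exists>d\<in>carrier G. d \<notin> F"
  using infinite_G assms by (meson finite_subset subsetI)

text \<open>If h moves the coordinates, a fixed point repeats its coordinate d at
  \<open>\<sigma> \<otimes> d\<close> for every d off the support of h, contrary to the independence
  of distant coordinates. Otherwise one nontrivial coordinate and the freeness of the action of B
  suffice.\<close>

lemma AE_free:
  assumes h: "h \<in> carrier H" "h \<noteq> \<one>\<^bsub>H\<^esub>"
  shows "AE x in W. act h x \<noteq> x"
proof (cases "snd h = e")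
  case True
  then obtain d where d: "d \<in> carrier G" "fst h d \<noteq> \<one>\<^bsub>B\<^esub>"
    using H_eqI[OF h(1), of "\<one>\<^bsub>H\<^esub>"] h(2) by auto
  have "AE x in M. \<beta> (fst h d) x \<noteq> x" using free_\<beta> d h by (simp add: ess_free_def)
  from AE_coordinate[OF d(1) this] AE_space show ?thesis
  proof eventually_elim
    case (elim x)
    then have "act h x d \<noteq> x d" using act_apply[OF h(1) elim(2) d(1)] True d by simp
    then show ?case by metis
  qed
next
  case False
  define \<sigma> where "\<sigma> = inv (snd h)"
  have \<sigma>: "\<sigma> \<in> carrier G" "\<sigma> \<noteq> e" using h False by (auto simp: \<sigma>_def)
  let ?U = "{x \<in> space W. act h x = x}"
  have U: "?U \<in> sets W" by (rule measurable_eq_set) (use h in auto)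
  have "measure W ?U = 0"
  proof (rule ccontr)
    assume "measure W ?U \<noteq> 0"
    then have pos: "measure W ?U > 0" by (simp add: less_le)
    obtain b E where E: "E \<in> sets M" "0 < measure M E" "measure M E < 1" by (rule moving_set)
    obtain F where F: "finite F" "\<And>i j A. i \<in> carrier G - F \<Longrightarrow> j \<in> carrier G - F \<Longrightarrow> i \<noteq> j \<Longrightarrow>
        A \<in> sets M \<Longrightarrow> measure M A = measure M E \<Longrightarrow>
        measure W ?U * (measure M E * (1 - measure M E)) / 2 \<le> measure W (?U \<inter> {z \<in> space W. z i \<in> A \<and> z j \<notin> A})"
      by (rule coordinate_pair_bound[OF U pos E(2,3)]) (rule that; assumption)
    obtain d where d: "d \<in> carrier G" "d \<notin> F" "\<sigma> \<otimes> d \<notin> F" "d \<notin> supp (fst h)"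
      using infinite_ex[of "F \<union> {d\<in>carrier G. \<sigma> \<otimes> d \<in> F} \<union> supp (fst h)"]
        F(1) finite_translate[OF F(1) \<sigma>(1)] finite_supp[OF h(1)] by auto
    have "\<sigma> \<otimes> d \<noteq> d" using \<sigma> d by auto
    then have "measure W ?U * (measure M E * (1 - measure M E)) / 2
        \<le> measure W (?U \<inter> {z \<in> space W. z d \<in> E \<and> z (\<sigma> \<otimes> d) \<notin> E})"
      using F(2)[of d "\<sigma> \<otimes> d" E] d \<sigma> E by auto
    moreover have "0 < measure W ?U * (measure M E * (1 - measure M E)) / 2" using pos E by simp
    ultimately have "0 < measure W (?U \<inter> {z \<in> space W. z d \<in> E \<and> z (\<sigma> \<otimes> d) \<notin> E})"
      by (rule less_le_trans[rotated])
    moreover have eqz: "z d = z (\<sigma> \<otimes> d)" if "z \<in> ?U" for z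
    proof -
      have "fst h d = \<one>\<^bsub>B\<^esub>" using d by (auto simp: supp_def)
      moreover have "z \<in> space W" using that by simp
      ultimately have "act h z d = z (\<sigma> \<otimes> d)"
        using d h(1) \<sigma> by (simp add: act_apply \<beta>_one W_mem \<sigma>_def)
      then show ?thesis using that by auto
    qed
    have "\<not> (z d \<in> E \<and> z (\<sigma> \<otimes> d) \<notin> E)" if "z \<in> ?U" for z
      unfolding eqz[OF that] by simp
    then have "?U \<inter> {z \<in> space W. z d \<in> E \<and> z (\<sigma> \<otimes> d) \<notin> E} = {}" by blast
    ultimately show False by (simp only: measure_empty less_irrefl)
  qed
  then have "AE x in W. x \<notin> ?U" using U W.prob_eq_0 by blast
  then show ?thesis using AE_space by eventually_elim auto
qed

definition free_part :: "('g \<Rightarrow> 'x) set" where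
  "free_part = {x \<in> space W. \<forall>h\<in>carrier H. h \<noteq> \<one>\<^bsub>H\<^esub> \<longrightarrow> act h x \<noteq> x}"

lemma free_part_sets: "free_part \<in> sets W"
  unfolding free_part_def
  by (intro sets.sets_Collect_countable_All' countable_H sets.sets_Collect_imp sets.sets_Collect_neg
      sets.sets_Collect_const measurable_eq_set) (auto intro: act_measurable)

lemma AE_free_part: "AE x in W. x \<in> free_part"
proof -
  have "AE x in W. \<forall>h\<in>carrier H. h \<noteq> \<one>\<^bsub>H\<^esub> \<longrightarrow> act h x \<noteq> x"
    by (rule AE_ball_countable'[OF _ countable_H]) (use AE_free in auto)
  then show ?thesis using AE_space by eventually_elim (auto simp: free_part_def)
qed

lemma free_part_space: "x \<in> free_part \<Longrightarrow> x \<in> space W"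
  by (simp add: free_part_def)

lemma free_part_inj:
  assumes "x \<in> free_part" "h \<in> carrier H" "k \<in> carrier H" "act h x = act k x"
  shows "h = k"
proof -
  have x: "x \<in> space W" using assms free_part_space by auto
  have "act (inv\<^bsub>H\<^esub> k \<otimes>\<^bsub>H\<^esub> h) x = x" using assms x by (simp add: act_mult)
  then have "inv\<^bsub>H\<^esub> k \<otimes>\<^bsub>H\<^esub> h = \<one>\<^bsub>H\<^esub>" using assms by (auto simp: free_part_def)
  then show ?thesis using assms by (metis H.inv_closed H.inv_equality H.inv_inv)
qed

text \<open>The element that carries x to y, unique where x has trivial stabiliser. With the default
  value, membership in H and measurability hold everywhere, and only equations are restricted to
  almost every point.\<close>

definition ret :: "('g \<Rightarrow> 'x) \<Rightarrow> ('g \<Rightarrow> 'x) \<Rightarrow> ('g \<Rightarrow> 'b) \<times> 'g" where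
  "ret y x = (if x \<in> free_part \<and> (\<exists>h\<in>carrier H. y = act h x)
     then THE h. h \<in> carrier H \<and> y = act h x else \<one>\<^bsub>H\<^esub>)"

lemma ret_act: "x \<in> free_part \<Longrightarrow> h \<in> carrier H \<Longrightarrow> ret (act h x) x = h"
proof -
  assume x: "x \<in> free_part" and h: "h \<in> carrier H"
  have "(THE k. k \<in> carrier H \<and> act h x = act k x) = h"
  proof (rule the_equality)
    fix k assume "k \<in> carrier H \<and> act h x = act k x"
    then show "k = h" using free_part_inj[OF x, of k h] h by metis
  qed (use h in simp)
  then show "ret (act h x) x = h" using x h unfolding ret_def by auto
qed

lemma ret_closed[simp]: "ret y x \<in> carrier H"
proof (cases "x \<in> free_part \<and> (\<exists>h\<in>carrier H. y = act h x)")
  case True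
  then show ?thesis using ret_act by auto
qed (auto simp: ret_def)

lemma act_ret: "x \<in> free_part \<Longrightarrow> (x, y) \<in> R \<Longrightarrow> act (ret y x) x = y"
  using ret_act by (auto simp: R_iff)

lemma act_ret': "x \<in> free_part \<Longrightarrow> (y, x) \<in> R \<Longrightarrow> act (ret y x) x = y"
  using act_ret equiv_R by (meson equiv_def symE)

lemma ret_measurable:
  assumes p: "p \<in> measurable N W" and q: "q \<in> measurable N W"
  shows "(\<lambda>x. ret (p x) (q x)) \<in> measurable N (count_space (carrier H))"
  unfolding measurable_count_space_eq_countable[OF countable_H]
proof (intro conjI ballI)
  let ?S = "\<lambda>k. {x \<in> space N. q x \<in> free_part} \<inter> {x \<in> space N. p x = act k (q x)}"
  have S: "?S k \<in> sets N" if "k \<in> carrier H" for k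
  proof (intro sets.Int)
    note [measurable] = q free_part_sets
    show "{x \<in> space N. q x \<in> free_part} \<in> sets N" by measurable
    show "{x \<in> space N. p x = act k (q x)} \<in> sets N"
      by (rule measurable_eq_set[OF p]) (rule measurable_compose[OF q act_measurable[OF that]])
  qed
  fix h assume h: "h \<in> carrier H"
  \<comment> \<open>The points without a candidate, where the default applies; they join the fibre
    over the neutral element.\<close>
  let ?rest = "space N - (\<Union>k\<in>carrier H. ?S k)"
  have in_S: "ret (p x) (q x) = k" if "x \<in> ?S k" "k \<in> carrier H" for x k
    using that ret_act by auto
  have in_rest: "ret (p x) (q x) = \<one>\<^bsub>H\<^esub>" if "x \<in> ?rest" for x
    using that unfolding ret_def by auto
  have "(\<lambda>x. ret (p x) (q x)) -` {h} \<inter> space N = ?S h \<union> (if h = \<one>\<^bsub>H\<^esub> then ?rest else {})"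
    (is "?L = ?R")
  proof
    show "?L \<subseteq> ?R"
    proof
      fix x assume x: "x \<in> ?L"
      show "x \<in> ?R"
      proof (cases "x \<in> ?rest")
        case True
        then have "h = \<one>\<^bsub>H\<^esub>" using in_rest x by auto
        with True show ?thesis by simp
      next
        case False
        then obtain k where k: "k \<in> carrier H" "x \<in> ?S k" using x by blast
        then have "h = k" using in_S x by auto
        with k show ?thesis by blast
      qed
    qed
    show "?R \<subseteq> ?L" using in_S[OF _ h] in_rest by (auto split: if_splits)
  qed
  moreover have "(\<Union>k\<in>carrier H. ?S k) \<in> sets N"
    by (rule sets.countable_UN''[OF countable_H]) (rule S)
  ultimately show "(\<lambda>x. ret (p x) (q x)) -` {h} \<inter> space N \<in> sets N"
    using S[OF h] by auto
qed auto

end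

section \<open>Superrigidity and almost invariant subsets of the group\<close>

lemma (in prob_space) AE_positive_ex:
  assumes "S \<in> sets M" "measure M S > 0" "AE x in M. P x"
  shows "\<exists>x\<in>S. P x"
proof (rule ccontr)
  assume "\<not> (\<exists>x\<in>S. P x)"
  then have "AE x in M. x \<notin> S" using assms(3) by (auto elim!: AE_mp)
  then have "measure M S = 0" using assms(1) prob_eq_0 by blast
  then show False using assms(2) by simp
qed

text \<open>The factors over the intersection occur twice and cancel. The parity cocycle owes its
  cocycle identity to this.\<close>

lemma prod_sym_diff:
  fixes s :: "'a \<Rightarrow> 'b :: comm_ring_1"
  assumes "finite A" "finite B" "\<And>d. s d * s d = 1"
  shows "prod s (sym_diff A B) = prod s A * prod s B"
proof -
  have A: "prod s A = prod s (A \<inter> B) * prod s (A - B)"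
    by (rule prod.Int_Diff[OF assms(1)])
  have B: "prod s B = prod s (A \<inter> B) * prod s (B - A)"
    using prod.Int_Diff[OF assms(2), of s A] by (simp add: Int_commute)
  have "prod s (A \<inter> B) * prod s (A \<inter> B) = 1"
    by (simp add: assms(3) flip: prod.distrib)
  moreover have "prod s (sym_diff A B) = prod s (A - B) * prod s (B - A)"
    using assms by (intro prod.union_disjoint) auto
  ultimately show ?thesis unfolding A B
    by (metis (no_types, lifting) mult.assoc mult.left_commute mult.right_neutral)
qed

locale wreath_rigid = wreath_pmp +
  assumes no_finite_normal: "\<And>N. N \<lhd> G \<Longrightarrow> finite N \<Longrightarrow> N = {\<one>}"
    and superrigid: "Gctble_cocycle_superrigid G (bernoulli_space G M) (bernoulli_shift G M)"
begin

lemma shift_action: "group_action G (space W) (bernoulli_shift G M)"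
proof (rule group_actionI[OF group_G])
  show "bernoulli_shift G M g \<in> extensional (space W)" for g
    by (simp add: bernoulli_shift_def)
  show "bernoulli_shift G M e x = x" if "x \<in> space W" for x
    using that by (simp add: shift_eq_act sh_one)
qed (simp_all add: shift_eq_act sh_mult act_mult)

lemma superrigidE:
  fixes L :: "('l, 'k) monoid_scheme"
  assumes L: "group L" "countable (carrier L)"
    and meas: "\<And>g. g \<in> carrier G \<Longrightarrow> c g \<in> measurable W (count_space (carrier L))"
    and coc: "\<And>g0 g1. g0 \<in> carrier G \<Longrightarrow> g1 \<in> carrier G \<Longrightarrow>
      AE w in W. c (g1 \<otimes> g0) w = c g1 (act (sh g0) w) \<otimes>\<^bsub>L\<^esub> c g0 w"
  obtains \<rho> f where "\<rho> \<in> hom G L" "f \<in> measurable W (count_space (carrier L))"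
    "\<And>g. g \<in> carrier G \<Longrightarrow> AE w in W. c g w = f (act (sh g) w) \<otimes>\<^bsub>L\<^esub> \<rho> g \<otimes>\<^bsub>L\<^esub> inv\<^bsub>L\<^esub> f w"
proof -
  have "cocycle_superrigid G W (bernoulli_shift G M) L"
    by (rule Gctble_cocycle_superrigidD[OF superrigid shift_action _ L])
      (auto simp: shift_eq_act)
  moreover have "cocycle G W (bernoulli_shift G M) L (\<lambda>(g, w). c g w)"
    unfolding cocycle_def
  proof (intro conjI ballI)
    show "(\<lambda>(g, w). c g w) \<in> measurable (count_space (carrier G) \<Otimes>\<^sub>M W) (count_space (carrier L))"
      by (rule measurable_pair_measure_countable1[OF countable_G]) (use meas in simp)
  qed (use coc in \<open>simp add: shift_eq_act\<close>)
  ultimately show ?thesis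
    unfolding cocycle_superrigid_def using that by (auto simp: shift_eq_act)
qed

text \<open>Superrigidity with values in a group of order two forces every subset of the group which is
  almost invariant under translations to be finite or cofinite: the parity cocycle of the
  coordinates in the difference of the set and its translate is cohomologous to a homomorphism,
  and moving a single coordinate reveals whether this coordinate lies in the difference.\<close>

lemma one_ended:
  assumes A: "A \<subseteq> carrier G"
    and inv: "\<And>g. g \<in> carrier G \<Longrightarrow> finite (sym_diff A {d \<in> carrier G. g \<otimes> d \<in> A})"
  shows "finite A \<or> finite (carrier G - A)"
proof -
  obtain b E where b: "b \<in> carrier B" and E: "E \<in> sets M"
    and move: "0 < measure M {x \<in> space M. (\<beta> b x \<in> E) \<noteq> (x \<in> E)}"
    by (rule moving_set)
  note [measurable] = E
  \<comment> \<open>The group of order two sits multiplicatively in the reals, so that cocycle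
    values are ordinary products of signs.\<close>
  define L :: "real monoid" where "L = \<lparr>carrier = {1, -1}, monoid.mult = (*), one = 1\<rparr>"
  have L: "group L"
    by (rule groupI) (auto simp: L_def)
  interpret L: group L by (rule L)
  have invL: "inv\<^bsub>L\<^esub> y = y" if "y \<in> carrier L" for y
    by (rule L.inv_equality) (use that in \<open>auto simp: L_def\<close>)
  define s where "s = (\<lambda>y. if y \<in> E then -1 else 1 :: real)"
  have s2: "s y * s y = 1" for y by (simp add: s_def)
  define D where "D = (\<lambda>g. sym_diff A {d \<in> carrier G. g \<otimes> d \<in> A})"
  have D: "finite (D g)" "D g \<subseteq> carrier G" if "g \<in> carrier G" for g
    using inv[OF that] A by (auto simp: D_def)
  define c where "c = (\<lambda>g x. \<Prod>d\<in>D g. s (x d))"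
  have c_L: "c g x \<in> {1, -1}" for g x
  proof -
    have "c g x * c g x = 1" by (simp add: c_def s2 flip: prod.distrib)
    then have "\<bar>c g x\<bar> = 1" by (metis abs_mult_self_eq abs_1 abs_mult power2_eq_1_iff power2_eq_square abs_square_eq_1)
    then show ?thesis by auto
  qed
  have meas: "c g \<in> measurable W (count_space (carrier L))" if g: "g \<in> carrier G" for g
  proof -
    have [measurable]: "c g \<in> borel_measurable W"
      unfolding c_def s_def
    proof (rule borel_measurable_prod)
      fix d assume "d \<in> D g"
      then have [measurable]: "(\<lambda>x. x d) \<in> measurable W M" using D(2)[OF g] by auto
      show "(\<lambda>x. if x d \<in> E then - 1 else 1) \<in> borel_measurable W" by measurable
    qed
    show ?thesis
      by (subst measurable_count_space_eq2) (use c_L in \<open>auto simp: L_def\<close>)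
  qed
  have coc: "c (g1 \<otimes> g0) x = c g1 (act (sh g0) x) \<otimes>\<^bsub>L\<^esub> c g0 x"
    if g: "g0 \<in> carrier G" "g1 \<in> carrier G" and x: "x \<in> space W" for g0 g1 x
  proof -
    define T where "T = {d \<in> carrier G. g0 \<otimes> d \<in> D g1}"
    have T: "finite T" unfolding T_def using D(1)[OF g(2)] g(1) by (rule finite_translate)
    \<comment> \<open>Membership of \<open>g0 \<otimes> d\<close> in A is inserted between that of d
      and that of \<open>g1 \<otimes> g0 \<otimes> d\<close>.\<close>
    have "D (g1 \<otimes> g0) = sym_diff T (D g0)"
      using g A by (auto simp: D_def T_def G.m_assoc)
    then have "c (g1 \<otimes> g0) x = (\<Prod>d\<in>T. s (x d)) * c g0 x"
      unfolding c_def using prod_sym_diff[OF T D(1)[OF g(1)], of "\<lambda>d. s (x d)"] s2 by simp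
    also have "(\<Prod>d\<in>T. s (x d)) = c g1 (act (sh g0) x)"
      unfolding c_def
    proof (rule prod.reindex_bij_witness[where i = "\<lambda>d. inv g0 \<otimes> d" and j = "\<lambda>d. g0 \<otimes> d"])
    qed (use g D(2)[OF g(2)] x in \<open>auto simp: T_def act_apply \<beta>_one W_mem\<close>)
    finally show ?thesis by (simp add: L_def)
  qed
  obtain \<rho> f where \<rho>: "\<rho> \<in> hom G L" and f: "f \<in> measurable W (count_space (carrier L))"
    and cf: "\<And>g. g \<in> carrier G \<Longrightarrow> AE x in W. c g x = f (act (sh g) x) \<otimes>\<^bsub>L\<^esub> \<rho> g \<otimes>\<^bsub>L\<^esub> inv\<^bsub>L\<^esub> f x"
  proof (rule superrigidE[OF L _ meas])
    show "countable (carrier L)" by (simp add: L_def)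
    show "AE x in W. c (g1 \<otimes> g0) x = c g1 (act (sh g0) x) \<otimes>\<^bsub>L\<^esub> c g0 x"
      if "g0 \<in> carrier G" "g1 \<in> carrier G" for g0 g1
      using coc[OF that] by (rule AE_I2)
  qed (assumption, (rule that; assumption))
  have fL: "f x \<in> {1, -1}" if "x \<in> space W" for x
    using measurable_space[OF f that] by (simp add: L_def)
  have \<rho>L: "\<rho> g \<in> {1, -1}" if "g \<in> carrier G" for g
    using \<rho> that by (auto simp: hom_def L_def)
  let ?h = "bs b e"
  let ?Q = "{x \<in> space W. (\<beta> b (x e) \<in> E) \<noteq> (x e \<in> E)}"
  have f1: "f -` {1} \<inter> space W \<in> sets W"
    by (rule measurable_sets[OF f]) (simp add: L_def)
  define V where "V = f -` {1} \<inter> space W"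
  have V[measurable]: "V \<in> sets W" using f1 by (simp add: V_def)
  have [measurable]: "act ?h \<in> measurable W W" "\<beta> b \<in> measurable M M" "(\<lambda>x. x e) \<in> measurable W M"
    using b mp_mapsD(1)[OF \<beta>_mp[OF b]] by auto
  \<comment> \<open>At these points the change at e flips the sign s, and t tells whether f keeps
    its value. One of the two cases has positive measure, and t is fixed before any g is
    chosen.\<close>
  define Qt where "Qt = (\<lambda>t. {x \<in> space W. ((\<beta> b (x e) \<in> E) \<noteq> (x e \<in> E)) \<and> ((act ?h x \<in> V \<longleftrightarrow> x \<in> V) \<longleftrightarrow> t)})"
  have Qt: "Qt t \<in> sets W" for t unfolding Qt_def by measurable
  have "0 < measure W ?Q"
  proof -
    have "?Q = {z \<in> space W. z e \<in> {x \<in> space M. (\<beta> b x \<in> E) \<noteq> (x \<in> E)}}" using W_mem by auto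
    moreover have "{x \<in> space M. (\<beta> b x \<in> E) \<noteq> (x \<in> E)} \<in> sets M" by measurable
    ultimately show ?thesis using move by (simp only: measure_coordinate[OF G.one_closed])
  qed
  also have "measure W ?Q = measure W (Qt True \<union> Qt False)"
    by (rule arg_cong[where f = "measure W"]) (auto simp: Qt_def)
  also have "\<dots> \<le> measure W (Qt True) + measure W (Qt False)"
    by (rule measure_Un_le) (use Qt in auto)
  finally obtain t where t: "measure W (Qt t) > 0"
    by (metis add.right_neutral add_0 measure_nonneg less_le not_less)
  obtain F where F: "finite F" "\<And>d b. d \<in> carrier G - F \<Longrightarrow> b \<in> carrier B \<Longrightarrow>
      measure W {x \<in> space W. act (bs b d) x \<in> V \<longleftrightarrow> x \<notin> V} \<le> measure W (Qt t) / 2"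
    by (rule asymp_fixed[OF V half_gt_zero[OF t]]) (rule that; assumption)
  \<comment> \<open>After the shift by g the change sits at g, where f overlooks it outside an event
    of at most half the measure of \<open>Qt t\<close>. Multiplying the cohomology equations at x
    and at the changed point cancels \<open>\<rho> g\<close> and leaves the product of the two
    values of f, which t determines; the parities multiply to -1 exactly if e lies in
    \<open>D g\<close>.\<close>
  have key: "e \<in> D g \<longleftrightarrow> \<not> t" if g: "g \<in> carrier G - F" for g
  proof -
    have gG: "g \<in> carrier G" using g by simp
    let ?N = "{x \<in> space W. act (bs b g) x \<in> V \<longleftrightarrow> x \<notin> V}"
    have [measurable]: "act (bs b g) \<in> measurable W W" "act (sh g) \<in> measurable W W" using b gG by auto
    have N: "?N \<in> sets W" by measurable
    let ?N' = "act (sh g) -` ?N \<inter> space W"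
    have N': "?N' \<in> sets W" by (rule vimage_act_sets[OF sh_closed[OF gG] N])
    have "measure W ?N' \<le> measure W (Qt t) / 2"
      using measure_mp_maps[OF act_mp[OF sh_closed[OF gG]] N] F(2)[OF g b] by simp
    moreover have "measure W (Qt t) \<le> measure W (Qt t - ?N') + measure W ?N'"
    proof -
      have "measure W (Qt t) \<le> measure W ((Qt t - ?N') \<union> ?N')"
        by (rule W.finite_measure_mono) (use Qt N' in auto)
      also have "\<dots> \<le> measure W (Qt t - ?N') + measure W ?N'"
        by (rule measure_Un_le) (use Qt N' in auto)
      finally show ?thesis .
    qed
    ultimately have pos: "measure W (Qt t - ?N') > 0" using t by linarith
    have "AE x in W. c g x = f (act (sh g) x) \<otimes>\<^bsub>L\<^esub> \<rho> g \<otimes>\<^bsub>L\<^esub> inv\<^bsub>L\<^esub> f x \<and>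
        c g (act ?h x) = f (act (sh g) (act ?h x)) \<otimes>\<^bsub>L\<^esub> \<rho> g \<otimes>\<^bsub>L\<^esub> inv\<^bsub>L\<^esub> f (act ?h x)"
      using cf[OF gG] AE_mp_maps[OF act_mp[OF bs_closed[OF b]] cf[OF gG]] by eventually_elim simp
    from W.AE_positive_ex[OF _ pos this] obtain x where x: "x \<in> Qt t" "x \<notin> ?N'"
      and c1: "c g x = f (act (sh g) x) \<otimes>\<^bsub>L\<^esub> \<rho> g \<otimes>\<^bsub>L\<^esub> inv\<^bsub>L\<^esub> f x"
      and c2: "c g (act ?h x) = f (act (sh g) (act ?h x)) \<otimes>\<^bsub>L\<^esub> \<rho> g \<otimes>\<^bsub>L\<^esub> inv\<^bsub>L\<^esub> f (act ?h x)"
      using Qt N' by auto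
    have xW: "x \<in> space W" using x by (simp add: Qt_def)
    let ?y = "act ?h x" and ?z = "act (sh g) x"
    have yW: "?y \<in> space W" and zW: "?z \<in> space W" using xW b gG by auto
    have eq: "act (sh g) ?y = act (bs b g) ?z"
      using sh_bs[OF gG G.one_closed b] gG b xW by (simp flip: act_mult)
    have inv_f: "inv\<^bsub>L\<^esub> f w = f w" if "w \<in> space W" for w
      by (rule invL) (use measurable_space[OF f that] in simp)
    have mL: "u \<otimes>\<^bsub>L\<^esub> v = u * v" for u v by (simp add: L_def)
    have c1': "c g x = f ?z * \<rho> g * f x" and c2': "c g ?y = f (act (sh g) ?y) * \<rho> g * f ?y"
      using c1 c2 by (simp_all only: mL inv_f[OF xW] inv_f[OF yW])
    have "f (act (bs b g) ?z) = f ?z"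
    proof -
      have "act (bs b g) ?z \<in> V \<longleftrightarrow> ?z \<in> V" using x(2) xW zW by auto
      then show ?thesis using fL[OF zW] fL[of "act (bs b g) ?z"] zW b by (auto simp: V_def)
    qed
    moreover have "f x * f ?y = (if t then 1 else -1)"
    proof -
      have "(?y \<in> V \<longleftrightarrow> x \<in> V) \<longleftrightarrow> t" using x(1) by (auto simp: Qt_def)
      then show ?thesis using fL[OF xW] fL[OF yW] xW yW by (auto simp: V_def)
    qed
    ultimately have "c g x * c g ?y = (if t then 1 else -1)"
      using c1' c2' fL[OF zW] \<rho>L[OF gG] by (auto simp: eq)
    moreover have "c g x * c g ?y = (\<Prod>d\<in>D g. s (x d) * s (?y d))"
      by (simp add: c_def prod.distrib)
    moreover have "s (x d) * s (?y d) = (if d = e then -1 else 1)" if "d \<in> D g" for d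
    proof -
      have "d \<in> carrier G" using D(2)[OF gG] that by auto
      then show ?thesis
        using x(1) xW b by (auto simp: act_apply \<beta>_one W_mem s2 Qt_def) (auto simp: s_def)
    qed
    ultimately have "(\<Prod>d\<in>D g. if d = e then -1 else 1 :: real) = (if t then 1 else -1)"
      by simp
    moreover have "(\<Prod>d\<in>D g. if d = e then -1 else 1 :: real) = (if e \<in> D g then -1 else 1)"
      by (rule prod.delta[OF D(1)[OF gG]])
    ultimately have "(if e \<in> D g then -1 else 1 :: real) = (if t then 1 else -1)"
      by (metis (no_types))
    then show ?thesis by (cases t; cases "e \<in> D g") simp_all
  qed
  \<comment> \<open>Since \<open>D g\<close> compares e with g at the coordinate e, a constant
    answer outside F means that A contains all or none of the elements there.\<close>
  have "e \<in> D g \<longleftrightarrow> (e \<in> A) \<noteq> (g \<in> A)" if "g \<in> carrier G" for g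
    using that by (auto simp: D_def)
  then have *: "g \<in> A \<longleftrightarrow> (e \<in> A \<longleftrightarrow> t)" if "g \<in> carrier G" "g \<notin> F" for g
    using key[of g] that by blast
  have "A \<subseteq> F \<or> carrier G - A \<subseteq> F"
  proof (cases "e \<in> A \<longleftrightarrow> t")
    case True
    then have "carrier G - A \<subseteq> F" using * by blast
    then show ?thesis ..
  next
    case False
    then have "A \<subseteq> F" using * A by blast
    then show ?thesis ..
  qed
  then show ?thesis using F(1) finite_subset by blast
qed

text \<open>Every preimage under u is almost invariant, hence finite or cofinite. If no fibre were
  cofinite, all fibres would be finite and the range infinite, and two disjoint infinite parts of
  the range would have disjoint infinite preimages.\<close>

lemma almost_constant:
  assumes "\<And>g. g \<in> carrier G \<Longrightarrow> finite {d \<in> carrier G. u (g \<otimes> d) \<noteq> u d}"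
  shows "\<exists>k. finite {d \<in> carrier G. u d \<noteq> k}"
proof (rule ccontr)
  assume no: "\<not> (\<exists>k. finite {d \<in> carrier G. u d \<noteq> k})"
  have fc: "finite {d \<in> carrier G. u d \<in> V} \<or> finite {d \<in> carrier G. u d \<notin> V}" for V
  proof -
    have "finite {d \<in> carrier G. u d \<in> V} \<or> finite (carrier G - {d \<in> carrier G. u d \<in> V})"
    proof (rule one_ended)
      fix g assume g: "g \<in> carrier G"
      show "finite (sym_diff {d \<in> carrier G. u d \<in> V} {d \<in> carrier G. g \<otimes> d \<in> {d \<in> carrier G. u d \<in> V}})"
        by (rule finite_subset[OF _ assms[OF g]]) (use g in auto)
    qed auto
    moreover have "carrier G - {d \<in> carrier G. u d \<in> V} = {d \<in> carrier G. u d \<notin> V}" by auto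
    ultimately show ?thesis by simp
  qed
  have fin: "finite {d \<in> carrier G. u d = k}" for k
    using fc[of "{k}"] no by auto
  have "infinite (u ` carrier G)"
  proof
    assume "finite (u ` carrier G)"
    then have "finite (\<Union>k\<in>u ` carrier G. {d \<in> carrier G. u d = k})"
      using fin by (intro finite_UN_I)
    moreover have "(\<Union>k\<in>u ` carrier G. {d \<in> carrier G. u d = k}) = carrier G" by auto
    ultimately show False using infinite_G by simp
  qed
  then obtain C where C: "pairwise (\<lambda>i j. disjnt (C i) (C j)) UNIV" "(\<Union>i :: nat. C i) \<subseteq> u ` carrier G"
    "\<And>i. infinite (C i)"
    by (rule infinite_infinite_partition) (rule that; assumption)
  have *: "infinite {d \<in> carrier G. u d \<in> V}" if "infinite V" "V \<subseteq> u ` carrier G" for V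
  proof
    assume "finite {d \<in> carrier G. u d \<in> V}"
    then have "finite (u ` {d \<in> carrier G. u d \<in> V})" by simp
    moreover have "V \<subseteq> u ` {d \<in> carrier G. u d \<in> V}" using that by auto
    ultimately show False using that finite_subset by blast
  qed
  have "C i \<subseteq> u ` carrier G" for i using C(2) by blast
  then have "infinite {d \<in> carrier G. u d \<in> C 0}" "infinite {d \<in> carrier G. u d \<in> C 1}"
    using *[OF C(3)] by blast+
  moreover have "{d \<in> carrier G. u d \<in> C 1} \<subseteq> {d \<in> carrier G. u d \<notin> C 0}"
    using C(1) by (auto simp: pairwise_def disjnt_iff)
  ultimately show False using fc[of "C 0"] finite_subset by blast
qed

end

section \<open>The equivalence relation of the direct sum and the centre\<close>

context wreath_pmp
begin

abbreviation "S \<equiv> sum_eqrel G M (orbit_eqrel B M \<beta>)"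

lemma S_iff: "(x, y) \<in> S \<longleftrightarrow> x \<in> space W \<and> (\<exists>h\<in>carrier H. snd h = e \<and> y = act h x)"
proof
  assume xy: "(x, y) \<in> S"
  then have x: "x \<in> space W" and y: "y \<in> space W"
    and orb: "\<And>d. d \<in> carrier G \<Longrightarrow> (x d, y d) \<in> orbit_eqrel B M \<beta>"
    and fin: "finite {d \<in> carrier G. x d \<noteq> y d}"
    by (auto simp: sum_eqrel_def)
  \<comment> \<open>The neutral element is taken wherever the two points agree, so that the chosen
    family has finite support.\<close>
  have "\<exists>b. d \<in> carrier G \<longrightarrow> b \<in> carrier B \<and> y d = \<beta> b (x d) \<and> (x d = y d \<longrightarrow> b = \<one>\<^bsub>B\<^esub>)" for d
  proof (cases "d \<in> carrier G \<and> x d \<noteq> y d")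
    case True
    then show ?thesis using orb[of d] by (auto simp: orbit_eqrel_def orbit_def)
  next
    case False
    then show ?thesis using x W_mem[OF x, of d] \<beta>_one by (intro exI[of _ "\<one>\<^bsub>B\<^esub>"]) auto
  qed
  then obtain a where a: "\<And>d. d \<in> carrier G \<Longrightarrow> a d \<in> carrier B"
    "\<And>d. d \<in> carrier G \<Longrightarrow> y d = \<beta> (a d) (x d)"
    "\<And>d. d \<in> carrier G \<Longrightarrow> x d = y d \<Longrightarrow> a d = \<one>\<^bsub>B\<^esub>"
    by metis
  let ?h = "(restrict a (carrier G), e)"
  have "supp (restrict a (carrier G)) \<subseteq> {d \<in> carrier G. x d \<noteq> y d}"
    using a(3) by (auto simp: supp_def)
  then have "finite (supp (restrict a (carrier G)))" using fin by (rule finite_subset)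
  then have h: "?h \<in> carrier H" using a(1) by (auto simp: carrier_H)
  moreover have "y = act ?h x"
    by (rule W_ext[OF y act_closed[OF h x]]) (simp add: act_apply[OF h x] a)
  ultimately show "x \<in> space W \<and> (\<exists>h\<in>carrier H. snd h = e \<and> y = act h x)"
    using x by (auto intro!: bexI[of _ ?h])
next
  assume "x \<in> space W \<and> (\<exists>h\<in>carrier H. snd h = e \<and> y = act h x)"
  then obtain h where h: "h \<in> carrier H" "snd h = e" "y = act h x" and x: "x \<in> space W" by auto
  have yd: "y d = \<beta> (fst h d) (x d)" if "d \<in> carrier G" for d
    using that h x by (simp add: act_apply)
  have "finite {d \<in> carrier G. x d \<noteq> y d}"
    by (rule finite_subset[OF _ finite_supp[OF h(1)]]) (use yd \<beta>_one W_mem[OF x] in \<open>auto simp: supp_def\<close>)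
  then show "(x, y) \<in> S"
    using h x yd W_mem[OF x] act_closed[OF h(1) x]
    by (auto simp: sum_eqrel_def orbit_eqrel_def orbit_def)
qed

text \<open>The direct sum is normal in the wreath product.\<close>

lemma S_act_iff:
  assumes k: "k \<in> carrier H" and x: "x \<in> space W" and y: "y \<in> space W"
  shows "(x, y) \<in> S \<longleftrightarrow> (act k x, act k y) \<in> S"
proof -
  have *: "(act k x, act k y) \<in> S" if k: "k \<in> carrier H" and S: "(x, y) \<in> S" for k x y
  proof -
    obtain h where h: "h \<in> carrier H" "snd h = e" "y = act h x" and x: "x \<in> space W"
      using S by (auto simp: S_iff)
    have "act k y = act (k \<otimes>\<^bsub>H\<^esub> h \<otimes>\<^bsub>H\<^esub> inv\<^bsub>H\<^esub> k) (act k x)"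
      using h k x by (simp add: act_mult)
    then show ?thesis using h k x
      by (auto simp: S_iff intro!: bexI[of _ "k \<otimes>\<^bsub>H\<^esub> h \<otimes>\<^bsub>H\<^esub> inv\<^bsub>H\<^esub> k"])
  qed
  show ?thesis using *[OF k] *[of "inv\<^bsub>H\<^esub> k" "act k x" "act k y"] k x y by auto
qed

text \<open>Every element is a member of the direct sum times a shift. A map that respects S and
  permutes the shifts therefore respects R.\<close>

lemma R_iff_S: "(x, y) \<in> R \<longleftrightarrow> x \<in> space W \<and> (\<exists>g\<in>carrier G. (act (sh g) x, y) \<in> S)"
proof
  assume "(x, y) \<in> R"
  then obtain h where h: "h \<in> carrier H" "y = act h x" and x: "x \<in> space W" by (auto simp: R_iff)
  let ?k = "h \<otimes>\<^bsub>H\<^esub> inv\<^bsub>H\<^esub> (sh (snd h))"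
  have "y = act ?k (act (sh (snd h)) x)" using h x by (simp add: act_mult)
  then show "x \<in> space W \<and> (\<exists>g\<in>carrier G. (act (sh g) x, y) \<in> S)"
    using h x by (auto simp: S_iff intro!: bexI[of _ "snd h"] bexI[of _ ?k])
next
  assume "x \<in> space W \<and> (\<exists>g\<in>carrier G. (act (sh g) x, y) \<in> S)"
  then obtain g k where "g \<in> carrier G" "k \<in> carrier H" "y = act k (act (sh g) x)" "x \<in> space W"
    by (auto simp: S_iff)
  then show "(x, y) \<in> R" by (auto simp: R_iff act_mult intro!: bexI[of _ "k \<otimes>\<^bsub>H\<^esub> sh g"])
qed

text \<open>Commuting with all shifts makes the family constant, and a nontrivial constant family
  over an infinite group has infinite support.\<close>

lemma const_fst_trivial:
  assumes s: "s \<in> carrier H" and inv: "\<And>g. g \<in> carrier G \<Longrightarrow> sh g \<otimes>\<^bsub>H\<^esub> s = s \<otimes>\<^bsub>H\<^esub> sh g"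
  shows "s = sh (snd s)" "snd s \<in> group_center G"
proof -
  have shift: "fst s (inv g \<otimes> d) = fst s d" if "g \<in> carrier G" "d \<in> carrier G" for g d
  proof -
    have "fst (sh g \<otimes>\<^bsub>H\<^esub> s) d = fst (s \<otimes>\<^bsub>H\<^esub> sh g) d" using inv that by simp
    then show ?thesis using that s by (simp add: fst_mult_H)
  qed
  have const: "fst s d = fst s c" if "c \<in> carrier G" "d \<in> carrier G" for c d
    using shift[of "d \<otimes> inv c" d] that by (simp add: G.inv_mult_group G.m_assoc)
  have "fst s d = \<one>\<^bsub>B\<^esub>" if d: "d \<in> carrier G" for d
  proof (rule ccontr)
    assume nt: "fst s d \<noteq> \<one>\<^bsub>B\<^esub>"
    have "fst s c \<noteq> \<one>\<^bsub>B\<^esub>" if "c \<in> carrier G" for c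
      using const[OF that d] nt by simp
    then have "supp (fst s) = carrier G" by (auto simp: supp_def)
    then show False using finite_supp[OF s] infinite_G by simp
  qed
  then show "s = sh (snd s)" using s by (intro H_eqI) auto
  have "snd (sh g \<otimes>\<^bsub>H\<^esub> s) = snd (s \<otimes>\<^bsub>H\<^esub> sh g)" if "g \<in> carrier G" for g
    using inv that by simp
  then show "snd s \<in> group_center G" using s by (auto simp: group_center_def)
qed

text \<open>Shifting x by g conjugates the return element of \<open>T\<close> by g, so the fibres
  over conjugate values have equal measure and a value of positive measure has finitely many
  conjugates. Infinitely many shifts then centralise it; by ergodicity its fibre is conull, and the
  value commutes with all shifts.\<close>

lemma equivariant_full_group:
  assumes T: "T \<in> mp_maps W" and R: "AE x in W. (T x, x) \<in> R"
    and eqv: "\<And>g. g \<in> carrier G \<Longrightarrow> AE x in W. T (act (sh g) x) = act (sh g) (T x)"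
  shows "\<exists>z\<in>group_center G. AE x in W. T x = act (sh z) x"
proof -
  define r where "r = (\<lambda>x. ret (T x) x)"
  have r: "r \<in> measurable W (count_space (carrier H))"
    unfolding r_def by (rule ret_measurable) (use mp_mapsD(1)[OF T] in auto)
  have rs: "r -` {s} \<inter> space W \<in> sets W" if "s \<in> carrier H" for s
    by (rule measurable_sets[OF r]) (use that in simp)
  have act_r: "AE x in W. x \<in> free_part \<and> act (r x) x = T x"
    using AE_free_part R by eventually_elim (simp add: r_def act_ret')
  have r_conj: "AE x in W. r (act (sh g) x) = sh g \<otimes>\<^bsub>H\<^esub> r x \<otimes>\<^bsub>H\<^esub> inv\<^bsub>H\<^esub> (sh g)" if g: "g \<in> carrier G" for g
    using AE_mp_maps[OF act_mp[OF sh_closed[OF g]] act_r] act_r eqv[OF g]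
  proof eventually_elim
    case (elim x)
    let ?k = "sh g \<otimes>\<^bsub>H\<^esub> r x \<otimes>\<^bsub>H\<^esub> inv\<^bsub>H\<^esub> (sh g)"
    have rH: "r x \<in> carrier H" by (simp add: r_def)
    have x: "x \<in> space W" using elim free_part_space by auto
    have "act ?k (act (sh g) x) = act (r (act (sh g) x)) (act (sh g) x)"
      using elim x g rH by (simp add: act_mult)
    then show ?case using elim g rH
      by (intro free_part_inj[of "act (sh g) x"]) (auto simp: r_def)
  qed
  define m where "m = (\<lambda>s. measure W (r -` {s} \<inter> space W))"
  have "\<exists>s\<in>carrier H. m s > 0"
  proof (rule ccontr)
    assume "\<not> (\<exists>s\<in>carrier H. m s > 0)"
    then have "\<forall>s\<in>carrier H. m s = 0" unfolding m_def by (metis measure_nonneg less_le)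
    then have "\<forall>s\<in>carrier H. AE x in W. r x \<noteq> s"
      using rs W.prob_eq_0 unfolding m_def
      by (auto intro: AE_mp[OF _ AE_I2])
    then have "AE x in W. \<forall>s\<in>carrier H. r x \<noteq> s" by (simp add: AE_ball_countable countable_H)
    then have "AE x in W. False" by eventually_elim (auto simp: r_def)
    then show False using W.AE_False by simp
  qed
  then obtain s where s: "s \<in> carrier H" "m s > 0" by blast
  define cj where "cj = (\<lambda>g. sh g \<otimes>\<^bsub>H\<^esub> s \<otimes>\<^bsub>H\<^esub> inv\<^bsub>H\<^esub> (sh g))"
  have cjH: "cj g \<in> carrier H" if "g \<in> carrier G" for g using that s by (simp add: cj_def)
  have cj_inj: "k = s" if "sh g \<otimes>\<^bsub>H\<^esub> k \<otimes>\<^bsub>H\<^esub> inv\<^bsub>H\<^esub> (sh g) = cj g" "g \<in> carrier G" "k \<in> carrier H" for g k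
    using that s by (simp add: cj_def)
  have m_cj: "m (cj g) = m s" if g: "g \<in> carrier G" for g
  proof -
    have "m (cj g) = measure W (act (sh g) -` (r -` {cj g} \<inter> space W) \<inter> space W)"
      unfolding m_def using measure_mp_maps[OF act_mp[OF sh_closed[OF g]] rs[OF cjH[OF g]]] by simp
    also have "\<dots> = m s"
      unfolding m_def
    proof (rule measure_eq_AE)
      show "AE x in W. x \<in> act (sh g) -` (r -` {cj g} \<inter> space W) \<inter> space W \<longleftrightarrow> x \<in> r -` {s} \<inter> space W"
        using r_conj[OF g] AE_space
      proof eventually_elim
        case (elim x)
        have "r x \<in> carrier H" by (simp add: r_def)
        then have "r (act (sh g) x) = cj g \<longleftrightarrow> r x = s"
          using elim cj_inj[of g "r x"] g by (auto simp: cj_def)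
        then show ?case using elim g by auto
      qed
    qed (rule vimage_act_sets[OF sh_closed[OF g] rs[OF cjH[OF g]]], rule rs[OF s(1)])
    finally show ?thesis .
  qed
  have "finite (cj ` carrier G)"
  proof (rule ccontr)
    assume "infinite (cj ` carrier G)"
    \<comment> \<open>More than \<open>1 / m s\<close> disjoint fibres of measure \<open>m s\<close>
      do not fit into a probability space.\<close>
    then obtain C where C: "C \<subseteq> cj ` carrier G" "finite C" "card C = Suc (nat \<lceil>1 / m s\<rceil>)"
      using infinite_arbitrarily_large by blast
    have "C \<subseteq> carrier H" using C(1) cjH by auto
    then have "(\<lambda>k. r -` {k} \<inter> space W) ` C \<subseteq> sets W" using rs by blast
    then have "measure W (\<Union>k\<in>C. r -` {k} \<inter> space W) = (\<Sum>k\<in>C. m k)"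
      unfolding m_def
      by (intro W.finite_measure_finite_Union C(2)) (auto simp: disjoint_family_on_def)
    also have "\<dots> = (\<Sum>k\<in>C. m s)" by (rule sum.cong) (use C m_cj in auto)
    also have "\<dots> = (1 + real (nat \<lceil>1 / m s\<rceil>)) * m s" using C by simp
    also have "\<dots> > 1 / m s * m s" using s(2) by (intro mult_strict_right_mono) linarith+
    also have "1 / m s * m s = 1" using s(2) by simp
    finally show False using W.prob_le_1 by (simp add: not_le[symmetric])
  qed
  then obtain g0 where g0: "g0 \<in> carrier G" "infinite {g \<in> carrier G. cj g = cj g0}"
    using pigeonhole_infinite[OF infinite_G] by blast
  \<comment> \<open>Quotients of elements that conjugate s to the same value centralise s.\<close>
  let ?Q = "(\<lambda>g. sh (inv g0 \<otimes> g)) ` {g \<in> carrier G. cj g = cj g0}"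
  have "m s = 0 \<or> m s = 1"
    unfolding m_def
  proof (rule ergodic[where Q = ?Q])
    show "?Q \<subseteq> carrier H" using g0 by auto
    have "snd ` ?Q = (\<lambda>g. inv g0 \<otimes> g) ` {g \<in> carrier G. cj g = cj g0}"
      by (simp add: image_image)
    moreover have "inj_on (\<lambda>g. inv g0 \<otimes> g) {g \<in> carrier G. cj g = cj g0}"
      using g0 by (auto simp: inj_on_def)
    ultimately show "infinite (snd ` ?Q)" using g0(2) by (simp add: finite_image_iff)
    fix h assume "h \<in> ?Q"
    then obtain g where g: "g \<in> carrier G" "cj g = cj g0" "h = sh (inv g0 \<otimes> g)" by auto
    let ?g = "inv g0 \<otimes> g"
    have gG: "?g \<in> carrier G" using g g0 by simp
    have "sh ?g \<otimes>\<^bsub>H\<^esub> s \<otimes>\<^bsub>H\<^esub> inv\<^bsub>H\<^esub> (sh ?g) = inv\<^bsub>H\<^esub> (sh g0) \<otimes>\<^bsub>H\<^esub> cj g \<otimes>\<^bsub>H\<^esub> sh g0"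
      using g(1) g0(1) s(1) by (simp add: cj_def sh_mult sh_inv H.m_assoc H.inv_mult_group)
    also have "\<dots> = inv\<^bsub>H\<^esub> (sh g0) \<otimes>\<^bsub>H\<^esub> cj g0 \<otimes>\<^bsub>H\<^esub> sh g0" using g by simp
    also have "\<dots> = s"
      using g0 s by (simp add: cj_def H.m_assoc) (simp add: H.l_inv flip: H.m_assoc)
    finally have com: "cj ?g = s" by (simp add: cj_def)
    show "AE x in W. act h x \<in> r -` {s} \<inter> space W \<longleftrightarrow> x \<in> r -` {s} \<inter> space W"
      using r_conj[OF gG] AE_space
    proof eventually_elim
      case (elim x)
      have rH: "r x \<in> carrier H" by (simp add: r_def)
      have "r (act (sh ?g) x) = s \<longleftrightarrow> r x = s"
        using elim(1) cj_inj[of ?g "r x"] gG com rH unfolding cj_def by metis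
      then show ?case using elim g gG by simp
    qed
  qed (use rs s in auto)
  then have "measure W (r -` {s} \<inter> space W) = 1" using s(2) by (simp add: m_def)
  then have AEs: "AE x in W. r x = s"
    using W.prob_eq_1[OF rs[OF s(1)]] by (auto elim!: AE_mp intro!: AE_I2)
  have "sh g \<otimes>\<^bsub>H\<^esub> s = s \<otimes>\<^bsub>H\<^esub> sh g" if g: "g \<in> carrier G" for g
  proof -
    have "AE x in W. s = sh g \<otimes>\<^bsub>H\<^esub> s \<otimes>\<^bsub>H\<^esub> inv\<^bsub>H\<^esub> (sh g)"
      using AEs AE_mp_maps[OF act_mp[OF sh_closed[OF g]] AEs] r_conj[OF g] by eventually_elim simp
    then have "s = sh g \<otimes>\<^bsub>H\<^esub> s \<otimes>\<^bsub>H\<^esub> inv\<^bsub>H\<^esub> (sh g)"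
      using W.AE_const by blast
    then have "s \<otimes>\<^bsub>H\<^esub> sh g = sh g \<otimes>\<^bsub>H\<^esub> s \<otimes>\<^bsub>H\<^esub> inv\<^bsub>H\<^esub> (sh g) \<otimes>\<^bsub>H\<^esub> sh g" by simp
    then show ?thesis using g s by (simp add: H.m_assoc)
  qed
  note c = const_fst_trivial[OF s(1) this]
  have "AE x in W. T x = act (sh (snd s)) x"
    using AEs act_r by eventually_elim (use c(1) in simp)
  then show ?thesis using c(2) by blast
qed

lemma act_mp_autos: "h \<in> carrier H \<Longrightarrow> act h \<in> mp_autos W"
  using act_ae_inverse mp_autos_iff by blast

lemma equivariant_Int_full_group:
  "Aut_rel_equivariant G W (bernoulli_shift G M) S \<inter> full_group W R =
    (\<lambda>z. ae_class W (bernoulli_shift G M z)) ` group_center G" (is "?D \<inter> _ = ?Z")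
proof (intro equalityI subsetI)
  fix A assume A: "A \<in> ?D \<inter> full_group W R"
  then obtain T where T: "T \<in> mp_autos W" "A = ae_class W T"
    "\<And>g. g\<in>carrier G \<Longrightarrow> AE x in W. T (act (sh g) x) = act (sh g) (T x)"
    by (auto simp: Aut_rel_equivariant_eq shift_eq_act)
  have "AE x in W. (T x, x) \<in> R" using A T full_group_iff by blast
  from equivariant_full_group[OF mp_autos_maps[OF T(1)] this T(3)] obtain z
    where z: "z \<in> group_center G" "AE x in W. T x = act (sh z) x" by blast
  have zG: "z \<in> carrier G" using z by (simp add: group_center_def)
  have "A = ae_class W (bernoulli_shift G M z)"
    unfolding T(2) shift_eq_act[OF zG] using z zG T(1) by (subst ae_class_eq_iff) (auto intro: act_mp_autos)
  then show "A \<in> ?Z" using z by auto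
next
  fix A assume "A \<in> ?Z"
  then obtain z where z: "z \<in> group_center G" "A = ae_class W (bernoulli_shift G M z)" by auto
  have zG: "z \<in> carrier G" using z by (simp add: group_center_def)
  have A: "A = ae_class W (act (sh z))" using z shift_eq_act[OF zG] by simp
  have auto: "act (sh z) \<in> mp_autos W" using zG act_mp_autos by simp
  have pres: "ae_preserves W S (act (sh z))"
    by (rule ae_preservesI[where P = "\<lambda>_. True"]) (use S_act_iff zG in auto)
  have com: "act (sh z) (act (sh g) x) = act (sh g) (act (sh z) x)" if "g \<in> carrier G" "x \<in> space W" for g x
  proof -
    have "z \<otimes> g = g \<otimes> z" using z that by (simp add: group_center_def)
    then show ?thesis using that zG by (metis act_mult sh_closed sh_mult)
  qed
  have "A \<in> ?D"
    unfolding A Aut_rel_equivariant_eq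
    by (rule imageI) (use auto pres com in \<open>auto simp: shift_eq_act intro!: AE_I2\<close>)
  moreover have "A \<in> full_group W R"
    unfolding A full_group_iff[OF auto]
    by (rule AE_I2) (use zG equiv_R in \<open>auto simp: R_iff intro!: bexI[of _ "inv\<^bsub>H\<^esub> (sh z)"]\<close>)
  ultimately show "A \<in> ?D \<inter> full_group W R" by simp
qed

end

section \<open>Automorphisms of the orbit relation\<close>

text \<open>The last assumption is the cohomology equation for the cocycle of \<open>T\<close> with
  the cocycle eliminated: the map \<open>Sm\<close> defined below intertwines the shift with
  \<rho>.\<close>

locale straightened = wreath_rigid G B M \<beta>
  for G :: "('g, 'm) monoid_scheme" (structure) and B :: "('b, 'n) monoid_scheme"
    and M :: "'x measure" and \<beta> :: "'b \<Rightarrow> 'x \<Rightarrow> 'x" +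
  fixes T T' :: "('g \<Rightarrow> 'x) \<Rightarrow> 'g \<Rightarrow> 'x" and f :: "('g \<Rightarrow> 'x) \<Rightarrow> ('g \<Rightarrow> 'b) \<times> 'g"
    and \<rho> :: "'g \<Rightarrow> ('g \<Rightarrow> 'b) \<times> 'g"
  assumes TT': "ae_inverse (bernoulli_space G M) T T'"
    and T_R: "ae_preserves (bernoulli_space G M) (wreath_eqrel B G M \<beta>) T"
    and f_meas: "f \<in> measurable (bernoulli_space G M) (count_space (carrier (wreath B G)))"
    and \<rho>_hom: "\<rho> \<in> hom G (wreath B G)"
    and cohomologous: "\<And>g. g \<in> carrier G \<Longrightarrow> AE x in bernoulli_space G M.
      wreath_action G M \<beta> (inv\<^bsub>wreath B G\<^esub> f (wreath_action G M \<beta> (sh g) x)) (T (wreath_action G M \<beta> (sh g) x)) =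
      wreath_action G M \<beta> (\<rho> g) (wreath_action G M \<beta> (inv\<^bsub>wreath B G\<^esub> f x) (T x))"
begin

definition Sm :: "('g \<Rightarrow> 'x) \<Rightarrow> 'g \<Rightarrow> 'x" where
  "Sm x = act (inv\<^bsub>H\<^esub> f x) (T x)"

definition \<phi> :: "'g \<Rightarrow> 'g" where
  "\<phi> g = snd (\<rho> g)"

lemma T_mp: "T \<in> mp_maps W" and T'_mp: "T' \<in> mp_maps W"
  using TT' by (auto simp: ae_inverse_def)

lemma f_H: "x \<in> space W \<Longrightarrow> f x \<in> carrier H"
  using measurable_space[OF f_meas] by simp

lemma f_sets: "s \<in> carrier H \<Longrightarrow> f -` {s} \<inter> space W \<in> sets W"
  by (rule measurable_sets[OF f_meas]) simp

lemma \<rho>_closed[simp]: "g \<in> carrier G \<Longrightarrow> \<rho> g \<in> carrier H"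
  using \<rho>_hom by (auto simp: hom_def)

lemma \<rho>_mult: "g \<in> carrier G \<Longrightarrow> h \<in> carrier G \<Longrightarrow> \<rho> (g \<otimes> h) = \<rho> g \<otimes>\<^bsub>H\<^esub> \<rho> h"
  using \<rho>_hom by (auto simp: hom_def)

lemma \<rho>_group_hom: "group_hom G H \<rho>"
  by unfold_locales (rule \<rho>_hom)

lemma \<rho>_one: "\<rho> e = \<one>\<^bsub>H\<^esub>"
  by (rule group_hom.hom_one[OF \<rho>_group_hom])

lemma \<phi>_closed[simp]: "g \<in> carrier G \<Longrightarrow> \<phi> g \<in> carrier G"
  by (simp add: \<phi>_def)

lemma \<phi>_mult: "g \<in> carrier G \<Longrightarrow> h \<in> carrier G \<Longrightarrow> \<phi> (g \<otimes> h) = \<phi> g \<otimes> \<phi> h"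
  by (simp add: \<phi>_def \<rho>_mult)

lemma \<phi>_hom: "group_hom G G \<phi>"
  by unfold_locales (auto simp: hom_def \<phi>_mult)

lemma Sm_measurable[measurable]: "Sm \<in> measurable W W"
  unfolding Sm_def
proof (rule measurable_compose_countable'[where I = "carrier H" and g = f and f = "\<lambda>s x. act (inv\<^bsub>H\<^esub> s) (T x)"])
  show "(\<lambda>x. act (inv\<^bsub>H\<^esub> s) (T x)) \<in> measurable W W" if "s \<in> carrier H" for s
    by (rule measurable_compose[OF mp_mapsD(1)[OF T_mp] act_measurable]) (use that in simp)
qed (rule f_meas, rule countable_H)

lemma Sm_space[simp]: "x \<in> space W \<Longrightarrow> Sm x \<in> space W"
  using measurable_space[OF Sm_measurable] .

lemma act_f_Sm: "x \<in> space W \<Longrightarrow> act (f x) (Sm x) = T x"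
  unfolding Sm_def by (rule act_inv) (auto simp: f_H mp_maps_space[OF T_mp])

lemma Sm_T_R: "x \<in> space W \<Longrightarrow> (Sm x, T x) \<in> R"
  using act_f_Sm f_H Sm_space unfolding R_iff by metis

lemma Sm_equivariant: "g \<in> carrier G \<Longrightarrow> AE x in W. Sm (act (sh g) x) = act (\<rho> g) (Sm x)"
  unfolding Sm_def by (rule cohomologous)

lemma AE_all_act:
  assumes "AE y in W. P y"
  shows "AE y in W. \<forall>h\<in>carrier H. P (act h y)"
  by (rule AE_ball_countable'[OF _ countable_H]) (rule AE_mp_maps[OF act_mp assms])

text \<open>\<open>Sm x\<close> is one of countably many translates of \<open>T x\<close>, and
  \<open>T\<close> as well as all translations pull null sets back to null sets. This is the
  nonsingularity of \<open>Sm\<close>.\<close>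

lemma AE_Sm:
  assumes "AE y in W. P y"
  shows "AE x in W. P (Sm x)"
  using AE_mp_maps[OF T_mp AE_all_act[OF assms]] AE_space
  by eventually_elim (simp add: Sm_def f_H)

lemma Sm_preserves_R: "ae_preserves W R Sm"
proof -
  obtain P where P: "AE x in W. P x" "\<And>x y. P x \<Longrightarrow> P y \<Longrightarrow> (x, y) \<in> R \<longleftrightarrow> (T x, T y) \<in> R"
    using T_R unfolding ae_preserves_def by blast
  have s: "sym R" and t: "trans R" using equiv_R by (auto simp: equiv_def)
  show ?thesis
  proof (rule ae_preservesI[OF P(1)])
    fix x y assume "P x" "P y" and xy: "x \<in> space W" "y \<in> space W"
    then have "(x, y) \<in> R \<longleftrightarrow> (T x, T y) \<in> R" using P(2) by blast
    also have "\<dots> \<longleftrightarrow> (Sm x, Sm y) \<in> R"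
      using Sm_T_R[OF xy(1)] Sm_T_R[OF xy(2)] s t by (meson symE transE)
    finally show "(x, y) \<in> R \<longleftrightarrow> (Sm x, Sm y) \<in> R" .
  qed
qed

section \<open>Injectivity of the induced endomorphism\<close>

lemma Sm_coordinate_sets:
  assumes "d \<in> carrier G" "A \<in> sets M"
  shows "{x \<in> space W. Sm x d \<in> A} \<in> sets W"
proof -
  note [measurable] = coordinate_measurable[OF assms(1)] assms(2)
  show ?thesis by measurable
qed

text \<open>Infinitely many independent coordinates confined to A describe a null set, and a
  nonsingular map cannot send almost every point into it.\<close>

lemma finite_concentrated:
  assumes A: "A \<in> sets M" "measure M A < 1"
  shows "finite {d \<in> carrier G. AE x in W. Sm x d \<in> A}"
proof (rule ccontr)
  let ?J = "{d \<in> carrier G. AE x in W. Sm x d \<in> A}"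
  assume inf: "infinite ?J"
  have cJ: "countable ?J" by (rule countable_subset[OF _ countable_G]) auto
  let ?Z = "{z \<in> space W. \<forall>d\<in>?J. z d \<in> A}"
  have Z: "?Z \<in> sets W"
  proof (rule sets.sets_Collect_countable_All'[OF _ cJ])
    fix d assume "d \<in> ?J"
    then have [measurable]: "(\<lambda>x. x d) \<in> measurable W M" by simp
    note [measurable] = A(1)
    show "{z \<in> space W. z d \<in> A} \<in> sets W" by measurable
  qed
  have "AE x in W. \<forall>d\<in>?J. Sm x d \<in> A" by (rule AE_ball_countable'[OF _ cJ]) simp
  then have in_Z: "AE x in W. Sm x \<in> ?Z" using AE_space by eventually_elim simp
  have "measure W ?Z = 0"
  proof (rule ccontr)
    assume "measure W ?Z \<noteq> 0"
    then have pos: "measure W ?Z > 0" by (simp add: less_le)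
    have compl: "measure M (space M - A) > 0" using A by (simp add: M.prob_compl)
    obtain F where F: "finite F" "\<And>i A'. i \<in> carrier G - F \<Longrightarrow> A' \<in> sets M \<Longrightarrow>
        measure M A' = measure M (space M - A) \<Longrightarrow> measure W (?Z \<inter> {z \<in> space W. z i \<in> A'}) > 0"
      by (rule coordinate_positive[OF Z pos compl]) (rule that; assumption)
    obtain d where d: "d \<in> ?J" "d \<notin> F" using inf F(1) by (meson finite_subset subsetI)
    have "measure W (?Z \<inter> {z \<in> space W. z d \<in> space M - A}) > 0"
      using F(2)[of d "space M - A"] d A by auto
    moreover have "?Z \<inter> {z \<in> space W. z d \<in> space M - A} = {}" using d by auto
    ultimately show False by (simp only: measure_empty less_irrefl)
  qed
  then have "AE z in W. z \<notin> ?Z" using Z W.prob_eq_0 by blast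
  from AE_Sm[OF this] in_Z have "AE x in W. False" by eventually_elim blast
  then show False using W.AE_False by simp
qed

text \<open>Both sides of \<open>\<rho> (k \<otimes> g) = \<rho> (g \<otimes> n)\<close>, where k is
  the conjugate of n, are compared at one coordinate. Conjugation thus translates the supports of
  kernel elements by \<open>\<phi> g\<close>.\<close>

lemma fst_conj:
  assumes g: "g \<in> carrier G" and n: "n \<in> carrier G" "\<phi> n = e" and d: "d \<in> carrier G"
  shows "fst (\<rho> (g \<otimes> n \<otimes> inv g)) (\<phi> g \<otimes> d) = \<one>\<^bsub>B\<^esub> \<longleftrightarrow> fst (\<rho> n) d = \<one>\<^bsub>B\<^esub>"
proof -
  let ?k = "g \<otimes> n \<otimes> inv g" and ?c = "\<phi> g \<otimes> d"
  have k: "?k \<in> carrier G" "?k \<otimes> g = g \<otimes> n" using g n by (simp_all add: G.m_assoc)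
  have "\<phi> (inv g) = inv (\<phi> g)" using g by (rule group_hom.hom_inv[OF \<phi>_hom])
  then have phik: "snd (\<rho> ?k) = e" using g n by (simp add: \<phi>_mult flip: \<phi>_def)
  have "fst (\<rho> (?k \<otimes> g)) ?c = fst (\<rho> (g \<otimes> n)) ?c" using k by simp
  then have eq: "fst (\<rho> ?k) ?c \<otimes>\<^bsub>B\<^esub> fst (\<rho> g) ?c = fst (\<rho> g) ?c \<otimes>\<^bsub>B\<^esub> fst (\<rho> n) d"
    using g n d k(1) phik by (simp only: \<rho>_mult) (simp add: fst_mult_H flip: \<phi>_def)
  have "fst (\<rho> ?k) ?c \<in> carrier B" "fst (\<rho> g) ?c \<in> carrier B" "fst (\<rho> n) d \<in> carrier B"
    using g n d k(1) by auto
  then show ?thesis using eq by (metis B.l_cancel_one B.r_cancel_one B.l_one B.r_one)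
qed

text \<open>At all but finitely many coordinates d, ergodicity allows only finitely many kernel
  elements to act trivially at d. If the image of \<phi> is infinite, conjugation pushes arbitrarily
  many kernel elements off d; if it is finite, the elements that act trivially along an orbit of the
  image form a nontrivial finite normal subgroup.\<close>

lemma kernel_trivial:
  assumes "g \<in> carrier G" "\<phi> g = e"
  shows "g = e"
proof -
  let ?N = "kernel G G \<phi>"
  have N: "n \<in> ?N \<longleftrightarrow> n \<in> carrier G \<and> \<phi> n = e" for n by (auto simp: kernel_def)
  have normal: "?N \<lhd> G" by (rule group_hom.normal_kernel[OF \<phi>_hom])
  have "finite ?N"
  proof (rule ccontr)
    assume inf: "infinite ?N"
    define Nd where "Nd = (\<lambda>d. {n \<in> ?N. fst (\<rho> n) d = \<one>\<^bsub>B\<^esub>})"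
    obtain b E where E: "E \<in> sets M" "0 < measure M E" "measure M E < 1" by (rule moving_set)
    \<comment> \<open>The coordinates at which \<open>Sm\<close> stays almost surely on one side of
      E, so that no contradiction to ergodicity arises there.\<close>
    define Bad where "Bad = {d \<in> carrier G. AE x in W. Sm x d \<in> E} \<union>
      {d \<in> carrier G. AE x in W. Sm x d \<in> space M - E}"
    have Bad: "finite Bad"
      unfolding Bad_def using finite_concentrated[of E] finite_concentrated[of "space M - E"] E
      by (simp add: M.prob_compl)
    have Nd_fin: "finite (Nd d)" if d: "d \<in> carrier G" "d \<notin> Bad" for d
    proof (rule ccontr)
      assume infd: "infinite (Nd d)"
      let ?U = "{x \<in> space W. Sm x d \<in> E}"
      have U: "?U \<in> sets W" using Sm_coordinate_sets d E by blast
      have "measure W ?U = 0 \<or> measure W ?U = 1"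
      proof (rule ergodic[OF U, where Q = "sh ` Nd d"])
        show "sh ` Nd d \<subseteq> carrier H" by (auto simp: Nd_def N)
        have "snd ` sh ` Nd d = Nd d" by (simp add: image_image)
        then show "infinite (snd ` sh ` Nd d)" using infd by simp
        fix h assume "h \<in> sh ` Nd d"
        then obtain n where n: "n \<in> carrier G" "\<phi> n = e" "fst (\<rho> n) d = \<one>\<^bsub>B\<^esub>" "h = sh n"
          by (auto simp: Nd_def N)
        show "AE x in W. act h x \<in> ?U \<longleftrightarrow> x \<in> ?U"
          using Sm_equivariant[OF n(1)] AE_space
        proof eventually_elim
          case (elim x)
          have "Sm (act h x) d = Sm x d"
            using elim n d by (simp add: act_apply \<beta>_one W_mem flip: \<phi>_def)
          then show ?case using elim n by simp
        qed
      qed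
      then have "d \<in> Bad"
      proof
        assume "measure W ?U = 0"
        then have "AE x in W. x \<notin> ?U" using U W.prob_eq_0 by blast
        then have "AE x in W. Sm x d \<in> space M - E"
          using AE_space by eventually_elim (use d W_mem in auto)
        then show ?thesis using d by (simp add: Bad_def)
      next
        assume "measure W ?U = 1"
        then have "AE x in W. x \<in> ?U" using U W.prob_eq_1 by blast
        then have "AE x in W. Sm x d \<in> E" by eventually_elim auto
        then show ?thesis using d by (simp add: Bad_def)
      qed
      then show False using d by simp
    qed
    show False
    proof (cases "finite (\<phi> ` carrier G)")
      case False
      obtain d where d: "d \<in> carrier G" "d \<notin> Bad" using infinite_ex[OF Bad] by blast
      \<comment> \<open>One element more than \<open>Nd d\<close> can hold; a single conjugation
        moves all their supports away from d.\<close>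
      obtain K where K: "K \<subseteq> ?N" "finite K" "card K = Suc (card (Nd d))"
        using infinite_arbitrarily_large[OF inf] by blast
      let ?F = "\<Union>n\<in>K. supp (fst (\<rho> n))"
      have "finite ?F" using K N by (intro finite_UN_I K(2) finite_supp) auto
      then have "finite {c \<in> carrier G. c \<otimes> d \<in> ?F}" using d(1) by (rule finite_translate_right)
      then obtain c where "c \<in> \<phi> ` carrier G" "c \<notin> {c \<in> carrier G. c \<otimes> d \<in> ?F}"
        using False by (meson finite_subset subsetI)
      then obtain g where g: "g \<in> carrier G" "\<phi> g \<otimes> d \<notin> ?F" by auto
      have "(\<lambda>n. inv g \<otimes> n \<otimes> g) ` K \<subseteq> Nd d"
      proof clarify
        fix n assume n: "n \<in> K"
        let ?n = "inv g \<otimes> n \<otimes> g"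
        have nG: "n \<in> carrier G" "\<phi> n = e" using n K N by auto
        have n': "?n \<in> carrier G" "g \<otimes> ?n \<otimes> inv g = n"
          using g nG by (simp_all add: G.m_assoc)
        have "\<phi> (inv g) = inv (\<phi> g)" using g(1) by (rule group_hom.hom_inv[OF \<phi>_hom])
        then have phi: "\<phi> ?n = e" using g nG by (simp add: \<phi>_mult)
        have "fst (\<rho> n) (\<phi> g \<otimes> d) = \<one>\<^bsub>B\<^esub>" using g d n by (auto simp: supp_def)
        then have "fst (\<rho> ?n) d = \<one>\<^bsub>B\<^esub>" using fst_conj[OF g(1) n'(1) phi d(1)] n'(2) by simp
        then show "?n \<in> Nd d" using n' phi by (simp add: Nd_def N)
      qed
      moreover have "inj_on (\<lambda>n. inv g \<otimes> n \<otimes> g) K"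
      proof (rule inj_onI)
        fix n m assume nm: "n \<in> K" "m \<in> K" "inv g \<otimes> n \<otimes> g = inv g \<otimes> m \<otimes> g"
        then have "n \<in> carrier G" "m \<in> carrier G" using K N by auto
        then show "n = m" using nm(3) g(1) by simp
      qed
      ultimately have "card K \<le> card (Nd d)" using Nd_fin[OF d] by (metis card_image card_mono)
      then show False using K by simp
    next
      case True
      have "?N \<noteq> {e}" using inf by auto
      moreover have "e \<in> ?N" using N group_hom.hom_one[OF \<phi>_hom] by simp
      ultimately obtain n where n: "n \<in> carrier G" "\<phi> n = e" "n \<noteq> e" using N by blast
      define J where "J = (\<Union>c\<in>\<phi> ` carrier G. {d \<in> carrier G. c \<otimes> d \<in> supp (fst (\<rho> n))})"
      have "finite J"
        unfolding J_def by (rule finite_UN_I[OF True]) (use n in \<open>auto intro!: finite_translate finite_supp\<close>)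
      then obtain d where d: "d \<in> carrier G" "d \<notin> Bad" "d \<notin> J"
        using infinite_ex[of "Bad \<union> J"] Bad by auto
      \<comment> \<open>Triviality is demanded along the whole orbit of d under the image of \<phi>,
        since conjugation permutes this orbit; J was defined so that n belongs to P.\<close>
      define P where "P = {m \<in> ?N. \<forall>g\<in>carrier G. fst (\<rho> m) (\<phi> g \<otimes> d) = \<one>\<^bsub>B\<^esub>}"
      have P: "m \<in> P \<longleftrightarrow> m \<in> carrier G \<and> \<phi> m = e \<and> (\<forall>g\<in>carrier G. fst (\<rho> m) (\<phi> g \<otimes> d) = \<one>\<^bsub>B\<^esub>)" for m
        by (auto simp: P_def N)
      have P_mult: "fst (\<rho> (m \<otimes> m')) c = fst (\<rho> m) c \<otimes>\<^bsub>B\<^esub> fst (\<rho> m') c"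
        if "m \<in> P" "m' \<in> P" "c \<in> carrier G" for m m' c
        using that P by (simp add: \<rho>_mult fst_mult_H flip: \<phi>_def)
      have phi_e: "\<phi> e = e" by (rule group_hom.hom_one[OF \<phi>_hom])
      have "n \<in> P" unfolding P using n d by (auto simp: supp_def J_def)
      have "P \<subseteq> Nd d"
      proof
        fix m assume m: "m \<in> P"
        then have "fst (\<rho> m) (\<phi> e \<otimes> d) = \<one>\<^bsub>B\<^esub>" using P G.one_closed by blast
        then show "m \<in> Nd d" using m P d(1) phi_e by (simp add: Nd_def N)
      qed
      then have "finite P" using Nd_fin[OF d(1,2)] finite_subset by blast
      moreover have "P \<lhd> G"
        unfolding G.normal_inv_iff
      proof (intro conjI ballI G.subgroupI)
        show "P \<subseteq> carrier G" using P by auto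
        show "P \<noteq> {}" using \<open>n \<in> P\<close> by auto
      next
        fix m assume m: "m \<in> P"
        then have mG: "m \<in> carrier G" and "\<phi> (inv m) = e"
          using P group_hom.hom_inv[OF \<phi>_hom, of m] by auto
        moreover have "fst (\<rho> (inv m)) (\<phi> g \<otimes> d) = \<one>\<^bsub>B\<^esub>" if g: "g \<in> carrier G" for g
        proof -
          let ?c = "\<phi> g \<otimes> d"
          have c: "?c \<in> carrier G" using g d by simp
          have "fst (\<rho> (m \<otimes> inv m)) ?c = fst (\<rho> m) ?c \<otimes>\<^bsub>B\<^esub> fst (\<rho> (inv m)) ?c"
            using mG c m P by (subst \<rho>_mult) (auto simp: fst_mult_H simp flip: \<phi>_def)
          moreover have "fst (\<rho> m) ?c = \<one>\<^bsub>B\<^esub>" using m g P by blast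
          ultimately show ?thesis using mG c by (simp add: \<rho>_one)
        qed
        ultimately show "inv m \<in> P" unfolding P by simp
      next
        fix m m' assume m: "m \<in> P" "m' \<in> P"
        then show "m \<otimes> m' \<in> P"
          unfolding P using P_mult[OF m] P d(1) by (simp add: \<phi>_mult)
      next
        fix g m assume g: "g \<in> carrier G" and m: "m \<in> P"
        let ?m = "g \<otimes> m \<otimes> inv g"
        have mG: "m \<in> carrier G" "\<phi> m = e" using m P by auto
        have inv: "\<phi> (inv g) = inv (\<phi> g)" using g by (rule group_hom.hom_inv[OF \<phi>_hom])
        have "fst (\<rho> ?m) (\<phi> k \<otimes> d) = \<one>\<^bsub>B\<^esub>" if k: "k \<in> carrier G" for k
        proof -
          let ?d = "\<phi> (inv g \<otimes> k) \<otimes> d"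
          have "\<phi> k \<otimes> d = \<phi> g \<otimes> ?d"
            using g k d inv by (simp add: \<phi>_mult G.m_assoc)
          moreover have "fst (\<rho> m) ?d = \<one>\<^bsub>B\<^esub>"
            using m P g k by (meson G.inv_closed G.m_closed)
          ultimately show ?thesis
            using fst_conj[OF g mG, of ?d] g k d(1) by simp
        qed
        then show "?m \<in> P" unfolding P using g mG inv by (simp add: \<phi>_mult)
      qed
      ultimately have "P = {e}" using no_finite_normal by blast
      then show False using \<open>n \<in> P\<close> n by simp
    qed
  qed
  then have "?N = {e}" using no_finite_normal normal by blast
  then show ?thesis using assms N by blast
qed

lemma \<phi>_inj: "inj_on \<phi> (carrier G)"
  using group_hom.inj_on_one_iff[OF \<phi>_hom] kernel_trivial by blast

section \<open>Measure preservation and invertibility of the straightened map\<close>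

lemma Sm_mp: "Sm \<in> mp_maps W"
proof -
  define \<nu> where "\<nu> = distr W W Sm"
  interpret \<nu>: prob_space \<nu> unfolding \<nu>_def by (rule W.prob_space_distr) simp
  have [simp]: "sets \<nu> = sets W" "space \<nu> = space W" by (simp_all add: \<nu>_def)
  have "absolutely_continuous W \<nu>"
    unfolding absolutely_continuous_def
  proof
    fix N assume N: "N \<in> null_sets W"
    have S: "Sm -` N \<inter> space W \<in> sets W"
      by (rule measurable_sets[OF Sm_measurable]) (use N in auto)
    from AE_Sm[OF AE_not_in[OF N]] have "AE x in W. Sm x \<notin> N" .
    then have "AE x in W. x \<notin> Sm -` N \<inter> space W" by eventually_elim simp
    then have "Sm -` N \<inter> space W \<in> null_sets W" using AE_iff_null_sets[OF S] by simp
    then show "N \<in> null_sets \<nu>" using N by (auto simp: \<nu>_def null_sets_def emeasure_distr)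
  qed
  then obtain h where h[measurable]: "h \<in> borel_measurable W" and dens: "density W h = \<nu>"
    using W.Radon_Nikodym[of \<nu>] by auto
  \<comment> \<open>The image measure and W are both invariant under \<open>\<rho> g\<close>, and
    densities are unique almost everywhere.\<close>
  have inv: "AE x in W. h (act (\<rho> g) x) = h x" if g: "g \<in> carrier G" for g
  proof -
    let ?k = "\<rho> g"
    have k: "?k \<in> carrier H" using g by simp
    have k_meas[measurable]: "act ?k \<in> measurable W W" "act (inv\<^bsub>H\<^esub> ?k) \<in> measurable W W"
      using k by auto
    have "distr \<nu> W (act ?k) = distr W W (act ?k \<circ> Sm)"
      unfolding \<nu>_def by (rule distr_distr) measurable
    also have "\<dots> = distr W W (Sm \<circ> act (sh g))"
    proof (rule distr_cong_AE)
      show "AE x in W. (act ?k \<circ> Sm) x = (Sm \<circ> act (sh g)) x"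
        using Sm_equivariant[OF g] by eventually_elim simp
    qed (use g in \<open>auto intro!: measurable_comp[OF Sm_measurable] measurable_comp[OF _ Sm_measurable]\<close>)
    also have "\<dots> = distr (distr W W (act (sh g))) W Sm"
      by (rule distr_distr[symmetric]) (use g in auto)
    also have "\<dots> = \<nu>" using mp_mapsD(2)[OF act_mp[OF sh_closed[OF g]]] by (simp add: \<nu>_def)
    finally have \<nu>_inv: "distr \<nu> W (act ?k) = \<nu>" .
    have "\<nu> = density (distr W W (act ?k)) h" using mp_mapsD(2)[OF act_mp[OF k]] dens by simp
    also have "\<dots> = distr (density W (\<lambda>x. h (act ?k x))) W (act ?k)" by (rule density_distr) measurable
    finally have eq: "distr (density W (\<lambda>x. h (act ?k x))) W (act ?k) = \<nu>" by simp
    have undo_k: "distr (distr N W (act ?k)) W (act (inv\<^bsub>H\<^esub> ?k)) = N" if N: "sets N = sets W" for N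
    proof -
      have sp: "space N = space W" using N by (rule sets_eq_imp_space_eq)
      have mN: "act ?k \<in> measurable N W" using k_meas(1) N by (simp cong: measurable_cong_sets)
      have "distr (distr N W (act ?k)) W (act (inv\<^bsub>H\<^esub> ?k)) = distr N W (act (inv\<^bsub>H\<^esub> ?k) \<circ> act ?k)"
        by (rule distr_distr[OF k_meas(2) mN])
      also have "\<dots> = distr N N (\<lambda>x. x)" by (rule distr_cong) (use k sp N in auto)
      also have "\<dots> = N" by simp
      finally show ?thesis .
    qed
    have "density W (\<lambda>x. h (act ?k x)) = density W h"
      using undo_k[of "density W (\<lambda>x. h (act ?k x))"] undo_k[of \<nu>] eq \<nu>_inv dens by simp
    then show ?thesis by (intro W.density_unique) measurable
  qed
  \<comment> \<open>The level 1 alone decides: if the density is almost everywhere at most 1, or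
    almost everywhere at least 1, then one of two probability measures dominates the other, and
    passing to complements makes them equal.\<close>
  define U where "U = {x \<in> space W. h x > 1}"
  have U[measurable]: "U \<in> sets W" unfolding U_def by measurable
  have erg: "measure W U = 0 \<or> measure W U = 1"
  proof (rule ergodic[OF U, where Q = "\<rho> ` carrier G"])
    have "snd ` \<rho> ` carrier G = \<phi> ` carrier G" by (simp add: image_image \<phi>_def)
    then show "infinite (snd ` \<rho> ` carrier G)" using \<phi>_inj infinite_G by (simp add: finite_image_iff)
    fix k assume "k \<in> \<rho> ` carrier G"
    then obtain g where g: "g \<in> carrier G" "k = \<rho> g" by auto
    show "AE x in W. act k x \<in> U \<longleftrightarrow> x \<in> U"
      using inv[OF g(1)] AE_space by eventually_elim (use g in \<open>auto simp: U_def\<close>)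
  qed auto
  have compl: "measure \<nu> (space W - V) = 1 - measure \<nu> V" "measure W (space W - V) = 1 - measure W V"
    if "V \<in> sets W" for V
    using \<nu>.prob_compl[of V] W.prob_compl[of V] that by simp_all
  have "measure \<nu> V = measure W V" if V: "V \<in> sets W" for V
    using erg
  proof
    assume "measure W U = 0"
    then have "AE x in W. x \<notin> U" using U W.prob_eq_0 by blast
    then have h1: "AE x in W. h x \<le> 1" using AE_space by eventually_elim (auto simp: U_def)
    have le: "measure \<nu> V \<le> measure W V" if V: "V \<in> sets W" for V
    proof -
      have "emeasure \<nu> V = (\<integral>\<^sup>+x. h x * indicator V x \<partial>W)"
        unfolding dens[symmetric] by (rule emeasure_density) (use V in auto)
      also have "\<dots> \<le> (\<integral>\<^sup>+x. indicator V x \<partial>W)"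
        by (rule nn_integral_mono_AE) (use h1 in \<open>auto elim!: AE_mp split: split_indicator\<close>)
      also have "\<dots> = emeasure W V" using V by simp
      finally show ?thesis by (simp add: \<nu>.emeasure_eq_measure W.emeasure_eq_measure)
    qed
    show ?thesis using le[OF V] le[of "space W - V"] V compl[OF V] by simp
  next
    assume "measure W U = 1"
    then have "AE x in W. x \<in> U" using U W.prob_eq_1 by blast
    then have h1: "AE x in W. 1 \<le> h x" by eventually_elim (auto simp: U_def)
    have le: "measure W V \<le> measure \<nu> V" if V: "V \<in> sets W" for V
    proof -
      have "emeasure W V = (\<integral>\<^sup>+x. indicator V x \<partial>W)" using V by simp
      also have "\<dots> \<le> (\<integral>\<^sup>+x. h x * indicator V x \<partial>W)"
        by (rule nn_integral_mono_AE) (use h1 in \<open>auto elim!: AE_mp split: split_indicator\<close>)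
      also have "\<dots> = emeasure \<nu> V"
        unfolding dens[symmetric] by (rule emeasure_density[symmetric]) (use V in auto)
      finally show ?thesis by (simp add: \<nu>.emeasure_eq_measure W.emeasure_eq_measure)
    qed
    show ?thesis using le[OF V] le[of "space W - V"] V compl[OF V] by simp
  qed
  then have "\<nu> = W"
    by (intro measure_eqI) (simp_all add: \<nu>.emeasure_eq_measure W.emeasure_eq_measure)
  then show ?thesis by (simp add: mp_maps_def \<nu>_def)
qed


lemma Sm_ae_inverse: "\<exists>Si. ae_inverse W Sm Si"
proof -
  \<comment> \<open>Up to null sets \<open>Y s\<close> is the image of the piece on which f equals
    s: a preimage of y in this piece can only be \<open>T' (act s y)\<close>.\<close>
  define Y where "Y = (\<lambda>s. {y \<in> space W. f (T' (act s y)) = s})"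
  define piece where "piece = (\<lambda>s. f -` {s} \<inter> space W)"
  have T'm: "T' \<in> measurable W W" using mp_mapsD(1)[OF T'_mp] .
  have T'T: "AE x in W. T' (T x) = x" and TT'': "AE x in W. T (T' x) = x"
    using TT' by (auto simp: ae_inverse_def)
  have fT': "(\<lambda>y. f (T' (act s y))) \<in> measurable W (count_space (carrier H))" if "s \<in> carrier H" for s
    by (rule measurable_compose[OF measurable_compose[OF act_measurable[OF that] T'm] f_meas])
  have Y: "Y s \<in> sets W" if "s \<in> carrier H" for s
  proof -
    have "(\<lambda>y. f (T' (act s y))) -` {s} \<inter> space W \<in> sets W"
      by (rule measurable_sets[OF fT'[OF that]]) (use that in simp)
    moreover have "(\<lambda>y. f (T' (act s y))) -` {s} \<inter> space W = Y s" by (auto simp: Y_def)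
    ultimately show ?thesis by simp
  qed
  have piece: "piece s \<in> sets W" if "s \<in> carrier H" for s
    unfolding piece_def by (rule f_sets[OF that])
  define j where "j = (\<lambda>s x. act (inv\<^bsub>H\<^esub> s) (T x))"
  have j_mp: "j s \<in> mp_maps W" if "s \<in> carrier H" for s
    using mp_maps_comp[OF act_mp[of "inv\<^bsub>H\<^esub> s"] T_mp] that by (simp add: j_def comp_def)
  have Sm_j: "Sm x = j (f x) x" for x by (simp add: Sm_def j_def)
  have j_Y: "AE x in W. j s x \<in> Y s \<longleftrightarrow> x \<in> piece s" if s: "s \<in> carrier H" for s
    using T'T AE_space
  proof eventually_elim
    case (elim x)
    have Tx: "T x \<in> space W" using elim mp_maps_space[OF T_mp] by blast
    have "act s (j s x) = T x" using s Tx by (simp add: j_def)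
    moreover have "j s x \<in> space W" using s Tx by (simp add: j_def)
    ultimately show ?case using elim by (auto simp: Y_def piece_def)
  qed
  text \<open>\<^term>\<open>Sm\<close> is measure preserving on all of the space and on each of the pieces, on which
    it has the images \<^term>\<open>Y\<close>: a point in two of these images would be counted twice.\<close>
  have disj: "AE y in W. \<not> (y \<in> Y s \<and> y \<in> Y t)" if s: "s \<in> carrier H" and t: "t \<in> carrier H" and st: "s \<noteq> t" for s t
  proof -
    let ?V = "Y s \<inter> Y t"
    have V: "?V \<in> sets W" using Y s t by auto
    have counted: "measure W (piece r \<inter> (j r -` ?V \<inter> space W)) = measure W ?V" if r: "r \<in> {s, t}" for r
    proof -
      have rH: "r \<in> carrier H" using r s t by auto
      have jm: "j r -` ?V \<inter> space W \<in> sets W"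
        by (rule measurable_sets[OF mp_mapsD(1)[OF j_mp[OF rH]] V])
      have "measure W (piece r \<inter> (j r -` ?V \<inter> space W)) = measure W (j r -` ?V \<inter> space W)"
      proof (rule measure_eq_AE)
        show "AE x in W. x \<in> piece r \<inter> (j r -` ?V \<inter> space W) \<longleftrightarrow> x \<in> j r -` ?V \<inter> space W"
          using j_Y[OF rH] by eventually_elim (use r in auto)
      qed (use piece[OF rH] jm in auto)
      also have "\<dots> = measure W ?V" by (rule measure_mp_maps[OF j_mp[OF rH] V])
      finally show ?thesis .
    qed
    let ?A = "\<lambda>r. piece r \<inter> (j r -` ?V \<inter> space W)"
    have A: "?A r \<in> sets W" if "r \<in> carrier H" for r
      using piece[OF that] measurable_sets[OF mp_mapsD(1)[OF j_mp[OF that]] V] by auto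
    have "measure W ?V + measure W ?V = measure W (?A s) + measure W (?A t)"
      using counted[of s] counted[of t] by simp
    also have "\<dots> = measure W (?A s \<union> ?A t)"
      by (rule W.finite_measure_Union[symmetric]) (use A s t st in \<open>auto simp: piece_def\<close>)
    also have "\<dots> \<le> measure W (Sm -` ?V \<inter> space W)"
      by (rule W.finite_measure_mono) (use measurable_sets[OF Sm_measurable V] in \<open>auto simp: piece_def Sm_j\<close>)
    also have "\<dots> = measure W ?V" by (rule measure_mp_maps[OF Sm_mp V])
    finally have "measure W ?V = 0" using measure_nonneg[of W ?V] by linarith
    then have "AE y in W. y \<notin> ?V" using V W.prob_eq_0 by blast
    then show ?thesis by eventually_elim auto
  qed
  have "AE y in W. \<forall>s\<in>carrier H. \<forall>t\<in>carrier H. s \<noteq> t \<longrightarrow> \<not> (y \<in> Y s \<and> y \<in> Y t)"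
    by (intro AE_ball_countable' countable_H) (use disj in auto)
  then have uniq: "AE x in W. \<forall>s\<in>carrier H. \<forall>t\<in>carrier H. s \<noteq> t \<longrightarrow> \<not> (Sm x \<in> Y s \<and> Sm x \<in> Y t)"
    by (rule AE_mp_maps[OF Sm_mp])
  have Sm_Y: "AE x in W. Sm x \<in> Y (f x)"
    using T'T AE_space by eventually_elim (simp add: Y_def act_f_Sm)
  let ?UY = "\<Union>s\<in>carrier H. Y s"
  have UY: "?UY \<in> sets W" by (rule sets.countable_UN''[OF countable_H]) (rule Y)
  \<comment> \<open>Almost every point lands in the union, and by measure preservation the union is
    then conull.\<close>
  have "measure W ?UY = measure W (Sm -` ?UY \<inter> space W)"
    by (rule measure_mp_maps[OF Sm_mp UY, symmetric])
  also have "\<dots> = measure W (space W)"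
  proof (rule measure_eq_AE)
    show "AE x in W. x \<in> Sm -` ?UY \<inter> space W \<longleftrightarrow> x \<in> space W"
      using Sm_Y AE_space by eventually_elim (use f_H in blast)
  qed (use measurable_sets[OF Sm_measurable UY] in auto)
  finally have covers: "AE y in W. y \<in> ?UY" using W.prob_space UY W.prob_eq_1 by simp
  define enum where "enum = from_nat_into (carrier H)"
  have H_ne: "carrier H \<noteq> {}" using H.one_closed by blast
  have enumH: "enum n \<in> carrier H" for n
    unfolding enum_def by (rule from_nat_into[OF H_ne])
  \<comment> \<open>The sets overlap in null sets only, so the first index of an enumeration is a
    measurable choice of the piece.\<close>
  define l where "l = (\<lambda>y. enum (LEAST n. y \<in> Y (enum n)))"
  have lH: "l y \<in> carrier H" for y by (simp add: l_def enumH)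
  have l_Y: "y \<in> Y (l y)" if y: "y \<in> ?UY" for y
  proof -
    obtain s where s: "s \<in> carrier H" "y \<in> Y s" using y by blast
    obtain n where "enum n = s"
      using from_nat_into_surj[OF countable_H s(1)] unfolding enum_def by (rule exE)
    then have "y \<in> Y (enum n)" using s(2) by simp
    then show ?thesis unfolding l_def by (rule LeastI)
  qed
  have l_meas: "l \<in> measurable W (count_space (carrier H))"
    unfolding l_def
  proof (rule measurable_compose[where N = "count_space UNIV" and g = enum])
    show "(\<lambda>y. LEAST n. y \<in> Y (enum n)) \<in> measurable W (count_space UNIV)"
    proof (rule measurable_Least)
      fix n
      note [measurable] = Y[OF enumH[of n]]
      show "(\<lambda>y. y \<in> Y (enum n)) \<in> measurable W (count_space UNIV)" by measurable
    qed
  qed (simp add: enumH)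
  define Si where "Si = (\<lambda>y. T' (act (l y) y))"
  have Si_meas: "Si \<in> measurable W W"
    unfolding Si_def
  proof (rule measurable_compose_countable'[where I = "carrier H" and g = l and f = "\<lambda>s y. T' (act s y)"])
    show "(\<lambda>y. T' (act s y)) \<in> measurable W W" if "s \<in> carrier H" for s
      by (rule measurable_compose[OF act_measurable[OF that] T'm])
  qed (rule l_meas, rule countable_H)
  have Sm_Si: "AE y in W. Sm (Si y) = y"
    using covers AE_all_act[OF TT''] AE_space
  proof eventually_elim
    case (elim y)
    then have "f (Si y) = l y" using l_Y[OF elim(1)] by (simp add: Y_def Si_def)
    moreover have "T (Si y) = act (l y) y" using elim lH by (simp add: Si_def)
    ultimately show ?case using elim lH by (simp add: Sm_def)
  qed
  have Si_Sm: "AE x in W. Si (Sm x) = x"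
    using uniq Sm_Y T'T AE_space
  proof eventually_elim
    case (elim x)
    have fx: "f x \<in> carrier H" using elim f_H by blast
    then have "Sm x \<in> Y (l (Sm x))" using elim l_Y by blast
    then have "l (Sm x) = f x" using elim(1,2) fx lH by metis
    then show ?case using elim by (simp add: Si_def act_f_Sm)
  qed
  have "distr W W Si = distr (distr W W Sm) W Si" using mp_mapsD(2)[OF Sm_mp] by simp
  also have "\<dots> = distr W W (Si \<circ> Sm)" by (rule distr_distr[OF Si_meas Sm_measurable])
  also have "\<dots> = distr W W (\<lambda>x. x)"
    by (rule distr_cong_AE) (use Si_Sm Si_meas in \<open>auto intro: measurable_comp[OF Sm_measurable]\<close>)
  also have "\<dots> = W" by (simp add: distr_id2)
  finally have "Si \<in> mp_maps W" using Si_meas by (simp add: mp_maps_def)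
  then have "ae_inverse W Sm Si" using Sm_mp Sm_Si Si_Sm by (simp add: ae_inverse_def)
  then show ?thesis by (intro exI[of _ Si])
qed

definition Si :: "('g \<Rightarrow> 'x) \<Rightarrow> 'g \<Rightarrow> 'x" where
  "Si = (SOME Si. ae_inverse W Sm Si)"

lemma Si: "ae_inverse W Sm Si"
  unfolding Si_def by (rule someI_ex[OF Sm_ae_inverse])

lemma Si_mp: "Si \<in> mp_maps W" and Si_Sm: "AE x in W. Si (Sm x) = x" and Sm_Si: "AE x in W. Sm (Si x) = x"
  using Si by (auto simp: ae_inverse_def)

section \<open>Locality and the relation of the direct sum\<close>

lemma AE_ret_Sm:
  assumes h: "h \<in> carrier H"
  shows "AE x in W. Sm x \<in> free_part \<and> act (ret (Sm (act h x)) (Sm x)) (Sm x) = Sm (act h x)"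
proof -
  obtain P where P: "AE x in W. P x" "\<And>x y. P x \<Longrightarrow> P y \<Longrightarrow> (x, y) \<in> R \<longleftrightarrow> (Sm x, Sm y) \<in> R"
    using Sm_preserves_R unfolding ae_preserves_def by blast
  show ?thesis
    using P(1) AE_mp_maps[OF act_mp[OF h] P(1)] AE_Sm[OF AE_free_part] AE_space
  proof eventually_elim
    case (elim x)
    then have "(x, act h x) \<in> R" using h by (auto simp: R_iff)
    then have "(Sm x, Sm (act h x)) \<in> R" using P(2) elim by blast
    then show ?case using elim act_ret by blast
  qed
qed

text \<open>If the return element over a change of the coordinate at the neutral element moved the
  coordinates by \<open>\<sigma> \<noteq> e\<close>, then far away from the neutral element a coordinate would have to
  agree, up to the action of known group elements, with its translate by \<open>\<sigma>\<close>, because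
  coordinates of \<open>Sm x\<close> hardly depend on distant coordinates of \<open>x\<close>; but distinct coordinates
  are independent.\<close>

lemma locality_null:
  assumes b: "b \<in> carrier B" and s: "s \<in> carrier H" "snd s \<noteq> e"
  shows "AE x in W. ret (Sm (act (bs b e) x)) (Sm x) \<noteq> s"
proof -
  define \<sigma> where "\<sigma> = inv (snd s)"
  have \<sigma>: "\<sigma> \<in> carrier G" "\<sigma> \<noteq> e" using s by (auto simp: \<sigma>_def)
  define C where "C = (\<lambda>x. ret (Sm (act (bs b e) x)) (Sm x))"
  have hb: "bs b e \<in> carrier H" using b by simp
  have C_meas: "C \<in> measurable W (count_space (carrier H))"
    unfolding C_def
    by (rule ret_measurable) (rule measurable_compose[OF act_measurable[OF hb] Sm_measurable], rule Sm_measurable)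
  let ?U = "C -` {s} \<inter> space W"
  have U: "?U \<in> sets W" by (rule measurable_sets[OF C_meas]) (use s in simp)
  have Si_m: "Si \<in> measurable W W" using mp_mapsD(1)[OF Si_mp] .
  \<comment> \<open>The independence to be used is that of the coordinates of \<open>Sm x\<close>,
    so the event is moved to the image side.\<close>
  let ?U' = "Si -` ?U \<inter> space W"
  have U': "?U' \<in> sets W" by (rule measurable_sets[OF Si_m U])
  have mU: "measure W ?U' = measure W ?U" by (rule measure_mp_maps[OF Si_mp U])
  have "measure W ?U = 0"
  proof (rule ccontr)
    assume "measure W ?U \<noteq> 0"
    then have pos: "measure W ?U' > 0" using mU by (simp add: less_le)
    obtain b1 E where E: "E \<in> sets M" "0 < measure M E" "measure M E < 1" by (rule moving_set)
    \<comment> \<open>The lower bound that \<open>coordinate_pair_bound\<close> gives for the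
      conflicting event; locality will bound the same event by half of it.\<close>
    define q where "q = measure W ?U' * (measure M E * (1 - measure M E)) / 2"
    have q: "q > 0" using pos E by (simp add: q_def)
    obtain F where F: "finite F" "\<And>i j A. i \<in> carrier G - F \<Longrightarrow> j \<in> carrier G - F \<Longrightarrow> i \<noteq> j \<Longrightarrow>
        A \<in> sets M \<Longrightarrow> measure M A = measure M E \<Longrightarrow>
        measure W ?U' * (measure M E * (1 - measure M E)) / 2 \<le> measure W (?U' \<inter> {z \<in> space W. z i \<in> A \<and> z j \<notin> A})"
      by (rule coordinate_pair_bound[OF U' pos E(2,3)]) (rule that; assumption)
    define V where "V = {x \<in> space W. Sm x e \<in> E}"
    have V: "V \<in> sets W" unfolding V_def by (rule Sm_coordinate_sets) (use E in auto)
    obtain F' where F': "finite F'" "\<And>d b. d \<in> carrier G - F' \<Longrightarrow> b \<in> carrier B \<Longrightarrow>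
        measure W {x \<in> space W. act (bs b d) x \<in> V \<longleftrightarrow> x \<notin> V} \<le> q / 2"
      by (rule asymp_fixed[OF V half_gt_zero[OF q]]) (rule that; assumption)
    \<comment> \<open>To be avoided by \<delta>: the coordinates for which \<delta> or
      \<open>\<sigma> \<otimes> \<delta>\<close> lies in F, and the support of s, where s alters
      values.\<close>
    define J where "J = F \<union> {d \<in> carrier G. \<sigma> \<otimes> d \<in> F} \<union> supp (fst s)"
    have J: "finite J" using F(1) \<sigma>(1) finite_supp[OF s(1)] by (auto simp: J_def intro: finite_translate)
    have "inj_on (\<lambda>g. inv (\<phi> g)) (carrier G)"
      using \<phi>_inj by (auto simp: inj_on_def)
    then have "finite {g \<in> carrier G. inv (\<phi> g) \<in> J}"
      using finite_vimage_IntI[OF J, of "\<lambda>g. inv (\<phi> g)" "carrier G"]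
      by (simp add: vimage_def Int_def conj_commute)
    then obtain g where g: "g \<in> carrier G" "g \<notin> F'" "inv (\<phi> g) \<notin> J"
      using infinite_ex[of "F' \<union> {g \<in> carrier G. inv (\<phi> g) \<in> J}"] F'(1) by auto
    \<comment> \<open>The coordinate that \<open>\<rho> g\<close> carries to e. Injectivity of
      \<phi> lets it avoid J while g avoids F'.\<close>
    define \<delta> where "\<delta> = inv (\<phi> g)"
    have \<delta>: "\<delta> \<in> carrier G" "\<delta> \<notin> F" "\<sigma> \<otimes> \<delta> \<notin> F" "fst s \<delta> = \<one>\<^bsub>B\<^esub>" "\<sigma> \<otimes> \<delta> \<noteq> \<delta>"
      using g \<sigma> by (auto simp: \<delta>_def J_def supp_def)
    define w where "w = fst (\<rho> g) e"
    have w: "w \<in> carrier B" using g by (simp add: w_def)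
    \<comment> \<open>Besides moving \<delta> to e, \<open>\<rho> g\<close> applies w there, so E is
      pulled back through w. Its measure is unchanged, and F serves all sets of this
      measure.\<close>
    define Ew where "Ew = \<beta> w -` E \<inter> space M"
    have Ew: "Ew \<in> sets M" "measure M Ew = measure M E"
      unfolding Ew_def using measurable_sets[OF mp_mapsD(1)[OF \<beta>_mp[OF w]] E(1)]
        measure_mp_maps[OF \<beta>_mp[OF w] E(1)] by auto
    let ?A = "{z \<in> space W. z (\<sigma> \<otimes> \<delta>) \<in> Ew \<and> z \<delta> \<notin> Ew}"
    note [measurable] = coordinate_measurable[OF \<delta>(1)] coordinate_measurable[OF G.m_closed[OF \<sigma>(1) \<delta>(1)]] Ew(1)
    have A: "?A \<in> sets W" by measurable
    have lower: "q \<le> measure W (?U' \<inter> ?A)"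
      unfolding q_def using F(2)[of "\<sigma> \<otimes> \<delta>" \<delta> Ew] \<delta> \<sigma>(1) Ew by simp
    let ?N = "{x \<in> space W. act (bs b g) x \<in> V \<longleftrightarrow> x \<notin> V}"
    have hbg: "bs b g \<in> carrier H" and shg: "sh g \<in> carrier H" using b g by simp_all
    have N: "?N \<in> sets W"
    proof -
      note [measurable] = act_measurable[OF hbg] V
      show ?thesis by measurable
    qed
    have upper: "measure W (act (sh g) -` ?N \<inter> space W) \<le> q / 2"
      using measure_mp_maps[OF act_mp[OF shg] N] F'(2)[of g b] g b by simp
    have "measure W (?U' \<inter> ?A) = measure W (Sm -` (?U' \<inter> ?A) \<inter> space W)"
      by (rule measure_mp_maps[OF Sm_mp, symmetric]) (use U' A in blast)
    also have "\<dots> \<le> measure W (act (sh g) -` ?N \<inter> space W)"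
    proof (rule W.finite_measure_mono_AE)
      show "act (sh g) -` ?N \<inter> space W \<in> sets W" by (rule vimage_act_sets[OF shg N])
      have eqv: "AE x in W. Sm (act (sh g) x) = act (\<rho> g) (Sm x)" by (rule Sm_equivariant[OF g(1)])
      \<comment> \<open>Where the return element is s, the value of \<open>Sm x\<close> at
        \<open>\<sigma> \<otimes> \<delta>\<close> is the value of \<open>Sm\<close> of the changed
        point at \<delta>. After the shift by g, the set V separates two points that differ at most
        at g.\<close>
      show "AE x in W. x \<in> Sm -` (?U' \<inter> ?A) \<inter> space W \<longrightarrow> x \<in> act (sh g) -` ?N \<inter> space W"
        using eqv AE_mp_maps[OF act_mp[OF hb] eqv] Si_Sm AE_ret_Sm[OF hb] AE_space
      proof eventually_elim
        case (elim x)
        show ?case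
        proof
          assume "x \<in> Sm -` (?U' \<inter> ?A) \<inter> space W"
          then have x: "x \<in> space W" "C (Si (Sm x)) = s" "Sm x (\<sigma> \<otimes> \<delta>) \<in> Ew" "Sm x \<delta> \<notin> Ew" by auto
          let ?y = "act (bs b e) x"
          have yW: "?y \<in> space W" using hb x by simp
          have V_iff: "act (sh g) z \<in> V \<longleftrightarrow> Sm z \<delta> \<in> Ew"
            if z: "z \<in> space W" "Sm (act (sh g) z) = act (\<rho> g) (Sm z)" for z
          proof -
            have "Sm (act (sh g) z) e = \<beta> w (Sm z \<delta>)"
              using z g \<delta>(1) by (simp add: act_apply w_def \<delta>_def \<phi>_def)
            then show ?thesis using z shg W_mem[OF Sm_space[OF z(1)] \<delta>(1)] by (simp add: V_def Ew_def)
          qed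
          have "C x = s" using x(2) elim(3) by simp
          then have "act s (Sm x) = Sm ?y" using elim(4) by (simp add: C_def)
          moreover have "act s (Sm x) \<delta> = Sm x (\<sigma> \<otimes> \<delta>)"
            using \<delta> \<sigma>(1) s(1) x(1) by (simp add: act_apply \<beta>_one W_mem \<sigma>_def)
          ultimately have "Sm ?y \<delta> \<in> Ew" using x(3) by simp
          then have "act (sh g) ?y \<in> V" using V_iff[OF yW elim(2)] by simp
          moreover have "act (sh g) ?y = act (bs b g) (act (sh g) x)"
            using sh_bs[OF g(1) G.one_closed b] g(1) b x(1) by (simp flip: act_mult)
          moreover have "act (sh g) x \<notin> V" using V_iff[OF x(1) elim(1)] x(4) by simp
          ultimately show "x \<in> act (sh g) -` ?N \<inter> space W" using x(1) shg by simp
        qed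
      qed
    qed
    also have "\<dots> \<le> q / 2" by (rule upper)
    finally show False using lower q by simp
  qed
  then have "AE x in W. x \<notin> ?U" using U W.prob_eq_0 by blast
  then show ?thesis using AE_space by eventually_elim (auto simp: C_def)
qed

lemma S_refl: "x \<in> space W \<Longrightarrow> (x, x) \<in> S"
  by (auto simp: S_iff intro!: bexI[of _ "\<one>\<^bsub>H\<^esub>"])

lemma S_trans: "(x, y) \<in> S \<Longrightarrow> (y, z) \<in> S \<Longrightarrow> (x, z) \<in> S"
proof -
  assume "(x, y) \<in> S" "(y, z) \<in> S"
  then obtain h k where "h \<in> carrier H" "snd h = e" "y = act h x" "x \<in> space W"
    "k \<in> carrier H" "snd k = e" "z = act k y" by (auto simp: S_iff)
  then show "(x, z) \<in> S" by (auto simp: S_iff act_mult intro!: bexI[of _ "k \<otimes>\<^bsub>H\<^esub> h"])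
qed

text \<open>At e, locality discards the countably many return elements with nontrivial \<Gamma>-part
  one by one. Shifts carry the result to c, because S is invariant under
  \<open>\<rho> c\<close>.\<close>

lemma Sm_bs:
  assumes b: "b \<in> carrier B" and c: "c \<in> carrier G"
  shows "AE x in W. (Sm x, Sm (act (bs b c) x)) \<in> S"
proof -
  have hb: "bs b e \<in> carrier H" using b by simp
  have "AE x in W. \<forall>s\<in>carrier H. snd s \<noteq> e \<longrightarrow> ret (Sm (act (bs b e) x)) (Sm x) \<noteq> s"
    by (rule AE_ball_countable'[OF _ countable_H]) (use locality_null[OF b] in auto)
  then have at_e: "AE x in W. (Sm x, Sm (act (bs b e) x)) \<in> S"
    using AE_ret_Sm[OF hb] AE_space
  proof eventually_elim
    case (elim x)
    let ?r = "ret (Sm (act (bs b e) x)) (Sm x)"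
    have "snd ?r = e" using elim(1) ret_closed by blast
    then show ?case using elim Sm_space ret_closed unfolding S_iff by metis
  qed
  let ?g = "inv c"
  have shg: "sh ?g \<in> carrier H" and shc: "sh c \<in> carrier H" using c by simp_all
  note mp = AE_mp_maps[OF act_mp[OF shg]]
  show ?thesis
    using mp[OF at_e] mp[OF Sm_equivariant[OF c]] mp[OF AE_mp_maps[OF act_mp[OF hb] Sm_equivariant[OF c]]] AE_space
  proof eventually_elim
    case (elim x)
    let ?x = "act (sh ?g) x"
    have x': "?x \<in> space W" using elim(4) shg by simp
    have cx: "act (sh c) ?x = x" using c elim(4) by (simp add: sh_inv)
    have "act (sh c) (act (bs b e) ?x) = act (bs b c) (act (sh c) ?x)"
      using sh_bs[OF c G.one_closed b] c b x' by (simp flip: act_mult)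
    then have "act (sh c) (act (bs b e) ?x) = act (bs b c) x" using cx by simp
    moreover have "(act (\<rho> c) (Sm ?x), act (\<rho> c) (Sm (act (bs b e) ?x))) \<in> S"
      by (rule S_act_iff[THEN iffD1]) (use elim(1) x' hb c in auto)
    ultimately show ?case using elim(2,3) cx by simp
  qed
qed

text \<open>An element of the direct sum is a finite product of changes of single coordinates; the
  induction takes one coordinate out of the support at a time.\<close>

lemma Sm_sum:
  assumes "h \<in> carrier H" "snd h = e"
  shows "AE x in W. (Sm x, Sm (act h x)) \<in> S"
  using assms
proof (induction "card (supp (fst h))" arbitrary: h)
  case 0
  then have "supp (fst h) = {}" using finite_supp by simp
  then have "h = \<one>\<^bsub>H\<^esub>" using 0 by (intro H_eqI) (auto simp: supp_def)
  then show ?case by (auto intro!: AE_I2 S_refl)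
next
  case (Suc n)
  then have "supp (fst h) \<noteq> {}" by auto
  then obtain d where d: "d \<in> carrier G" "d \<in> supp (fst h)" by (auto simp: supp_def)
  define b where "b = fst h d"
  have b: "b \<in> carrier B" using d Suc by (simp add: b_def)
  define k where "k = inv\<^bsub>H\<^esub> (bs b d) \<otimes>\<^bsub>H\<^esub> h"
  have kH: "k \<in> carrier H" "snd k = e" using Suc b by (simp_all add: k_def)
  have h: "h = bs b d \<otimes>\<^bsub>H\<^esub> k" using Suc b by (simp add: k_def flip: H.m_assoc)
  have fst_k: "fst h c = fst (bs b d) c \<otimes>\<^bsub>B\<^esub> fst k c" if "c \<in> carrier G" for c
    using h that b kH by (simp add: fst_mult_H)
  have "fst k c = (if c = d then \<one>\<^bsub>B\<^esub> else fst h c)" if "c \<in> carrier G" for c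
    using fst_k[OF that] that b kH by (auto simp: b_def[symmetric] B.r_cancel_one')
  then have "supp (fst k) = supp (fst h) - {d}" by (auto simp: supp_def split: if_splits)
  then have "card (supp (fst k)) = n" using Suc(2) d finite_supp[OF Suc(3)] by simp
  then have IH: "AE x in W. (Sm x, Sm (act k x)) \<in> S" using Suc(1) kH by blast
  show ?case
    using IH AE_mp_maps[OF act_mp[OF kH(1)] Sm_bs[OF b d(1)]] AE_space
  proof eventually_elim
    case (elim x)
    have "act h x = act (bs b d) (act k x)"
      by (subst h) (rule act_mult[OF bs_closed[OF b] kH(1) elim(3)])
    then show ?case using S_trans[OF elim(1,2)] by simp
  qed
qed

lemma Sm_act:
  "AE x in W. \<forall>h\<in>carrier H. (act (\<rho> (snd h)) (Sm x), Sm (act h x)) \<in> S"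
proof (rule AE_ball_countable'[OF _ countable_H])
  fix h assume h: "h \<in> carrier H"
  let ?g = "snd h" and ?k = "h \<otimes>\<^bsub>H\<^esub> inv\<^bsub>H\<^esub> (sh (snd h))"
  have g: "?g \<in> carrier G" and k: "?k \<in> carrier H" "snd ?k = e" using h by simp_all
  show "AE x in W. (act (\<rho> (snd h)) (Sm x), Sm (act h x)) \<in> S"
    using Sm_equivariant[OF g] AE_mp_maps[OF act_mp[OF sh_closed[OF g]] Sm_sum[OF k]] AE_space
  proof eventually_elim
    case (elim x)
    have "act ?k (act (sh ?g) x) = act h x" using h g elim(3) by (simp add: act_mult)
    then show ?case using elim by simp
  qed
qed

text \<open>For the converse direction, x and y are at least in one orbit, say y = h x. Freeness at
  \<open>Sm x\<close> identifies two elements that carry it to \<open>Sm y\<close>, so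
  \<open>\<phi> (snd h)\<close> is neutral, and \<phi> is injective.\<close>

lemma Sm_preserves_S: "ae_preserves W S Sm"
proof -
  obtain P where P: "AE x in W. P x" "\<And>x y. P x \<Longrightarrow> P y \<Longrightarrow> (x, y) \<in> R \<longleftrightarrow> (Sm x, Sm y) \<in> R"
    using Sm_preserves_R unfolding ae_preserves_def by blast
  let ?Q = "\<lambda>x. P x \<and> Sm x \<in> free_part \<and> (\<forall>h\<in>carrier H. (act (\<rho> (snd h)) (Sm x), Sm (act h x)) \<in> S)"
  have "AE x in W. ?Q x"
    using P(1) AE_Sm[OF AE_free_part] Sm_act by eventually_elim blast
  then show ?thesis
  proof (rule ae_preservesI)
    fix x y assume x: "?Q x" and y: "?Q y" and xW: "x \<in> space W" and yW: "y \<in> space W"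
    show "(x, y) \<in> S \<longleftrightarrow> (Sm x, Sm y) \<in> S"
    proof
      assume "(x, y) \<in> S"
      then obtain h where h: "h \<in> carrier H" "snd h = e" "y = act h x" by (auto simp: S_iff)
      then have "(act (\<rho> e) (Sm x), Sm y) \<in> S" using x by metis
      then show "(Sm x, Sm y) \<in> S" using xW by (simp add: \<rho>_one)
    next
      assume S: "(Sm x, Sm y) \<in> S"
      then obtain k where k: "k \<in> carrier H" "snd k = e" "Sm y = act k (Sm x)" by (auto simp: S_iff)
      then have "(Sm x, Sm y) \<in> R" using xW by (auto simp: R_iff)
      then have "(x, y) \<in> R" using P(2) x y by blast
      then obtain h where h: "h \<in> carrier H" "y = act h x" by (auto simp: R_iff)
      then have "(act (\<rho> (snd h)) (Sm x), Sm y) \<in> S" using x by blast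
      then obtain k' where k': "k' \<in> carrier H" "snd k' = e" "Sm y = act k' (act (\<rho> (snd h)) (Sm x))"
        by (auto simp: S_iff)
      then have "act (k' \<otimes>\<^bsub>H\<^esub> \<rho> (snd h)) (Sm x) = act k (Sm x)" using k h xW by (simp add: act_mult)
      then have "k' \<otimes>\<^bsub>H\<^esub> \<rho> (snd h) = k"
        using free_part_inj[of "Sm x"] x k k' h by simp
      then have "snd (k' \<otimes>\<^bsub>H\<^esub> \<rho> (snd h)) = e" using k by simp
      then have "\<phi> (snd h) = e" using k' h by (simp add: \<phi>_def)
      then have "snd h = e" using kernel_trivial h by simp
      then show "(x, y) \<in> S" using h xW by (auto simp: S_iff)
    qed
  qed
qed

text \<open>The inverse of \<open>Sm\<close> preserves R, so the images of y and of its shift by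
  \<eta> differ by some h; applying \<open>Sm\<close> again, freeness at y reads off
  \<open>\<phi> (snd h) = \<eta>\<close>. The conclusion mentions no point, hence almost every y is
  as good as one.\<close>

lemma \<phi>_surj: 
  assumes \<eta>: "\<eta> \<in> carrier G"
  shows "\<exists>g\<in>carrier G. \<phi> g = \<eta>"
proof -
  have sh\<eta>: "sh \<eta> \<in> carrier H" using \<eta> by simp
  obtain P where P: "AE x in W. P x" "\<And>x y. P x \<Longrightarrow> P y \<Longrightarrow> (x, y) \<in> R \<longleftrightarrow> (Si x, Si y) \<in> R"
    using ae_preserves_inverse[OF Sm_preserves_R Si] unfolding ae_preserves_def by blast
  have "AE y in W. \<exists>g\<in>carrier G. \<phi> g = \<eta>"
    using P(1) AE_mp_maps[OF act_mp[OF sh\<eta>] P(1)] Sm_Si AE_mp_maps[OF act_mp[OF sh\<eta>] Sm_Si]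
      AE_mp_maps[OF Si_mp Sm_act] AE_free_part AE_space
  proof eventually_elim
    case (elim y)
    have "(y, act (sh \<eta>) y) \<in> R" using elim(7) sh\<eta> by (auto simp: R_iff)
    then have "(Si y, Si (act (sh \<eta>) y)) \<in> R" using P(2) elim by blast
    then obtain h where h: "h \<in> carrier H" "Si (act (sh \<eta>) y) = act h (Si y)" by (auto simp: R_iff)
    then have "(act (\<rho> (snd h)) y, act (sh \<eta>) y) \<in> S" using elim(3,4,5) by metis
    then obtain k where k: "k \<in> carrier H" "snd k = e" "act (sh \<eta>) y = act k (act (\<rho> (snd h)) y)"
      by (auto simp: S_iff)
    then have "act (k \<otimes>\<^bsub>H\<^esub> \<rho> (snd h)) y = act (sh \<eta>) y" using h elim(7) by (simp add: act_mult)
    then have "k \<otimes>\<^bsub>H\<^esub> \<rho> (snd h) = sh \<eta>"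
      using free_part_inj[OF elim(6)] k h sh\<eta> by simp
    then have "snd (k \<otimes>\<^bsub>H\<^esub> \<rho> (snd h)) = \<eta>" by simp
    then have "\<phi> (snd h) = \<eta>" using k h by (simp add: \<phi>_def)
    then show ?case using h by auto
  qed
  then show ?thesis by simp
qed

lemma \<phi>_bij: "bij_betw \<phi> (carrier G) (carrier G)"
  unfolding bij_betw_def using \<phi>_inj \<phi>_surj by (auto simp: image_def)

end

lemma (in group) conj_mult:
  assumes "s \<in> carrier G" "d \<in> carrier G" "f \<in> carrier G"
  shows "s \<otimes> (d \<otimes> f) \<otimes> inv s = (s \<otimes> d \<otimes> inv s) \<otimes> (s \<otimes> f \<otimes> inv s)"
proof -
  have "inv s \<otimes> (s \<otimes> (f \<otimes> inv s)) = f \<otimes> inv s" using assms by (simp flip: m_assoc)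
  then show ?thesis using assms by (simp add: m_assoc)
qed

section \<open>Permutations of the coordinates\<close>

context wreath_pmp
begin

text \<open>With p instead of its inverse this is the inverse of \<open>aut_star\<close>; a free map
  t lets both directions share their lemmas.\<close>

definition permute :: "('g \<Rightarrow> 'g) \<Rightarrow> ('g \<Rightarrow> 'x) \<Rightarrow> 'g \<Rightarrow> 'x" where
  "permute t x = (\<lambda>d\<in>carrier G. x (t d))"

lemma aut_star_permute: "aut_star G p = permute (inv_into (carrier G) p)"
  by (auto simp: aut_star_def permute_def fun_eq_iff)

lemma permute_mp: "bij_betw t (carrier G) (carrier G) \<Longrightarrow> permute t \<in> mp_maps W"
  using mp_maps_coordinates[OF M.prob_space_axioms, of "carrier G" "\<lambda>_. id" t] mp_maps_id[of M]
  by (simp add: bernoulli_space_def permute_def[abs_def])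

lemma permute_space: "bij_betw t (carrier G) (carrier G) \<Longrightarrow> x \<in> space W \<Longrightarrow> permute t x \<in> space W"
  by (rule mp_maps_space[OF permute_mp])

lemma permute_permute:
  assumes "x \<in> space W" "\<And>d. d \<in> carrier G \<Longrightarrow> t d \<in> carrier G" "\<And>d. d \<in> carrier G \<Longrightarrow> t' (t d) = d"
  shows "permute t (permute t' x) = x"
  using assms by (intro extensionalityI[where A = "carrier G"]) (auto simp: permute_def space_W PiE_iff)

lemma permute_S:
  assumes t: "bij_betw t (carrier G) (carrier G)" and S: "(x, y) \<in> S"
  shows "(permute t x, permute t y) \<in> S"
proof -
  have xy: "x \<in> space W" "y \<in> space W" and fin: "finite {d \<in> carrier G. x d \<noteq> y d}"
    and rel: "\<And>d. d \<in> carrier G \<Longrightarrow> (x d, y d) \<in> orbit_eqrel B M \<beta>"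
    using S by (auto simp: sum_eqrel_def)
  have tG: "t d \<in> carrier G" if "d \<in> carrier G" for d using t that by (auto simp: bij_betw_def)
  have "finite {d \<in> carrier G. x (t d) \<noteq> y (t d)}"
  proof (rule finite_imageD)
    show "finite (t ` {d \<in> carrier G. x (t d) \<noteq> y (t d)})"
      by (rule finite_subset[OF _ fin]) (use tG in auto)
    show "inj_on t {d \<in> carrier G. x (t d) \<noteq> y (t d)}"
      using t by (auto simp: bij_betw_def inj_on_def)
  qed
  moreover have "{d \<in> carrier G. permute t x d \<noteq> permute t y d} = {d \<in> carrier G. x (t d) \<noteq> y (t d)}"
    by (auto simp: permute_def)
  moreover have "(permute t x d, permute t y d) \<in> orbit_eqrel B M \<beta>" if "d \<in> carrier G" for d
    using rel[OF tG[OF that]] that by (simp add: permute_def)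
  ultimately show ?thesis
    using permute_space[OF t] xy by (simp add: sum_eqrel_def)
qed

lemma ae_inverse_permute:
  assumes p: "bij_betw p (carrier G) (carrier G)"
  shows "ae_inverse W (aut_star G p) (permute p)"
proof -
  note q = bij_betw_inv_into[OF p]
  have "permute (inv_into (carrier G) p) (permute p x) = x" if "x \<in> space W" for x
    by (rule permute_permute[OF that]) (use p q in \<open>auto simp: bij_betw_def f_inv_into_f\<close>)
  moreover have "permute p (permute (inv_into (carrier G) p) x) = x" if "x \<in> space W" for x
    by (rule permute_permute[OF that]) (use p q in \<open>auto simp: bij_betw_def\<close>)
  ultimately show ?thesis
    using permute_mp[OF p] permute_mp[OF q]
    by (auto simp: ae_inverse_def aut_star_permute intro!: AE_I2)
qed

lemma permute_preserves_S:
  assumes p: "bij_betw p (carrier G) (carrier G)"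
  shows "ae_preserves W S (aut_star G p)" "ae_preserves W S (permute p)"
proof -
  note q = bij_betw_inv_into[OF p]
  show "ae_preserves W S (permute p)"
  proof (rule ae_preservesI[where P = "\<lambda>_. True"])
    fix x y assume xy: "x \<in> space W" "y \<in> space W"
    have "permute (inv_into (carrier G) p) (permute p z) = z" if "z \<in> space W" for z
      by (rule permute_permute[OF that]) (use p q in \<open>auto simp: bij_betw_def f_inv_into_f\<close>)
    then show "(x, y) \<in> S \<longleftrightarrow> (permute p x, permute p y) \<in> S"
      using permute_S[OF p, of x y] permute_S[OF q, of "permute p x" "permute p y"] xy by auto
  qed simp
  then show "ae_preserves W S (aut_star G p)"
    by (rule ae_preserves_inverse) (rule ae_inverse_sym[OF ae_inverse_permute[OF p]])
qed

lemma auto_bij: "p \<in> auto G \<Longrightarrow> bij_betw p (carrier G) (carrier G)"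
  by (auto simp: auto_def Bij_def)

lemma auto_mult: "p \<in> auto G \<Longrightarrow> g \<in> carrier G \<Longrightarrow> h \<in> carrier G \<Longrightarrow> p (g \<otimes> h) = p g \<otimes> p h"
  by (auto simp: auto_def hom_def)

lemma auto_inv:
  assumes "p \<in> auto G" "g \<in> carrier G"
  shows "p (inv g) = inv (p g)"
proof -
  have "group_hom G G p" using assms(1) by unfold_locales (simp add: auto_def)
  then show ?thesis using assms(2) by (rule group_hom.hom_inv)
qed

lemma permute_equivariant:
  assumes p: "p \<in> auto G" and g: "g \<in> carrier G" and x: "x \<in> space W"
  shows "permute p (act (sh (p g)) x) = act (sh g) (permute p x)"
proof -
  note bij = auto_bij[OF p]
  have pG: "p d \<in> carrier G" if "d \<in> carrier G" for d using bij that by (auto simp: bij_betw_def)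
  note px = permute_space[OF bij]
  show ?thesis
  proof (rule W_ext)
    fix d assume d: "d \<in> carrier G"
    have "permute p (act (sh (p g)) x) d = x (inv (p g) \<otimes> p d)"
      using d g x pG by (simp add: permute_def act_apply \<beta>_one W_mem)
    also have "\<dots> = x (p (inv g \<otimes> d))"
      using p g d by (simp add: auto_mult auto_inv)
    also have "\<dots> = act (sh g) (permute p x) d"
      using d g px[OF x] by (simp add: act_apply \<beta>_one W_mem) (simp add: permute_def)
    finally show "permute p (act (sh (p g)) x) d = act (sh g) (permute p x) d" .
  qed (use x g pG px in auto)
qed

lemma aut_star_equivariant:
  assumes p: "p \<in> auto G" and g: "g \<in> carrier G" and x: "x \<in> space W"
  shows "aut_star G p (act (sh g) x) = act (sh (p g)) (aut_star G p x)"
proof -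
  note bij = auto_bij[OF p]
  note q = bij_betw_inv_into[OF bij]
  have pg: "p g \<in> carrier G" using bij g by (auto simp: bij_betw_def)
  let ?q = "permute (inv_into (carrier G) p)"
  have 1: "?q (permute p z) = z" if "z \<in> space W" for z
    by (rule permute_permute[OF that]) (use bij q in \<open>auto simp: bij_betw_def f_inv_into_f\<close>)
  have 2: "permute p (?q z) = z" if "z \<in> space W" for z
    by (rule permute_permute[OF that]) (use bij q in \<open>auto simp: bij_betw_def\<close>)
  have qx: "?q x \<in> space W" by (rule permute_space[OF q x])
  have "permute p (act (sh (p g)) (?q x)) = act (sh g) x"
    using permute_equivariant[OF p g qx] 2[OF x] by simp
  then have "?q (act (sh g) x) = ?q (permute p (act (sh (p g)) (?q x)))" by simp
  also have "\<dots> = act (sh (p g)) (?q x)" by (rule 1) (use pg qx in simp)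
  finally show ?thesis by (simp add: aut_star_permute)
qed

text \<open>R is the union of the shift translates of S; the map carries the translate by g to the
  one by p g, and bijectivity of p makes sure that all are reached. The twist p serves equivariant
  maps, \<open>aut_star\<close> and the straightened map alike.\<close>

lemma twisted_preserves_R:
  assumes T: "T \<in> mp_maps W" and S: "ae_preserves W S T" and p: "bij_betw p (carrier G) (carrier G)"
    and eqv: "\<And>g. g \<in> carrier G \<Longrightarrow> AE x in W. T (act (sh g) x) = act (sh (p g)) (T x)"
  shows "ae_preserves W R T"
proof -
  obtain P where P: "AE x in W. P x" "\<And>x y. P x \<Longrightarrow> P y \<Longrightarrow> (x, y) \<in> S \<longleftrightarrow> (T x, T y) \<in> S"
    using S unfolding ae_preserves_def by blast
  let ?Q = "\<lambda>x. P x \<and> (\<forall>g\<in>carrier G. P (act (sh g) x) \<and> T (act (sh g) x) = act (sh (p g)) (T x))"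
  have "AE x in W. \<forall>g\<in>carrier G. P (act (sh g) x) \<and> T (act (sh g) x) = act (sh (p g)) (T x)"
  proof (rule AE_ball_countable'[OF _ countable_G])
    fix g assume g: "g \<in> carrier G"
    show "AE x in W. P (act (sh g) x) \<and> T (act (sh g) x) = act (sh (p g)) (T x)"
      using AE_mp_maps[OF act_mp[OF sh_closed[OF g]] P(1)] eqv[OF g] by eventually_elim simp
  qed
  with P(1) have "AE x in W. ?Q x" by eventually_elim simp
  then show ?thesis
  proof (rule ae_preservesI)
    fix x y assume x: "?Q x" and y: "?Q y" and xW: "x \<in> space W" and yW: "y \<in> space W"
    have "(x, y) \<in> R \<longleftrightarrow> (\<exists>g\<in>carrier G. (act (sh g) x, y) \<in> S)" using xW by (simp add: R_iff_S)
    also have "\<dots> \<longleftrightarrow> (\<exists>g\<in>carrier G. (T (act (sh g) x), T y) \<in> S)"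
      using P(2) x y by (intro bex_cong) auto
    also have "\<dots> \<longleftrightarrow> (\<exists>g\<in>carrier G. (act (sh (p g)) (T x), T y) \<in> S)"
      using x by (intro bex_cong) auto
    also have "\<dots> \<longleftrightarrow> (\<exists>g\<in>p ` carrier G. (act (sh g) (T x), T y) \<in> S)" by simp
    also have "\<dots> \<longleftrightarrow> (T x, T y) \<in> R"
      using mp_maps_space[OF T xW] p by (simp add: R_iff_S bij_betw_def)
    finally show "(x, y) \<in> R \<longleftrightarrow> (T x, T y) \<in> R" .
  qed
qed

end

section \<open>Removal of the cocycle in the direct sum\<close>

context straightened
begin

text \<open>Since \<phi> is bijective, \<Gamma> acts simply transitively on the coordinates through
  it, and the family part of \<rho> is the coboundary of a function u, though u may have infinite
  support. Finite support of each \<open>\<rho> g\<close> makes u almost invariant, hence almost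
  equal to a constant, which can be divided out.\<close>

lemma coboundary:
  "\<exists>h0\<in>carrier H. snd h0 = e \<and> (\<forall>g\<in>carrier G. h0 \<otimes>\<^bsub>H\<^esub> \<rho> g = sh (\<phi> g) \<otimes>\<^bsub>H\<^esub> h0)"
proof -
  define q where "q = inv_into (carrier G) \<phi>"
  have q: "q (\<phi> g) = g" if "g \<in> carrier G" for g
    unfolding q_def by (rule inv_into_f_f[OF \<phi>_inj that])
  have qG: "q d \<in> carrier G" "\<phi> (q d) = d" if "d \<in> carrier G" for d
  proof -
    have "d \<in> \<phi> ` carrier G" using \<phi>_surj[OF that] by auto
    then show "q d \<in> carrier G" "\<phi> (q d) = d"
      unfolding q_def by (rule inv_into_into, rule f_inv_into_f)
  qed
  \<comment> \<open>\<open>q d\<close> is the element that \<phi> sends to d, so it moves the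
    coordinate e to d: u inverts the cocycle value picked up on the way from e to d.\<close>
  define u where "u = (\<lambda>d. inv\<^bsub>B\<^esub> (fst (\<rho> (q d)) d))"
  have uB: "u d \<in> carrier B" if "d \<in> carrier G" for d
    using qG that by (simp add: u_def)
  have coc: "fst (\<rho> g) (\<phi> g \<otimes> d) = inv\<^bsub>B\<^esub> (u (\<phi> g \<otimes> d)) \<otimes>\<^bsub>B\<^esub> u d"
    if g: "g \<in> carrier G" and d: "d \<in> carrier G" for g d
  proof -
    let ?c = "\<phi> g \<otimes> d"
    have qd: "q d \<in> carrier G" "\<phi> (q d) = d" using qG d by auto
    have qc: "q ?c = g \<otimes> q d" using q[of "g \<otimes> q d"] g qd by (simp add: \<phi>_mult)
    have cG: "?c \<in> carrier G" using g d by simp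
    have "fst (\<rho> (q ?c)) ?c = fst (\<rho> g) ?c \<otimes>\<^bsub>B\<^esub> fst (\<rho> (q d)) d"
      unfolding qc using g d qd cG by (simp add: \<rho>_mult fst_mult_H flip: \<phi>_def)
    moreover have "fst (\<rho> g) ?c \<in> carrier B" "fst (\<rho> (q d)) d \<in> carrier B" using g qd d cG by simp_all
    ultimately show ?thesis using qG[OF cG] cG by (simp add: u_def B.m_assoc)
  qed
  have "finite {d \<in> carrier G. u (c \<otimes> d) \<noteq> u d}" if c: "c \<in> carrier G" for c
  proof -
    have qc: "q c \<in> carrier G" "\<phi> (q c) = c" using qG c by auto
    have "{d \<in> carrier G. u (c \<otimes> d) \<noteq> u d} \<subseteq> {d \<in> carrier G. c \<otimes> d \<in> supp (fst (\<rho> (q c)))}"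
    proof clarify
      fix d assume d: "d \<in> carrier G" and ne: "u (c \<otimes> d) \<noteq> u d"
      have cd: "c \<otimes> d \<in> carrier G" using c d by simp
      have "fst (\<rho> (q c)) (c \<otimes> d) = inv\<^bsub>B\<^esub> (u (c \<otimes> d)) \<otimes>\<^bsub>B\<^esub> u d"
        using coc[OF qc(1) d] qc(2) by simp
      also have "\<dots> \<noteq> \<one>\<^bsub>B\<^esub>"
      proof
        assume "inv\<^bsub>B\<^esub> (u (c \<otimes> d)) \<otimes>\<^bsub>B\<^esub> u d = \<one>\<^bsub>B\<^esub>"
        then have "inv\<^bsub>B\<^esub> (u d) = inv\<^bsub>B\<^esub> (u (c \<otimes> d))"
          using uB[OF d] uB[OF cd] by (intro B.inv_equality) auto
        then show False using ne uB[OF d] uB[OF cd] by (metis B.inv_inv)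
      qed
      finally show "c \<otimes> d \<in> supp (fst (\<rho> (q c)))" using cd by (simp add: supp_def)
    qed
    moreover have "finite {d \<in> carrier G. c \<otimes> d \<in> supp (fst (\<rho> (q c)))}"
      by (rule finite_translate[OF finite_supp c]) (use qc in simp)
    ultimately show ?thesis by (rule finite_subset)
  qed
  then obtain k where k: "finite {d \<in> carrier G. u d \<noteq> k}" using almost_constant by blast
  obtain d0 where "d0 \<in> carrier G" "u d0 = k" using infinite_ex[OF k] by auto
  then have kB: "k \<in> carrier B" using uB by auto
  \<comment> \<open>A constant factor on the left of u cancels in the coboundary; this one makes the
    support finite.\<close>
  define h0 where "h0 = (\<lambda>d\<in>carrier G. inv\<^bsub>B\<^esub> k \<otimes>\<^bsub>B\<^esub> u d, e)"
  have "supp (\<lambda>d\<in>carrier G. inv\<^bsub>B\<^esub> k \<otimes>\<^bsub>B\<^esub> u d) \<subseteq> {d \<in> carrier G. u d \<noteq> k}"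
    using kB by (auto simp: supp_def)
  then have "finite (supp (\<lambda>d\<in>carrier G. inv\<^bsub>B\<^esub> k \<otimes>\<^bsub>B\<^esub> u d))" using k by (rule finite_subset)
  then have h0: "h0 \<in> carrier H" using kB uB by (auto simp: h0_def carrier_H)
  have "h0 \<otimes>\<^bsub>H\<^esub> \<rho> g = sh (\<phi> g) \<otimes>\<^bsub>H\<^esub> h0" if g: "g \<in> carrier G" for g
  proof (rule H_eqI)
    fix d assume d: "d \<in> carrier G"
    let ?d = "inv (\<phi> g) \<otimes> d"
    have d': "?d \<in> carrier G" "\<phi> g \<otimes> ?d = d" using g d by simp_all
    have "fst (\<rho> g) d = inv\<^bsub>B\<^esub> (u d) \<otimes>\<^bsub>B\<^esub> u ?d" using coc[OF g d'(1)] d'(2) by simp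
    moreover have "inv\<^bsub>B\<^esub> k \<otimes>\<^bsub>B\<^esub> u d \<otimes>\<^bsub>B\<^esub> (inv\<^bsub>B\<^esub> (u d) \<otimes>\<^bsub>B\<^esub> u ?d) = inv\<^bsub>B\<^esub> k \<otimes>\<^bsub>B\<^esub> u ?d"
    proof -
      have "u d \<otimes>\<^bsub>B\<^esub> (inv\<^bsub>B\<^esub> (u d) \<otimes>\<^bsub>B\<^esub> u ?d) = u ?d"
        using uB[OF d] uB[OF d'(1)] by (simp flip: B.m_assoc)
      then show ?thesis using kB uB[OF d] uB[OF d'(1)] by (simp add: B.m_assoc)
    qed
    moreover have "fst (h0 \<otimes>\<^bsub>H\<^esub> \<rho> g) d = inv\<^bsub>B\<^esub> k \<otimes>\<^bsub>B\<^esub> u d \<otimes>\<^bsub>B\<^esub> fst (\<rho> g) d"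
      using fst_mult_H[OF h0 d, of "\<rho> g"] d by (simp add: h0_def)
    moreover have "fst (sh (\<phi> g) \<otimes>\<^bsub>H\<^esub> h0) d = inv\<^bsub>B\<^esub> k \<otimes>\<^bsub>B\<^esub> u ?d"
      using g d d'(1) kB uB[OF d'(1)] by (simp add: fst_mult_H h0_def)
    ultimately show "fst (h0 \<otimes>\<^bsub>H\<^esub> \<rho> g) d = fst (sh (\<phi> g) \<otimes>\<^bsub>H\<^esub> h0) d" by simp
  next
    have "snd h0 = e" by (simp add: h0_def)
    then show "snd (h0 \<otimes>\<^bsub>H\<^esub> \<rho> g) = snd (sh (\<phi> g) \<otimes>\<^bsub>H\<^esub> h0)"
      using g h0 by (simp add: \<phi>_def)
  qed (use g h0 in simp_all)
  then show ?thesis using h0 by (intro bexI[of _ h0]) (simp_all add: h0_def)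
qed

lemma straightened_decomposition:
  "\<exists>p\<in>auto G. \<exists>D K. D \<in> mp_autos W \<and> ae_preserves W S D \<and>
     (\<forall>g\<in>carrier G. AE x in W. D (act (sh g) x) = act (sh g) (D x)) \<and>
     K \<in> mp_autos W \<and> (AE x in W. (K x, x) \<in> R) \<and> (AE x in W. T x = aut_star G p (D (K x)))"
proof -
  obtain h0 where h0: "h0 \<in> carrier H" "snd h0 = e"
    "\<And>g. g \<in> carrier G \<Longrightarrow> h0 \<otimes>\<^bsub>H\<^esub> \<rho> g = sh (\<phi> g) \<otimes>\<^bsub>H\<^esub> h0"
    using coboundary by blast
  define S1 where "S1 = act h0 \<circ> Sm"
  define S1i where "S1i = Si \<circ> act (inv\<^bsub>H\<^esub> h0)"
  have S1: "ae_inverse W S1 S1i"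
    unfolding S1_def S1i_def by (rule ae_inverse_comp[OF act_ae_inverse[OF h0(1)] Si])
  have S1_mp: "S1 \<in> mp_maps W" "S1i \<in> mp_maps W" "AE x in W. S1i (S1 x) = x" "AE x in W. S1 (S1i x) = x"
    using S1 by (auto simp: ae_inverse_def)
  have S1_S: "ae_preserves W S S1"
    unfolding S1_def
    by (rule ae_preserves_comp[OF _ Sm_preserves_S Sm_mp], rule ae_preservesI[where P = "\<lambda>_. True"])
      (use S_act_iff[OF h0(1)] in auto)
  have S1_eqv: "AE x in W. S1 (act (sh g) x) = act (sh (\<phi> g)) (S1 x)" if g: "g \<in> carrier G" for g
    using Sm_equivariant[OF g] AE_space
  proof eventually_elim
    case (elim x)
    have "act h0 (act (\<rho> g) (Sm x)) = act (h0 \<otimes>\<^bsub>H\<^esub> \<rho> g) (Sm x)"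
      using act_mult[OF h0(1) \<rho>_closed[OF g] Sm_space[OF elim(2)]] by simp
    also have "\<dots> = act (sh (\<phi> g)) (act h0 (Sm x))"
      unfolding h0(3)[OF g] using g h0(1) elim(2) by (intro act_mult) auto
    finally show ?case using elim(1) by (simp add: S1_def)
  qed
  have T_R_S1: "AE x in W. (S1 x, T x) \<in> R"
  proof (rule AE_I2)
    fix x assume x: "x \<in> space W"
    have "(Sm x, S1 x) \<in> R" using x h0(1) by (auto simp: S1_def R_iff)
    then show "(S1 x, T x) \<in> R" using Sm_T_R[OF x] equiv_R by (meson equiv_def symE transE)
  qed
  have S1_R: "ae_preserves W R S1"
    by (rule twisted_preserves_R[OF S1_mp(1) S1_S \<phi>_bij S1_eqv])
  \<comment> \<open>Members of \<open>auto\<close> are extensional, hence the restriction.\<close>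
  define p where "p = restrict \<phi> (carrier G)"
  have p_eq: "p g = \<phi> g" if "g \<in> carrier G" for g using that by (simp add: p_def)
  have p: "p \<in> auto G"
  proof -
    have "bij_betw p (carrier G) (carrier G)"
      using \<phi>_bij bij_betw_cong[of "carrier G" p \<phi>] p_eq by auto
    then show ?thesis by (auto simp: auto_def Bij_def hom_def p_eq \<phi>_mult) (simp add: p_def)
  qed
  note bij = auto_bij[OF p]
  note star = ae_inverse_permute[OF bij]
  have star': "AE x in W. aut_star G p (permute p x) = x" "permute p \<in> mp_maps W"
    using star by (auto simp: ae_inverse_def)
  \<comment> \<open>\<open>S1\<close> is equivariant up to \<phi>, and \<open>permute p\<close>
    undoes this twist. \<open>K\<close> is the discrepancy between \<open>T\<close> and
    \<open>S1\<close>; it stays inside orbits, because \<open>S1 x\<close> and \<open>T x\<close>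
    are related and \<open>S1i\<close> preserves R.\<close>
  define D where "D = permute p \<circ> S1"
  define K where "K = S1i \<circ> T"
  have D_auto: "D \<in> mp_autos W"
    unfolding D_def using ae_inverse_autos[OF star] ae_inverse_autos[OF S1] by (intro mp_autos_comp)
  have K_auto: "K \<in> mp_autos W"
    unfolding K_def using ae_inverse_autos[OF TT'] ae_inverse_autos[OF S1] by (intro mp_autos_comp)
  have D_S: "ae_preserves W S D"
    unfolding D_def by (rule ae_preserves_comp[OF permute_preserves_S(2)[OF bij] S1_S S1_mp(1)])
  have D_eqv: "AE x in W. D (act (sh g) x) = act (sh g) (D x)" if g: "g \<in> carrier G" for g
    using S1_eqv[OF g] AE_space
  proof eventually_elim
    case (elim x)
    then show ?case
      using permute_equivariant[OF p g mp_maps_space[OF S1_mp(1) elim(2)]] g by (simp add: D_def p_eq)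
  qed
  have K_R: "AE x in W. (K x, x) \<in> R"
  proof -
    obtain P where P: "AE x in W. P x" "\<And>x y. P x \<Longrightarrow> P y \<Longrightarrow> (x, y) \<in> R \<longleftrightarrow> (S1i x, S1i y) \<in> R"
      using ae_preserves_inverse[OF S1_R S1] unfolding ae_preserves_def by blast
    have sym: "sym R" using equiv_R by (simp add: equiv_def)
    show ?thesis
      using AE_mp_maps[OF S1_mp(1) P(1)] AE_mp_maps[OF T_mp P(1)] T_R_S1 S1_mp(3)
    proof eventually_elim
      case (elim x)
      then have "(S1i (S1 x), S1i (T x)) \<in> R" using P(2) by blast
      then show ?case using elim(4) symD[OF sym] by (simp add: K_def)
    qed
  qed
  have T_eq: "AE x in W. T x = aut_star G p (D (K x))"
    using AE_mp_maps[OF T_mp S1_mp(4)] AE_mp_maps[OF T_mp AE_mp_maps[OF S1_mp(2) AE_mp_maps[OF S1_mp(1) star'(1)]]]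
    by eventually_elim (simp add: D_def K_def)
  show ?thesis
    using p D_auto D_S D_eqv K_auto K_R T_eq by blast
qed

end

section \<open>The product decomposition and normality\<close>

context wreath_rigid
begin

text \<open>The return elements of \<open>T\<close> along the shifts satisfy the cocycle identity
  because \<open>T x\<close> lies in the free part for almost every x; superrigidity with target H
  then supplies f and \<rho>.\<close>

lemma straighten:
  assumes TT': "ae_inverse W T T'" and T_R: "ae_preserves W R T"
  shows "\<exists>f \<rho>. straightened G B M \<beta> T T' f \<rho>"
proof -
  have T: "T \<in> mp_maps W" using TT' by (simp add: ae_inverse_def)
  define c where "c = (\<lambda>g x. ret (T (act (sh g) x)) (T x))"
  have cH: "c g x \<in> carrier H" for g x by (simp add: c_def)
  obtain P where P: "AE x in W. P x" "\<And>x y. P x \<Longrightarrow> P y \<Longrightarrow> (x, y) \<in> R \<longleftrightarrow> (T x, T y) \<in> R"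
    using T_R unfolding ae_preserves_def by blast
  have act_c: "AE x in W. T x \<in> free_part \<and> act (c g x) (T x) = T (act (sh g) x)" if g: "g \<in> carrier G" for g
    using P(1) AE_mp_maps[OF act_mp[OF sh_closed[OF g]] P(1)] AE_mp_maps[OF T AE_free_part] AE_space
  proof eventually_elim
    case (elim x)
    have "(x, act (sh g) x) \<in> R" using elim(4) g by (auto simp: R_iff)
    then have "(T x, T (act (sh g) x)) \<in> R" using P(2) elim(1,2) by blast
    then show ?case using elim(3) act_ret by (simp add: c_def)
  qed
  have meas: "c g \<in> measurable W (count_space (carrier H))" if g: "g \<in> carrier G" for g
    unfolding c_def
    by (rule ret_measurable[OF measurable_compose[OF act_measurable[OF sh_closed[OF g]] mp_mapsD(1)[OF T]] mp_mapsD(1)[OF T]])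
  have coc: "AE x in W. c (g1 \<otimes> g0) x = c g1 (act (sh g0) x) \<otimes>\<^bsub>H\<^esub> c g0 x"
    if g: "g0 \<in> carrier G" "g1 \<in> carrier G" for g0 g1
    using act_c[OF G.m_closed[OF g(2,1)]] AE_mp_maps[OF act_mp[OF sh_closed[OF g(1)]] act_c[OF g(2)]]
      act_c[OF g(1)] AE_space
  proof eventually_elim
    case (elim x)
    have TW: "T x \<in> space W" using elim(1) free_part_space by blast
    have "act (c g1 (act (sh g0) x) \<otimes>\<^bsub>H\<^esub> c g0 x) (T x) = act (c (g1 \<otimes> g0) x) (T x)"
      using elim g TW cH by (simp add: act_mult sh_mult)
    then show ?case using elim(1) cH by (intro free_part_inj[of "T x"]) auto
  qed
  obtain \<rho> f where \<rho>: "\<rho> \<in> hom G H" and f: "f \<in> measurable W (count_space (carrier H))"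
    and cf: "\<And>g. g \<in> carrier G \<Longrightarrow> AE x in W. c g x = f (act (sh g) x) \<otimes>\<^bsub>H\<^esub> \<rho> g \<otimes>\<^bsub>H\<^esub> inv\<^bsub>H\<^esub> f x"
    by (rule superrigidE[OF group_H countable_H meas coc]) (assumption | rule that)+
  have fH: "f x \<in> carrier H" if "x \<in> space W" for x using measurable_space[OF f that] by simp
  have "AE x in W. act (inv\<^bsub>H\<^esub> f (act (sh g) x)) (T (act (sh g) x)) = act (\<rho> g) (act (inv\<^bsub>H\<^esub> f x) (T x))"
    if g: "g \<in> carrier G" for g
    using cf[OF g] act_c[OF g] AE_space
  proof eventually_elim
    case (elim x)
    have \<rho>g: "\<rho> g \<in> carrier H" using \<rho> g by (auto simp: hom_def)
    have TW: "T x \<in> space W" using elim(2) free_part_space by blast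
    have f1: "f x \<in> carrier H" and f2: "f (act (sh g) x) \<in> carrier H" using fH elim(3) g by auto
    have "T (act (sh g) x) = act (f (act (sh g) x) \<otimes>\<^bsub>H\<^esub> \<rho> g \<otimes>\<^bsub>H\<^esub> inv\<^bsub>H\<^esub> f x) (T x)"
      using elim(1,2) by simp
    also have "\<dots> = act (f (act (sh g) x)) (act (\<rho> g) (act (inv\<^bsub>H\<^esub> f x) (T x)))"
      using f1 f2 \<rho>g TW by (simp add: act_mult)
    finally show ?case using f1 f2 \<rho>g TW by simp
  qed
  then have "straightened G B M \<beta> T T' f \<rho>"
    by (intro straightened.intro wreath_rigid_axioms straightened_axioms.intro TT' T_R f \<rho>)
  then show ?thesis by blast
qed

lemma decomposition:
  assumes "T \<in> mp_autos W" "ae_preserves W R T"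
  obtains p D K where "p \<in> auto G" "D \<in> mp_autos W" "ae_preserves W S D"
    "\<And>g. g \<in> carrier G \<Longrightarrow> AE x in W. D (act (sh g) x) = act (sh g) (D x)"
    "K \<in> mp_autos W" "AE x in W. (K x, x) \<in> R" "AE x in W. T x = aut_star G p (D (K x))"
proof -
  obtain T' where T': "ae_inverse W T T'" using assms(1) mp_autos_iff by blast
  obtain f \<rho> where st: "straightened G B M \<beta> T T' f \<rho>" using straighten[OF T' assms(2)] by blast
  show ?thesis using straightened.straightened_decomposition[OF st] that by blast
qed

abbreviation "Dsub \<equiv> Aut_rel_equivariant G W (bernoulli_shift G M) S"

lemma shift_mp: "g \<in> carrier G \<Longrightarrow> bernoulli_shift G M g \<in> mp_maps W"
  by (simp add: shift_eq_act act_mp)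

lemma Dsub_iff:
  assumes "T \<in> mp_autos W"
  shows "ae_class W T \<in> Dsub \<longleftrightarrow> ae_preserves W S T \<and>
    (\<forall>g\<in>carrier G. AE x in W. T (act (sh g) x) = act (sh g) (T x))"
  using Aut_rel_equivariant_iff[of T W G "bernoulli_shift G M" S] assms shift_mp by (simp add: shift_eq_act)

lemma Dsub_cases:
  assumes "A \<in> Dsub"
  obtains T where "A = ae_class W T" "T \<in> mp_autos W" "ae_preserves W S T"
    "\<And>g. g \<in> carrier G \<Longrightarrow> AE x in W. T (act (sh g) x) = act (sh g) (T x)"
  using assms that unfolding Aut_rel_equivariant_eq by (auto simp: shift_eq_act)

lemma Dsub_subset: "Dsub \<subseteq> Aut_rel W R"
proof
  fix A assume "A \<in> Dsub"
  then obtain T where T: "A = ae_class W T" "T \<in> mp_autos W" "ae_preserves W S T"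
    "\<And>g. g \<in> carrier G \<Longrightarrow> AE x in W. T (act (sh g) x) = act (sh g) (T x)"
    by (rule Dsub_cases) (rule that; assumption)
  have "ae_preserves W R T"
    by (rule twisted_preserves_R[OF mp_autos_maps[OF T(2)] T(3), where p = "\<lambda>g. g"])
      (use T(4) in \<open>auto simp: bij_betw_def\<close>)
  then show "A \<in> Aut_rel W R" using T(1,2) by (simp add: Aut_rel_iff)
qed

lemma Aut_star_subset: "Aut_star G M \<subseteq> Aut_rel W R"
proof
  fix A assume "A \<in> Aut_star G M"
  then obtain p where p: "p \<in> auto G" "A = ae_class W (aut_star G p)" by (auto simp: Aut_star_def)
  note bij = auto_bij[OF p(1)]
  note star = ae_inverse_permute[OF bij]
  have "ae_preserves W R (aut_star G p)"
    by (rule twisted_preserves_R[OF _ permute_preserves_S(1)[OF bij] bij])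
      (use star p(1) aut_star_equivariant in \<open>auto simp: ae_inverse_def intro!: AE_I2\<close>)
  then show "A \<in> Aut_rel W R" using p(2) ae_inverse_autos[OF star] by (simp add: Aut_rel_iff)
qed

text \<open>The conjugate commutes with the shift by g because the conjugated map commutes with the
  shift by the preimage of g under p, and p is onto.\<close>

lemma Aut_star_conj_Dsub:
  assumes "s \<in> Aut_star G M" "d \<in> Dsub"
  shows "s \<otimes>\<^bsub>Aut_mp W\<^esub> d \<otimes>\<^bsub>Aut_mp W\<^esub> inv\<^bsub>Aut_mp W\<^esub> s \<in> Dsub"
proof -
  obtain p where p: "p \<in> auto G" "s = ae_class W (aut_star G p)" using assms(1) by (auto simp: Aut_star_def)
  obtain T where T: "d = ae_class W T" "T \<in> mp_autos W" "ae_preserves W S T"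
    "\<And>g. g \<in> carrier G \<Longrightarrow> AE x in W. T (act (sh g) x) = act (sh g) (T x)"
    using assms(2) by (rule Dsub_cases) (rule that; assumption)
  note bij = auto_bij[OF p(1)]
  note star = ae_inverse_permute[OF bij]
  note autos = ae_inverse_autos[OF star]
  let ?C = "aut_star G p \<circ> T \<circ> permute p"
  have C: "?C \<in> mp_autos W" using autos T(2) by (intro mp_autos_comp)
  have "ae_preserves W S ?C"
    using permute_preserves_S[OF bij] T(3) autos T(2)
    by (intro ae_preserves_comp mp_autos_maps) auto
  moreover have "AE x in W. ?C (act (sh g) x) = act (sh g) (?C x)" if g: "g \<in> carrier G" for g
  proof -
    have "g \<in> p ` carrier G" using bij g by (simp add: bij_betw_def)
    then obtain k where k: "k \<in> carrier G" "p k = g" by auto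
    show ?thesis
      using AE_mp_maps[OF permute_mp[OF bij] T(4)[OF k(1)]] AE_space
    proof eventually_elim
      case (elim x)
      have "permute p (act (sh g) x) = act (sh k) (permute p x)"
        using permute_equivariant[OF p(1) k(1) elim(2)] k by simp
      moreover have "T (permute p x) \<in> space W"
        by (intro mp_maps_space[OF mp_autos_maps[OF T(2)]] permute_space[OF bij] elim(2))
      ultimately show ?case using elim(1) aut_star_equivariant[OF p(1) k(1)] k by simp
    qed
  qed
  ultimately have "ae_class W ?C \<in> Dsub" using Dsub_iff[OF C] by blast
  moreover have "s \<otimes>\<^bsub>Aut_mp W\<^esub> d \<otimes>\<^bsub>Aut_mp W\<^esub> inv\<^bsub>Aut_mp W\<^esub> s = ae_class W ?C"
    unfolding p T inv_Aut_mp[OF star] using autos T(2) by (simp add: mult_Aut_mp mp_autos_comp)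
  ultimately show ?thesis by simp
qed

lemma Aut_rel_factor:
  assumes "a \<in> Aut_rel W R"
  shows "\<exists>s\<in>Aut_star G M. \<exists>d\<in>Dsub. \<exists>k\<in>full_group W R. a = s \<otimes>\<^bsub>Aut_mp W\<^esub> (d \<otimes>\<^bsub>Aut_mp W\<^esub> k)"
proof -
  obtain T where T: "T \<in> mp_autos W" "ae_preserves W R T" "a = ae_class W T"
    using assms by (auto simp: Aut_rel_eq)
  obtain p D K where p: "p \<in> auto G" and D: "D \<in> mp_autos W" "ae_preserves W S D"
    "\<And>g. g \<in> carrier G \<Longrightarrow> AE x in W. D (act (sh g) x) = act (sh g) (D x)"
    and K: "K \<in> mp_autos W" "AE x in W. (K x, x) \<in> R" and eq: "AE x in W. T x = aut_star G p (D (K x))"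
    by (rule decomposition[OF T(1,2)]) (rule that; assumption)
  note autos = ae_inverse_autos[OF ae_inverse_permute[OF auto_bij[OF p]]]
  have "a = ae_class W (aut_star G p \<circ> (D \<circ> K))"
    unfolding T(3) using eq T(1) autos D(1) K(1) by (subst ae_class_eq_iff) (auto intro!: mp_autos_comp)
  also have "\<dots> = ae_class W (aut_star G p) \<otimes>\<^bsub>Aut_mp W\<^esub> (ae_class W D \<otimes>\<^bsub>Aut_mp W\<^esub> ae_class W K)"
    using autos D(1) K(1) by (simp add: mult_Aut_mp mp_autos_comp)
  finally show ?thesis
    using p D Dsub_iff[OF D(1)] full_group_iff[OF K(1)] K(2) unfolding Aut_star_def by blast
qed

text \<open>Normality is tested on the two factors of an element: conjugation by a member of the
  subgroup stays inside it, and \<open>Aut_star\<close> normalises \<open>Dsub\<close> and the full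
  group separately.\<close>

lemma Aut_rel_product:
  "Aut_rel W R = Aut_star G M <#>\<^bsub>Aut_mp W\<^esub> (Dsub <#>\<^bsub>Aut_mp W\<^esub> full_group W R)"
  "(Dsub <#>\<^bsub>Aut_mp W\<^esub> full_group W R) \<lhd> (Aut_mp W\<lparr>carrier := Aut_rel W R\<rparr>)"
proof -
  interpret Q: group "Aut_mp W" by (rule group_Aut_mp)
  let ?A = "Aut_mp W\<lparr>carrier := Aut_rel W R\<rparr>" and ?F = "full_group W R"
  note sub = subgroup_Aut_rel[of W R]
  interpret A: group ?A by (rule Q.subgroup_imp_group[OF sub])
  have F: "?F \<lhd> ?A" by (rule normal_full_group[OF equiv_R])
  have "subgroup Dsub (Aut_mp W)" by (rule subgroup_Aut_rel_equivariant) (rule shift_mp)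
  then have D: "subgroup Dsub ?A" by (rule Q.subgroup_incl[OF _ sub Dsub_subset])
  let ?K = "Dsub <#>\<^bsub>?A\<^esub> ?F"
  have K_eq: "Dsub <#>\<^bsub>Aut_mp W\<^esub> ?F = ?K" by (simp add: set_mult_def)
  have K: "subgroup ?K ?A"
    unfolding A.commut_normal[OF D F] by (rule A.mult_norm_subgroup[OF F D])
  have St: "Aut_star G M \<subseteq> carrier ?A" using Aut_star_subset by simp
  have factor: "\<exists>s\<in>Aut_star G M. \<exists>k\<in>?K. a = s \<otimes>\<^bsub>?A\<^esub> k" if a: "a \<in> carrier ?A" for a
  proof -
    obtain s d k where "s \<in> Aut_star G M" "d \<in> Dsub" "k \<in> ?F" "a = s \<otimes>\<^bsub>?A\<^esub> (d \<otimes>\<^bsub>?A\<^esub> k)"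
      using Aut_rel_factor[of a] a by auto
    moreover from this have "d \<otimes>\<^bsub>?A\<^esub> k \<in> ?K" by (auto simp: set_mult_def)
    ultimately show ?thesis by blast
  qed
  have "Aut_rel W R = Aut_star G M <#>\<^bsub>?A\<^esub> ?K"
  proof
    show "Aut_rel W R \<subseteq> Aut_star G M <#>\<^bsub>?A\<^esub> ?K"
    proof
      fix a assume "a \<in> Aut_rel W R"
      then obtain s k where "s \<in> Aut_star G M" "k \<in> ?K" "a = s \<otimes>\<^bsub>?A\<^esub> k" using factor[of a] by auto
      then show "a \<in> Aut_star G M <#>\<^bsub>?A\<^esub> ?K" unfolding set_mult_def by blast
    qed
    have "Aut_star G M <#>\<^bsub>?A\<^esub> ?K \<subseteq> carrier ?A"
      by (rule A.set_mult_closed[OF St subgroup.subset[OF K]])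
    then show "Aut_star G M <#>\<^bsub>?A\<^esub> ?K \<subseteq> Aut_rel W R" by simp
  qed
  then show "Aut_rel W R = Aut_star G M <#>\<^bsub>Aut_mp W\<^esub> (Dsub <#>\<^bsub>Aut_mp W\<^esub> ?F)"
    unfolding K_eq by (simp add: set_mult_def)
  have conj_star: "s \<otimes>\<^bsub>?A\<^esub> k \<otimes>\<^bsub>?A\<^esub> inv\<^bsub>?A\<^esub> s \<in> ?K" if s: "s \<in> Aut_star G M" and k: "k \<in> ?K" for s k
  proof -
    obtain d f where df: "d \<in> Dsub" "f \<in> ?F" "k = d \<otimes>\<^bsub>?A\<^esub> f" using k by (auto simp: set_mult_def)
    have sA: "s \<in> carrier ?A" using s St by blast
    have dA: "d \<in> carrier ?A" using df D subgroup.subset by blast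
    have fA: "f \<in> carrier ?A" using df full_group_subset[OF equiv_R] by auto
    have "inv\<^bsub>?A\<^esub> s = inv\<^bsub>Aut_mp W\<^esub> s"
      using Q.m_inv_consistent[OF sub] s Aut_star_subset by auto
    then have 1: "s \<otimes>\<^bsub>?A\<^esub> d \<otimes>\<^bsub>?A\<^esub> inv\<^bsub>?A\<^esub> s \<in> Dsub" using Aut_star_conj_Dsub[OF s df(1)] by simp
    have 2: "s \<otimes>\<^bsub>?A\<^esub> f \<otimes>\<^bsub>?A\<^esub> inv\<^bsub>?A\<^esub> s \<in> ?F" by (rule normal.inv_op_closed2[OF F sA df(2)])
    have "s \<otimes>\<^bsub>?A\<^esub> k \<otimes>\<^bsub>?A\<^esub> inv\<^bsub>?A\<^esub> s =
        (s \<otimes>\<^bsub>?A\<^esub> d \<otimes>\<^bsub>?A\<^esub> inv\<^bsub>?A\<^esub> s) \<otimes>\<^bsub>?A\<^esub> (s \<otimes>\<^bsub>?A\<^esub> f \<otimes>\<^bsub>?A\<^esub> inv\<^bsub>?A\<^esub> s)"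
      unfolding df(3) by (rule A.conj_mult[OF sA dA fA])
    then show ?thesis using 1 2 unfolding set_mult_def by blast
  qed
  show "(Dsub <#>\<^bsub>Aut_mp W\<^esub> ?F) \<lhd> ?A"
    unfolding K_eq A.normal_inv_iff
  proof (intro conjI ballI K)
    fix a k assume a: "a \<in> carrier ?A" and k: "k \<in> ?K"
    obtain s k' where s: "s \<in> Aut_star G M" and k': "k' \<in> ?K" and a_eq: "a = s \<otimes>\<^bsub>?A\<^esub> k'"
      using factor[OF a] by blast
    have sA: "s \<in> carrier ?A" using s St by blast
    have kA: "k \<in> carrier ?A" "k' \<in> carrier ?A" using k k' subgroup.subset[OF K] by blast+
    have "k' \<otimes>\<^bsub>?A\<^esub> k \<otimes>\<^bsub>?A\<^esub> inv\<^bsub>?A\<^esub> k' \<in> ?K"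
      using K k k' by (intro subgroup.m_closed[OF K] subgroup.m_inv_closed[OF K])
    from conj_star[OF s this]
    show "a \<otimes>\<^bsub>?A\<^esub> k \<otimes>\<^bsub>?A\<^esub> inv\<^bsub>?A\<^esub> a \<in> ?K"
      unfolding a_eq A.inv_mult_group[OF sA kA(2)] using sA kA A.m_assoc A.m_closed A.inv_closed by simp
  qed
qed

end

theorem corollary8p10:
  fixes G :: "('g, 'm) monoid_scheme" and B :: "('b, 'n) monoid_scheme"
    and M :: "'x measure" and \<beta> :: "'b \<Rightarrow> 'x \<Rightarrow> 'x"
  defines "W \<equiv> bernoulli_space G M"
    and "R \<equiv> wreath_eqrel B G M \<beta>"
    and "D \<equiv> Aut_rel_equivariant G (bernoulli_space G M) (bernoulli_shift G M)
               (sum_eqrel G M (orbit_eqrel B M \<beta>))"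
  assumes "group G" and "countable (carrier G)" and "infinite (carrier G)"
    and "group B" and "countable (carrier B)" and "carrier B \<noteq> {\<one>\<^bsub>B\<^esub>}"
    and "standard_prob_space M"
    and "pmp_action B M \<beta>" and "ess_free B M \<beta>"
    and "\<And>N. N \<lhd> G \<Longrightarrow> finite N \<Longrightarrow> N = {\<one>\<^bsub>G\<^esub>}"
    and "Gctble_cocycle_superrigid G W (bernoulli_shift G M)"
  shows "Aut_rel W R = Aut_star G M <#>\<^bsub>Aut_mp W\<^esub> (D <#>\<^bsub>Aut_mp W\<^esub> full_group W R) \<and>
    (D <#>\<^bsub>Aut_mp W\<^esub> full_group W R) \<lhd> (Aut_mp W\<lparr>carrier := Aut_rel W R\<rparr>) \<and>
    D \<inter> full_group W R = (\<lambda>z. ae_class W (bernoulli_shift G M z)) ` group_center G"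
proof -
  have "wreath_pmp G B M \<beta>" by (intro wreath_pmp.intro assms)
  then interpret wreath_rigid G B M \<beta>
    using assms unfolding W_def by (intro wreath_rigid.intro wreath_rigid_axioms.intro)
  show ?thesis
    unfolding W_def R_def D_def
    using Aut_rel_product equivariant_Int_full_group by blast
qed

end
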